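(* Let $\epsilon\in(0,1)$, $\delta>0$, and let $\sigma\in\,]0,s_4^2]$ be such that $8\zeta_*(\sigma)\le\sqrt n$. Let $\Theta_\delta$ be a finite $\delta$-net of the unit sphere $\mathbb S_d=\{\theta\in\mathbb R^d:\|\theta\|=1\}$ and let $Q$ be a symmetric $d\times d$ matrix, depending on the sample, satisfying (whenever such a matrix exists) $\mathbf{Tr}(Q^2)\le\mathbf{Tr}(G^2)$ and $$B_-(\theta)\le\theta^\top Q\theta\le B_+(\theta),\qquad\theta\in\Theta_\delta .$$ Let $Q_+$ be the positive part of $Q$ (obtained by taking the positive parts of its eigenvalues). Then, with probability at least $1-2\epsilon$, for any $\theta\in\mathbb S_d$, $$\big|\max\{\theta^\top Q_+\theta,\sigma\}-\max\{N(\theta),\sigma\}\big|\le2\max\{N(\theta),\sigma\}\,B_*\big(N(\theta)\big)+7\delta\sqrt{\mathbf{Tr}(G^2)},$$ $$\big|\max\{\theta^\top Q_+\theta,\sigma\}-\max\{N(\theta),\sigma\}\big|\le2\max\{\theta^\top Q_+\theta,\sigma\}\,B_*\big(\min\{\theta^\top Q_+\theta,s_4^2\}\big)+7\delta\sqrt{\mathbf{Tr}(G^2)}.$$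
   Context: $X\in\mathbb R^d$ is a random vector of law $\mathrm P$, and $X_1,\dots,X_n$ is an i.i.d. sample from $\mathrm P$; $N(\theta)=\mathbb E[\langle\theta,X\rangle^2]$, $G=\mathbb E[XX^\top]$, $\mathbf{Tr}(G)=\mathbb E[\|X\|^2]$. The quantities $$s_4=\mathbb E[\|X\|^4]^{1/4},\qquad \kappa=\sup_{\theta\in\mathbb R^d,\ \mathbb E[\langle\theta,X\rangle^2]>0}\frac{\mathbb E[\langle\theta,X\rangle^4]}{\mathbb E[\langle\theta,X\rangle^2]^2}$$ are assumed finite, and $\kappa\ge3/2$. Let $\psi:\mathbb R\to\mathbb R$ be the odd function with $\psi(t)=-\log(1-t+t^2/2)$ for $0\le t\le1$ and $\psi(t)=\log 2$ for $t\ge1$. For $\lambda>0$ let $r_\lambda(\theta)=\frac1n\sum_{i=1}^n\psi(\langle\theta,X_i\rangle^2-\lambda)$, $\widehat\alpha_\lambda(\theta)=\sup\{\alpha\in\mathbb R_+: r_\lambda(\alpha\theta)\le0\}\in(0,+\infty]$, and $\widetilde N_\lambda(\theta)=\lambda/\widehat\alpha_\lambda(\theta)^2$ (equal to $0$ if $\widehat\alpha_\lambda(\theta)=+\infty$). Let $c=\frac{15}{8\log(2)(\sqrt2-1)}\exp\big(\frac{1+2\sqrt2}{2}\big)$, $a=1/2$, $K=1+\big\lceil a^{-1}\log\big(\frac{n}{72(2+c)\kappa^{1/2}}\big)\big\rceil$, assumed $\ge1$, and $\Lambda=\{(\lambda_j,\beta_j):0\le j<K\}$ with $$\lambda_j=\sqrt{\frac{2}{n(\kappa-1)}\Big(\frac{2+3c}{4(2+c)\kappa^{1/2}\exp(-ja)}+\log(K/\epsilon)\Big)},\qquad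 \beta_j=\sqrt{2(2+c)\kappa^{1/2}s_4^4\,n\exp[-(j-1/2)a]}.$$ For $(\lambda,\beta)\in\Lambda$ put $\xi=\frac{\kappa\lambda}{2}$, $\mu=\lambda(\kappa-1)+\frac{(2+c)\kappa^{1/2}s_4^2}{\beta}$, $\gamma=\frac\lambda2(\kappa-1)+\frac{(2+c)\kappa^{1/2}s_4^2}{\beta}+\frac{(2+3c)s_4^4}{2\beta^2\lambda}+\frac{\log(|\Lambda|/\epsilon)}{n\lambda}$, $\delta_{\lambda,\beta}=\frac{\beta}{2n\lambda}$, and for $t>0$, with $\tau=\delta_{\lambda,\beta}\lambda/t$, $$\Phi_-(t)=t\Big(1-\frac{\gamma+\tau}{1+\mu-\gamma-\tau}\Big)\ \text{if }\xi-\mu+2\gamma+2\tau<1,\qquad \Phi_-(t)=0\text{ otherwise},$$ $$\Phi_+(t)=t\Big(1+\frac{\gamma+\tau}{1-\mu-\gamma-2\tau}\Big)^{-1}\ \text{if }\xi+\mu+\gamma+2\tau<1,\qquad \Phi_+(t)=0\text{ otherwise},$$ with $\Phi_\pm(0)=0$ (these functions depend on $(\lambda,\beta)$), and $\Phi_+^{-1}(u)=\sup\{t\in\mathbb R_+:\Phi_+(t)\le u\}$. For $\theta\in\mathbb S_d$, $$B_-(\theta)=\max_{(\lambda,\beta)\in\Lambda}\Phi_-\big(\widetilde N_\lambda(\theta)\big),\qquad B_+(\theta)=\min_{(\lambda,\beta)\in\Lambda}\Phi_+^{-1}\big(\widetilde N_\lambda(\theta)\big).$$ A $\delta$-net of $\mathbb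 S_d$ is a set $\Theta_\delta\subset\mathbb S_d$ with $\sup_{\theta\in\mathbb S_d}\min_{\xi\in\Theta_\delta}\|\theta-\xi\|\le\delta$. Further, $$\zeta_*(t)=\sqrt{2.032(\kappa-1)\Big(\frac{0.73\,\mathbf{Tr}(G)}{t}+\log(K)+\log(\epsilon^{-1})\Big)}+\sqrt{\frac{98.5\,\kappa\,\mathbf{Tr}(G)}{t}},$$ $$B_*(t)=\frac{n^{-1/2}\zeta_*(\max\{t,\sigma\})}{1-4n^{-1/2}\zeta_*(\max\{t,\sigma\})}\ \text{ if }\big[6+(\kappa-1)^{-1}\big]\zeta_*(\max\{t,\sigma\})\le\sqrt n,\qquad B_*(t)=+\infty\text{ otherwise.}$$ "With probability at least $p$" means that the event contains a measurable event of probability at least $p$. *)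

theory Defs
  imports "HOL-Probability.Probability"
begin

text \<open>
  Throughout, \<open>P\<close> is the law of a random vector of \<open>real ^ 'd\<close>. A sample of size \<open>n\<close> is a
  function \<open>x\<close> on the indices \<open>{1..n}\<close>; it is applied to \<open>\<lambda>i\<in>{1..n}. X i \<omega>\<close>.
\<close>

subsection \<open>Moments of the law\<close>

definition quad_moment :: "(real ^ 'd) measure \<Rightarrow> real ^ 'd \<Rightarrow> real" where
  "quad_moment P \<theta> = (\<integral>x. (\<theta> \<bullet> x)\<^sup>2 \<partial>P)"

definition gram_matrix :: "(real ^ 'd) measure \<Rightarrow> real ^ 'd ^ 'd" where
  "gram_matrix P = (\<chi> i j. \<integral>x. x $ i * x $ j \<partial>P)"

definition s4 :: "(real ^ 'd) measure \<Rightarrow> real" where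
  "s4 P = root 4 (\<integral>x. norm x ^ 4 \<partial>P)"

definition kurtosis_ratios :: "(real ^ 'd) measure \<Rightarrow> real set" where
  "kurtosis_ratios P =
     {(\<integral>x. (\<theta> \<bullet> x) ^ 4 \<partial>P) / (\<integral>x. (\<theta> \<bullet> x)\<^sup>2 \<partial>P)\<^sup>2 | \<theta>. (\<integral>x. (\<theta> \<bullet> x)\<^sup>2 \<partial>P) > 0}"

text \<open>A real supremum: meaningful when \<^const>\<open>kurtosis_ratios\<close> is bounded above.\<close>

definition kappa :: "(real ^ 'd) measure \<Rightarrow> real" where
  "kappa P = Sup (kurtosis_ratios P)"

subsection \<open>The influence function and the preliminary estimator\<close>

definition psi_nonneg :: "real \<Rightarrow> real" where
  "psi_nonneg t = (if t \<le> 1 then - ln (1 - t + t\<^sup>2 / 2) else ln 2)"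

definition psi :: "real \<Rightarrow> real" where
  "psi t = (if t \<ge> 0 then psi_nonneg t else - psi_nonneg (- t))"

definition r_emp :: "nat \<Rightarrow> (nat \<Rightarrow> real ^ 'd) \<Rightarrow> real \<Rightarrow> real ^ 'd \<Rightarrow> real" where
  "r_emp n x l \<theta> = (1 / real n) * (\<Sum>i = 1..n. psi ((\<theta> \<bullet> x i)\<^sup>2 - l))"

definition alpha_hat :: "nat \<Rightarrow> (nat \<Rightarrow> real ^ 'd) \<Rightarrow> real \<Rightarrow> real ^ 'd \<Rightarrow> ereal" where
  "alpha_hat n x l \<theta> = Sup (ereal ` {\<alpha>. \<alpha> \<ge> 0 \<and> r_emp n x l (\<alpha> *\<^sub>R \<theta>) \<le> 0})"

definition N_tilde :: "nat \<Rightarrow> (nat \<Rightarrow> real ^ 'd) \<Rightarrow> real \<Rightarrow> real ^ 'd \<Rightarrow> real" where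
  "N_tilde n x l \<theta> =
     (if alpha_hat n x l \<theta> = \<infinity> then 0 else l / (real_of_ereal (alpha_hat n x l \<theta>))\<^sup>2)"

subsection \<open>The grid of parameters\<close>

definition c_const :: real where
  "c_const = 15 / (8 * ln 2 * (sqrt 2 - 1)) * exp ((1 + 2 * sqrt 2) / 2)"

definition a_const :: real where
  "a_const = 1 / 2"

definition grid_size :: "(real ^ 'd) measure \<Rightarrow> nat \<Rightarrow> int" where
  "grid_size P n =
     1 + \<lceil>inverse a_const * ln (real n / (72 * (2 + c_const) * sqrt (kappa P)))\<rceil>"

definition lambda_grid :: "(real ^ 'd) measure \<Rightarrow> nat \<Rightarrow> real \<Rightarrow> nat \<Rightarrow> real" where
  "lambda_grid P n \<epsilon> j =
     sqrt (2 / (real n * (kappa P - 1)) *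
       ((2 + 3 * c_const) / (4 * (2 + c_const) * sqrt (kappa P) * exp (- (real j * a_const)))
        + ln (real_of_int (grid_size P n) / \<epsilon>)))"

definition beta_grid :: "(real ^ 'd) measure \<Rightarrow> nat \<Rightarrow> nat \<Rightarrow> real" where
  "beta_grid P n j =
     sqrt (2 * (2 + c_const) * sqrt (kappa P) * s4 P ^ 4 * real n
           * exp (- ((real j - 1 / 2) * a_const)))"

definition Lambda_grid :: "(real ^ 'd) measure \<Rightarrow> nat \<Rightarrow> real \<Rightarrow> (real \<times> real) set" where
  "Lambda_grid P n \<epsilon> =
     {(lambda_grid P n \<epsilon> j, beta_grid P n j) | j. int j < grid_size P n}"

subsection \<open>The confidence bounds\<close>

definition xi_coef :: "(real ^ 'd) measure \<Rightarrow> real \<Rightarrow> real" where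
  "xi_coef P l = kappa P * l / 2"

definition mu_coef :: "(real ^ 'd) measure \<Rightarrow> real \<Rightarrow> real \<Rightarrow> real" where
  "mu_coef P l b = l * (kappa P - 1) + (2 + c_const) * sqrt (kappa P) * (s4 P)\<^sup>2 / b"

definition gamma_coef :: "(real ^ 'd) measure \<Rightarrow> nat \<Rightarrow> real \<Rightarrow> real \<Rightarrow> real \<Rightarrow> real" where
  "gamma_coef P n \<epsilon> l b =
     l / 2 * (kappa P - 1) + (2 + c_const) * sqrt (kappa P) * (s4 P)\<^sup>2 / b
     + (2 + 3 * c_const) * s4 P ^ 4 / (2 * b\<^sup>2 * l)
     + ln (real (card (Lambda_grid P n \<epsilon>)) / \<epsilon>) / (real n * l)"

definition delta_coef :: "nat \<Rightarrow> real \<Rightarrow> real \<Rightarrow> real" where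
  "delta_coef n l b = b / (2 * real n * l)"

definition Phi_minus ::
    "(real ^ 'd) measure \<Rightarrow> nat \<Rightarrow> real \<Rightarrow> real \<Rightarrow> real \<Rightarrow> real \<Rightarrow> real" where
  "Phi_minus P n \<epsilon> l b t =
     (let \<xi> = xi_coef P l; \<mu> = mu_coef P l b; \<gamma> = gamma_coef P n \<epsilon> l b;
          \<tau> = delta_coef n l b * l / t
      in if t > 0 \<and> \<xi> - \<mu> + 2 * \<gamma> + 2 * \<tau> < 1
         then t * (1 - (\<gamma> + \<tau>) / (1 + \<mu> - \<gamma> - \<tau>)) else 0)"

definition Phi_plus ::
    "(real ^ 'd) measure \<Rightarrow> nat \<Rightarrow> real \<Rightarrow> real \<Rightarrow> real \<Rightarrow> real \<Rightarrow> real" where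
  "Phi_plus P n \<epsilon> l b t =
     (let \<xi> = xi_coef P l; \<mu> = mu_coef P l b; \<gamma> = gamma_coef P n \<epsilon> l b;
          \<tau> = delta_coef n l b * l / t
      in if t > 0 \<and> \<xi> + \<mu> + \<gamma> + 2 * \<tau> < 1
         then t * inverse (1 + (\<gamma> + \<tau>) / (1 - \<mu> - \<gamma> - 2 * \<tau>)) else 0)"

text \<open>The generalized inverse takes the value \<open>\<infinity>\<close>, for instance when \<^const>\<open>Phi_plus\<close> vanishes
  identically.\<close>

definition Phi_plus_inv ::
    "(real ^ 'd) measure \<Rightarrow> nat \<Rightarrow> real \<Rightarrow> real \<Rightarrow> real \<Rightarrow> real \<Rightarrow> ereal" where
  "Phi_plus_inv P n \<epsilon> l b u = Sup (ereal ` {t. t \<ge> 0 \<and> Phi_plus P n \<epsilon> l b t \<le> u})"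

definition B_minus ::
    "(real ^ 'd) measure \<Rightarrow> nat \<Rightarrow> real \<Rightarrow> (nat \<Rightarrow> real ^ 'd) \<Rightarrow> real ^ 'd \<Rightarrow> real" where
  "B_minus P n \<epsilon> x \<theta> =
     (MAX (l, b)\<in>Lambda_grid P n \<epsilon>. Phi_minus P n \<epsilon> l b (N_tilde n x l \<theta>))"

definition B_plus ::
    "(real ^ 'd) measure \<Rightarrow> nat \<Rightarrow> real \<Rightarrow> (nat \<Rightarrow> real ^ 'd) \<Rightarrow> real ^ 'd \<Rightarrow> ereal" where
  "B_plus P n \<epsilon> x \<theta> =
     (MIN (l, b)\<in>Lambda_grid P n \<epsilon>. Phi_plus_inv P n \<epsilon> l b (N_tilde n x l \<theta>))"

subsection \<open>Nets and matrices\<close>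

definition finite_net :: "real \<Rightarrow> (real ^ 'd) set \<Rightarrow> bool" where
  "finite_net \<delta> \<Theta> \<longleftrightarrow> finite \<Theta> \<and> \<Theta> \<noteq> {} \<and> \<Theta> \<subseteq> sphere 0 1 \<and>
     (SUP \<theta>\<in>sphere 0 1. MIN \<xi>\<in>\<Theta>. norm (\<theta> - \<xi>)) \<le> \<delta>"

definition diagonal_matrix :: "real ^ 'd \<Rightarrow> real ^ 'd ^ 'd" where
  "diagonal_matrix v = (\<chi> i j. if i = j then v $ i else 0)"

text \<open>For symmetric \<open>Q\<close> a spectral decomposition exists, and the matrix below does not depend on
  the one that is chosen.\<close>

definition positive_part :: "real ^ 'd ^ 'd \<Rightarrow> real ^ 'd ^ 'd" where
  "positive_part Q = (THE R. \<exists>U v. orthogonal_matrix U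
      \<and> Q = U ** diagonal_matrix v ** transpose U
      \<and> R = U ** diagonal_matrix (\<chi> i. max (v $ i) 0) ** transpose U)"

definition admissible ::
    "(real ^ 'd) measure \<Rightarrow> nat \<Rightarrow> real \<Rightarrow> (real ^ 'd) set \<Rightarrow> (nat \<Rightarrow> real ^ 'd) \<Rightarrow>
     real ^ 'd ^ 'd \<Rightarrow> bool" where
  "admissible P n \<epsilon> \<Theta> x S \<longleftrightarrow>
     transpose S = S \<and>
     trace (S ** S) \<le> trace (gram_matrix P ** gram_matrix P) \<and>
     (\<forall>\<theta>\<in>\<Theta>. B_minus P n \<epsilon> x \<theta> \<le> \<theta> \<bullet> (S *v \<theta>) \<and> ereal (\<theta> \<bullet> (S *v \<theta>)) \<le> B_plus P n \<epsilon> x \<theta>)"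

subsection \<open>The error bound\<close>

definition zeta_star :: "(real ^ 'd) measure \<Rightarrow> nat \<Rightarrow> real \<Rightarrow> real \<Rightarrow> real" where
  "zeta_star P n \<epsilon> t =
     sqrt (2.032 * (kappa P - 1) *
       (0.73 * trace (gram_matrix P) / t + ln (real_of_int (grid_size P n)) + ln (inverse \<epsilon>)))
     + sqrt (98.5 * kappa P * trace (gram_matrix P) / t)"

definition B_star :: "(real ^ 'd) measure \<Rightarrow> nat \<Rightarrow> real \<Rightarrow> real \<Rightarrow> real \<Rightarrow> ereal" where
  "B_star P n \<epsilon> \<sigma> t =
     (let z = zeta_star P n \<epsilon> (max t \<sigma>)
      in if (6 + inverse (kappa P - 1)) * z \<le> sqrt (real n)
         then ereal ((z / sqrt (real n)) / (1 - 4 * (z / sqrt (real n)))) else \<infinity>)"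

end

theory Submission
  imports Defs
begin

text \<open>
  Replace \<open>\<theta>\<close> by a Gaussian vector \<open>\<theta>'\<close> of mean \<open>\<theta>\<close> and covariance \<open>I / \<beta>\<close>, and let
  \<open>W = \<theta>' \<bullet> x\<close> and \<open>v = (norm x)\<^sup>2 / \<beta>\<close>. Then \<open>W\<^sup>2 - v - \<lambda>\<close> has mean
  \<open>(\<theta> \<bullet> x)\<^sup>2 - \<lambda>\<close>, and its fluctuations are compensated by a term \<open>32 * W\<^sup>2 * v + 32 * v\<^sup>2\<close>:
  the mean over \<open>\<theta>'\<close> of \<open>ln (1 + z + z\<^sup>2 / 2 + 32 * W\<^sup>2 * v + 32 * v\<^sup>2)\<close>, with
  \<open>z = \<plusminus> (W\<^sup>2 - v - \<lambda>)\<close>, is at least \<open>\<plusminus> psi ((\<theta> \<bullet> x)\<^sup>2 - \<lambda>)\<close>. Being linear in the law of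
  \<open>\<theta>'\<close>, this mean is controlled uniformly in \<open>\<theta>\<close> by the Donsker-Varadhan and Markov inequalities.
  The resulting two-sided bound of \<^const>\<open>r_emp\<close> by a quadratic polynomial in the moment \<open>N\<close>, read at
  \<^const>\<open>alpha_hat\<close>, places \<open>N\<close> between \<^const>\<open>B_minus\<close> and \<^const>\<open>B_plus\<close>. Hence the Gram matrix is
  admissible, and so is \<open>Q\<close>.

  At a point of the net, \<open>\<theta> \<bullet> (Q *v \<theta>)\<close> and \<open>N\<close> are then both compatible with the same values of
  \<^const>\<open>N_tilde\<close>, and the pair of the grid adapted to the smaller of the two shows that they are close.
  From the net to the sphere one loses at most \<open>7 * \<delta>\<close> times the Frobenius norm \<open>F\<close> of the Gram
  matrix: the two quadratic forms vary by at most \<open>2 * \<delta> * F\<close>, the eigenvalues of \<open>Q\<close> are at least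
  \<open>- 2 * \<delta> * F\<close>, and the error bound is nondecreasing with slope at most \<open>1 / 4\<close>.
\<close>

text \<open>Since the logarithm is concave, averaging it over \<open>\<theta>'\<close> can push it
  below its value at the centre; the added term repays this loss. It raises the mean by at most
  \<open>34 * m\<^sup>2 * v + 65 * v\<^sup>2\<close>, the compensated variance included, and there
  is room for that because \<open>c_const \<ge> 43\<close> gives \<open>2 + c_const \<ge> 34\<close>
  and \<open>(2 + 3 * c_const) / 2 \<ge> 65\<close>.

  The multiple of \<open>\<theta>\<close> at which \<open>r_emp\<close> changes sign depends on the
  sample. The deviation bound must therefore hold at once for vectors of every length. Length enters
  through the relative entropy \<open>b * (norm \<theta>)\<^sup>2 / 2\<close>, which becomes the
  \<open>delta_coef\<close> term and then \<open>\<tau>\<close>.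

  Randomness is confined to \<open>emp_bounds\<close>; all that follows is deterministic. One index
  suffices for the grid because, at scale \<open>s\<close>, both parameters are tuned through the
  single ratio \<open>(s4 P)\<^sup>2 / s\<close>.\<close>

subsection \<open>Gaussian perturbation of the influence function\<close>

text \<open>A nondecreasing lower bound of \<open>1 + z + z\<^sup>2 / 2\<close>, equal to it for \<open>z \<ge> -1\<close>.\<close>

definition lower_quad :: "real \<Rightarrow> real" where
  "lower_quad z = (1 + (max (1 + z) 0)\<^sup>2) / 2"

lemma lower_quad_ge_half: "lower_quad z \<ge> 1 / 2"
  by (simp add: lower_quad_def)

lemma lower_quad_le: "lower_quad z \<le> 1 + z + z\<^sup>2 / 2"
proof -
  have "(max (1 + z) 0)\<^sup>2 \<le> (1 + z)\<^sup>2" by (auto simp: max_def)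
  then show ?thesis by (simp add: lower_quad_def power2_eq_square field_simps)
qed

lemma lower_quad_mono: "x \<le> y \<Longrightarrow> lower_quad x \<le> lower_quad y"
  unfolding lower_quad_def by (intro divide_right_mono add_left_mono power_mono) (auto simp: max_def)

text \<open>Clearing denominators leaves \<open>d\<^sup>2\<close> times a quadratic in
  \<open>d\<close>, which is nonnegative because \<open>b\<^sup>2 \<le> P\<^sup>2 * c\<close>. With
  \<open>e = 1 + t\<close> the inverted expression is \<open>1 + z + z\<^sup>2 / 2\<close> at
  \<open>z = t + d\<close>, expanded around \<open>t\<close>.\<close>

lemma inverse_quadratic_le:
  fixes e d :: real
  assumes "0 \<le> e" "e \<le> 1"
  defines "P \<equiv> (1 + e\<^sup>2) / 2"
  shows "inverse (P + e * d + d\<^sup>2 / 2) \<le> inverse P - e / P\<^sup>2 * d + d\<^sup>2 / 2"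
proof -
  have P: "1 / 2 \<le> P" "P \<le> 1" using assms by (auto simp: P_def power_le_one)
  have e2: "e\<^sup>2 = 2 * P - 1" unfolding P_def by (simp add: field_simps)
  define b where "b = e * (1 - P\<^sup>2) / 2"
  define c where "c = P / 2 - e\<^sup>2 + P ^ 3 / 2"
  have c: "c = (P - 1)\<^sup>2 * (P + 2) / 2" unfolding c_def e2 by (simp add: power2_eq_square power3_eq_cube algebra_simps)
  have b2: "b\<^sup>2 = (2 * P - 1) * (1 + P)\<^sup>2 * (P - 1)\<^sup>2 / 4"
    unfolding b_def power_divide power_mult_distrib e2 by (simp add: power2_eq_square algebra_simps)
  have "(2 * P - 1) * (1 + P)\<^sup>2 \<le> 2 * P\<^sup>2 * (P + 2)"
  proof -
    have "2 * P\<^sup>2 * (P + 2) - (2 * P - 1) * (1 + P)\<^sup>2 = P\<^sup>2 + 1"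
      by (simp add: power2_eq_square algebra_simps)
    then show ?thesis using zero_le_power2[of P] by linarith
  qed
  then have "(2 * P - 1) * (1 + P)\<^sup>2 * (P - 1)\<^sup>2 \<le> 2 * P\<^sup>2 * (P + 2) * (P - 1)\<^sup>2"
    by (rule mult_right_mono) simp
  then have disc: "b\<^sup>2 \<le> P\<^sup>2 * c" unfolding b2 c by (simp add: algebra_simps)
  have "c - b * d + P\<^sup>2 * d\<^sup>2 / 4 = (P * d / 2 - b / P)\<^sup>2 + (P\<^sup>2 * c - b\<^sup>2) / P\<^sup>2"
    using P by (simp add: field_simps power2_eq_square)
  then have pos: "c - b * d + P\<^sup>2 * d\<^sup>2 / 4 \<ge> 0"
    using disc by simp
  have Y: "P + e * d + d\<^sup>2 / 2 = (1 + (e + d)\<^sup>2) / 2" 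
    by (simp add: P_def power2_eq_square field_simps)
  have Ypos: "P + e * d + d\<^sup>2 / 2 > 0" unfolding Y by (simp add: add_pos_nonneg)
  have "(inverse P - e / P\<^sup>2 * d + d\<^sup>2 / 2) * (P + e * d + d\<^sup>2 / 2) - 1
      = d\<^sup>2 * (c - b * d + P\<^sup>2 * d\<^sup>2 / 4) / P\<^sup>2"
    unfolding c_def b_def using P by (simp add: field_simps power2_eq_square power3_eq_cube)
  also have "\<dots> \<ge> 0" using pos by simp
  finally have "1 \<le> (inverse P - e / P\<^sup>2 * d + d\<^sup>2 / 2) * (P + e * d + d\<^sup>2 / 2)" by simp
  then show ?thesis using Ypos by (simp add: field_simps)
qed

text \<open>For \<open>t \<ge> 0\<close> the parabola is \<open>1 - z + z\<^sup>2 / 2\<close>,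
  because \<open>(1 + z + z\<^sup>2 / 2) * (1 - z + z\<^sup>2 / 2) = 1 + z ^ 4 / 4\<close>; for
  \<open>t < 0\<close> it is tangent to \<open>1 / lower_quad\<close> at \<open>t\<close>. Its
  leading coefficient 1/2 makes its mean \<open>q0 + V / 2\<close> when \<open>z\<close> has mean
  \<open>t\<close> and variance \<open>V\<close>. The bound \<open>1 / 2 \<le> q0\<close> expresses
  \<open>psi t \<le> ln 2\<close>.\<close>

lemma inverse_lower_quad_le:
  assumes "-1 \<le> t" "t \<le> 1"
  obtains q0 b where "q0 = exp (- psi t)" "1 / 2 \<le> q0"
    "\<And>z. inverse (lower_quad z) \<le> q0 + b * (z - t) + (z - t)\<^sup>2 / 2"
proof (cases "t \<ge> 0")
  case True
  have pos: "1 - t + t\<^sup>2 / 2 \<ge> 1 / 2"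
  proof -
    have "1 - t + t\<^sup>2 / 2 = 1 / 2 + (1 - t)\<^sup>2 / 2" by (simp add: power2_eq_square field_simps)
    then show ?thesis by simp
  qed
  have "inverse (lower_quad z) \<le> (1 - t + t\<^sup>2 / 2) + (t - 1) * (z - t) + (z - t)\<^sup>2 / 2" for z
  proof -
    have eq: "(1 - t + t\<^sup>2 / 2) + (t - 1) * (z - t) + (z - t)\<^sup>2 / 2 = 1 - z + z\<^sup>2 / 2"
      by (simp add: power2_eq_square field_simps)
    show ?thesis
    proof (cases "z \<ge> -1")
      case True
      have p: "lower_quad z = 1 + z + z\<^sup>2 / 2" using True by (simp add: lower_quad_def power2_eq_square field_simps)
      have "(1 + z + z\<^sup>2 / 2) * (1 - z + z\<^sup>2 / 2) = 1 + z ^ 4 / 4"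
        by (simp add: power2_eq_square power4_eq_xxxx field_simps)
      then have "1 \<le> lower_quad z * (1 - z + z\<^sup>2 / 2)" unfolding p by simp
      then show ?thesis unfolding eq using lower_quad_ge_half[of z] by (simp add: field_simps)
    next
      case False
      then have "inverse (lower_quad z) = 2" by (simp add: lower_quad_def)
      moreover have "z\<^sup>2 \<ge> 0" by simp
      ultimately show ?thesis unfolding eq using False by linarith
    qed
  qed
  moreover have "1 - t + t\<^sup>2 / 2 = exp (- psi t)"
    using True assms pos by (simp add: psi_def psi_nonneg_def)
  ultimately show ?thesis using pos that by metis
next
  case False
  define e where "e = 1 + t"
  define P where "P = (1 + e\<^sup>2) / 2"
  have e: "0 \<le> e" "e \<le> 1" using False assms by (auto simp: e_def)
  have P: "1 / 2 \<le> P" "P \<le> 1" using e by (auto simp: P_def power_le_one)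
  have Pt: "P = 1 + t + t\<^sup>2 / 2" by (simp add: P_def e_def power2_eq_square field_simps)
  have *: "inverse (lower_quad z) \<le> inverse P - e / P\<^sup>2 * (z - t) + (z - t)\<^sup>2 / 2" for z
  proof (cases "z \<ge> -1")
    case True
    have "lower_quad z = P + e * (z - t) + (z - t)\<^sup>2 / 2"
      using True by (simp add: lower_quad_def Pt e_def power2_eq_square field_simps)
    then show ?thesis using inverse_quadratic_le[OF e, of "z - t"] by (simp add: P_def)
  next
    case False
    \<comment> \<open>To the left of -1 the inverse is constantly 2, while the parabola is
      nonincreasing there and already at least 2 at -1.\<close>
    have "P + e * (-1 - t) + (-1 - t)\<^sup>2 / 2 = 1 / 2"
      by (simp add: Pt e_def power2_eq_square field_simps)
    then have "2 \<le> inverse P - e / P\<^sup>2 * (-1 - t) + (-1 - t)\<^sup>2 / 2"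
      using inverse_quadratic_le[OF e, of "-1 - t", folded P_def] by (simp only:) simp
    moreover have "e / P\<^sup>2 * (-1 - t) \<ge> e / P\<^sup>2 * (z - t)"
      using False e by (intro mult_left_mono) auto
    moreover have "(-1 - t)\<^sup>2 \<le> (z - t)\<^sup>2"
      using False assms by (intro abs_le_square_iff[THEN iffD1]) auto
    moreover have "inverse (lower_quad z) = 2" using False by (simp add: lower_quad_def)
    ultimately show ?thesis by linarith
  qed
  have "exp (- psi t) = inverse P"
    using False assms P by (simp add: psi_def psi_nonneg_def Pt exp_minus)
  moreover have "inverse P \<ge> 1 / 2" using P by (simp add: field_simps)
  ultimately show ?thesis using that[of "inverse P" "- (e / P\<^sup>2)"] * by simp
qed

text \<open>The weight \<open>H / (Q + H)\<close> optimises the bound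
  \<open>1 / (1 / Q + 1 / H) \<le> w\<^sup>2 Q + (1 - w)\<^sup>2 H\<close> for the parallel sum, whose right-hand side
  is linear in \<open>Q\<close> and \<open>H\<close> and can be integrated.\<close>

lemma inverse_add_le:
  fixes a b w :: real
  assumes "a > 0" "b > 0"
  shows "inverse (a + b) \<le> w\<^sup>2 * inverse a + (1 - w)\<^sup>2 * inverse b"
proof -
  have "(w\<^sup>2 * inverse a + (1 - w)\<^sup>2 * inverse b) * (a + b) - 1 = (w * b - (1 - w) * a)\<^sup>2 / (a * b)"
    using assms by (simp add: field_simps power2_eq_square)
  also have "\<dots> \<ge> 0" using assms by simp
  finally show ?thesis using assms by (simp add: field_simps)
qed

text \<open>The averaged expressions are dominated by polynomials of degree 4 in the perturbation,
  so four moments suffice. The value \<open>v = 0\<close> is included because \<open>x = 0\<close>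
  leads to a degenerate perturbation.\<close>

locale gaussian_moments = prob_space G for G :: "'a measure" +
  fixes \<eta> :: "'a \<Rightarrow> real" and v :: real
  assumes meas[measurable]: "\<eta> \<in> borel_measurable G"
    and int1: "integrable G \<eta>" and int2: "integrable G (\<lambda>x. (\<eta> x)\<^sup>2)"
    and int3: "integrable G (\<lambda>x. (\<eta> x) ^ 3)" and int4: "integrable G (\<lambda>x. (\<eta> x) ^ 4)"
    and mom1: "(\<integral>x. \<eta> x \<partial>G) = 0" and mom2: "(\<integral>x. (\<eta> x)\<^sup>2 \<partial>G) = v"
    and mom3: "(\<integral>x. (\<eta> x) ^ 3 \<partial>G) = 0" and mom4: "(\<integral>x. (\<eta> x) ^ 4 \<partial>G) = 3 * v\<^sup>2"
begin

lemma has_integral_quartic: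
  assumes "\<And>x. f x = c0 + c1 * \<eta> x + c2 * (\<eta> x)\<^sup>2 + c3 * (\<eta> x) ^ 3 + c4 * (\<eta> x) ^ 4"
  shows "integrable G f" "(\<integral>x. f x \<partial>G) = c0 + c2 * v + 3 * c4 * v\<^sup>2"
proof -
  have f: "f = (\<lambda>x. c0 + c1 * \<eta> x + c2 * (\<eta> x)\<^sup>2 + c3 * (\<eta> x) ^ 3 + c4 * (\<eta> x) ^ 4)"
    using assms by auto
  show "integrable G f" unfolding f using int1 int2 int3 int4 by auto
  show "(\<integral>x. f x \<partial>G) = c0 + c2 * v + 3 * c4 * v\<^sup>2"
    unfolding f using int1 int2 int3 int4 by (simp add: mom1 mom2 mom3 mom4 prob_space)
qed

end

text \<open>The last two terms compensate for the variance \<open>4 * m\<^sup>2 * v + 2 * v\<^sup>2\<close> of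
  \<open>w\<^sup>2 - v\<close> when \<open>w\<close> is Gaussian with mean \<open>m\<close> and variance \<open>v\<close>.\<close>

definition pert :: "real \<Rightarrow> real \<Rightarrow> real \<Rightarrow> real \<Rightarrow> real" where
  "pert \<sigma> l v w = lower_quad (\<sigma> * (w\<^sup>2 - v - l)) + 32 * w\<^sup>2 * v + 32 * v\<^sup>2"

definition pert_poly :: "real \<Rightarrow> real \<Rightarrow> real \<Rightarrow> real \<Rightarrow> real" where
  "pert_poly \<sigma> l v w =
     1 + \<sigma> * (w\<^sup>2 - v - l) + (\<sigma> * (w\<^sup>2 - v - l))\<^sup>2 / 2 + 32 * w\<^sup>2 * v + 32 * v\<^sup>2"

lemma pert_le_poly: "pert \<sigma> l v w \<le> pert_poly \<sigma> l v w"
  unfolding pert_def pert_poly_def by (intro add_right_mono lower_quad_le)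

lemma pert_ge_half: "v \<ge> 0 \<Longrightarrow> pert \<sigma> l v w \<ge> 1 / 2"
  using lower_quad_ge_half[of "\<sigma> * (w\<^sup>2 - v - l)"] unfolding pert_def by (intro add_increasing2) auto

lemma psi_le_ln_lower_quad: "psi t \<le> ln (lower_quad t)"
proof -
  consider "t \<le> -1" | "-1 \<le> t" "t \<le> 1" | "t \<ge> 1" by linarith
  then show ?thesis
  proof cases
    case 1
    then have "psi t \<le> ln (1/2)" by (auto simp: psi_def psi_nonneg_def ln_div power2_eq_square)
    also have "\<dots> \<le> ln (lower_quad t)" using lower_quad_ge_half[of t] by simp
    finally show ?thesis .
  next
    case 2
    obtain q0 b where q: "q0 = exp (- psi t)" "1 / 2 \<le> q0"
      "\<And>z. inverse (lower_quad z) \<le> q0 + b * (z - t) + (z - t)\<^sup>2 / 2" using inverse_lower_quad_le[OF 2] by metis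
    have "inverse (lower_quad t) \<le> inverse (exp (psi t))" using q(3)[of t] q(1) by (simp add: exp_minus)
    then have "exp (psi t) \<le> lower_quad t" using lower_quad_ge_half[of t] by (simp add: field_simps)
    then show ?thesis using lower_quad_ge_half[of t] by (simp add: ln_ge_iff)
  next
    case 3
    then have "psi t = ln 2" by (auto simp: psi_def psi_nonneg_def ln_div)
    also have "\<dots> \<le> ln (lower_quad t)" using lower_quad_mono[OF 3] by (simp add: lower_quad_def power2_eq_square)
    finally show ?thesis .
  qed
qed

lemma abs_ln_le: "1 / 2 \<le> (y::real) \<Longrightarrow> \<bar>ln y\<bar> \<le> y + ln 2"
proof -
  assume y: "1 / 2 \<le> y"
  have "ln y \<le> y - 1" using y by (intro ln_le_minus_one) auto
  moreover have "ln (1/2) \<le> ln y" using y by simp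
  moreover have "ln (2::real) \<ge> 0" by simp
  moreover have "ln (1 / 2) = - ln (2::real)" by (simp add: ln_div)
  ultimately show ?thesis using y unfolding abs_le_iff by linarith
qed

context gaussian_moments
begin

lemma integral_pert_poly:
  shows "integrable G (\<lambda>x. pert_poly \<sigma> l v (m + \<eta> x))"
    and "(\<integral>x. pert_poly \<sigma> l v (m + \<eta> x) \<partial>G)
      = 1 + \<sigma> * (m\<^sup>2 - l) + \<sigma>\<^sup>2 * (m\<^sup>2 - l)\<^sup>2 / 2 + (2 * \<sigma>\<^sup>2 + 32) * m\<^sup>2 * v + (\<sigma>\<^sup>2 + 64) * v\<^sup>2"
proof -
  have "pert_poly \<sigma> l v (m + \<eta> x)
      = (1 + \<sigma> * (m\<^sup>2 - v - l) + (\<sigma> * (m\<^sup>2 - v - l))\<^sup>2 / 2 + 32 * m\<^sup>2 * v + 32 * v\<^sup>2)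
        + (2 * m * \<sigma> + 2 * m * \<sigma>\<^sup>2 * (m\<^sup>2 - v - l) + 64 * m * v) * \<eta> x
        + (\<sigma> + \<sigma>\<^sup>2 * (m\<^sup>2 - v - l) + 2 * m\<^sup>2 * \<sigma>\<^sup>2 + 32 * v) * (\<eta> x)\<^sup>2
        + (2 * m * \<sigma>\<^sup>2) * (\<eta> x) ^ 3 + (\<sigma>\<^sup>2 / 2) * (\<eta> x) ^ 4" for x
    by (simp add: pert_poly_def power2_eq_square power3_eq_cube power4_eq_xxxx field_simps)
  note * = has_integral_quartic[of "\<lambda>x. pert_poly \<sigma> l v (m + \<eta> x)", OF this]
  show "integrable G (\<lambda>x. pert_poly \<sigma> l v (m + \<eta> x))" by (rule *(1))
  show "(\<integral>x. pert_poly \<sigma> l v (m + \<eta> x) \<partial>G)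
      = 1 + \<sigma> * (m\<^sup>2 - l) + \<sigma>\<^sup>2 * (m\<^sup>2 - l)\<^sup>2 / 2 + (2 * \<sigma>\<^sup>2 + 32) * m\<^sup>2 * v + (\<sigma>\<^sup>2 + 64) * v\<^sup>2"
    unfolding *(2) by (simp add: power2_eq_square algebra_simps add_divide_distrib diff_divide_distrib)
qed

lemma pert_integrable:
  assumes "v \<ge> 0"
  shows "integrable G (\<lambda>x. pert \<sigma> l v (m + \<eta> x))" "integrable G (\<lambda>x. ln (pert \<sigma> l v (m + \<eta> x)))"
proof -
  have [measurable]: "(\<lambda>x. pert \<sigma> l v (m + \<eta> x)) \<in> borel_measurable G"
    unfolding pert_def lower_quad_def by measurable
  show A: "integrable G (\<lambda>x. pert \<sigma> l v (m + \<eta> x))"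
  proof (rule Bochner_Integration.integrable_bound[OF integral_pert_poly(1)])
    show "AE x in G. norm (pert \<sigma> l v (m + \<eta> x)) \<le> norm (pert_poly \<sigma> l v (m + \<eta> x))"
    proof (rule AE_I2)
      fix x
      show "norm (pert \<sigma> l v (m + \<eta> x)) \<le> norm (pert_poly \<sigma> l v (m + \<eta> x))"
        using pert_ge_half[OF assms, of \<sigma> l "m + \<eta> x"] pert_le_poly[of \<sigma> l v "m + \<eta> x"] by simp
    qed
  qed measurable
  show "integrable G (\<lambda>x. ln (pert \<sigma> l v (m + \<eta> x)))"
  proof (rule Bochner_Integration.integrable_bound[of _ "\<lambda>x. pert \<sigma> l v (m + \<eta> x) + ln 2"])
    show "integrable G (\<lambda>x. pert \<sigma> l v (m + \<eta> x) + ln 2)" using A by simp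
    show "AE x in G. norm (ln (pert \<sigma> l v (m + \<eta> x))) \<le> norm (pert \<sigma> l v (m + \<eta> x) + ln 2)"
    proof (rule AE_I2)
      fix x
      show "norm (ln (pert \<sigma> l v (m + \<eta> x))) \<le> norm (pert \<sigma> l v (m + \<eta> x) + ln 2)"
        using abs_ln_le[OF pert_ge_half[OF assms, of \<sigma> l "m + \<eta> x"]] pert_ge_half[OF assms, of \<sigma> l "m + \<eta> x"]
        by simp
    qed
  qed measurable
qed

text \<open>The logarithm of \<open>y\<close> is at least \<open>1 - ln q0 - 1 / (q0 * y)\<close>,
  so it suffices that the inverse has mean at most \<open>q0 = exp (- psi t)\<close>. The part
  \<open>lower_quad\<close> has an inverse of mean at most \<open>Q = q0 + V / 2\<close>, the
  compensator an inverse of mean at most \<open>1 / (2 * V)\<close>. Their parallel sum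
  \<open>Q / (2 * V * Q + 1)\<close> is at most \<open>q0\<close> exactly when
  \<open>q0 * Q \<ge> 1 / 4\<close>, which holds as both are at least 1/2.\<close>

lemma psi_le_integral_aux:
  assumes v: "v > 0" and s: "\<sigma>\<^sup>2 = 1" and t: "-1 \<le> t" "t \<le> 1"
  shows "psi t \<le> (\<integral>x. ln (lower_quad (t + \<sigma> * (2 * m * \<eta> x + (\<eta> x)\<^sup>2 - v)) + 32 * (m + \<eta> x)\<^sup>2 * v + 32 * v\<^sup>2) \<partial>G)"
proof -
  obtain q0 b where q0: "q0 = exp (- psi t)" "1 / 2 \<le> q0"
    and q: "\<And>z. inverse (lower_quad z) \<le> q0 + b * (z - t) + (z - t)\<^sup>2 / 2"
    using inverse_lower_quad_le[OF t] by metis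
  define V where "V = 4 * m\<^sup>2 * v + 2 * v\<^sup>2"
  have V: "V > 0" unfolding V_def using v by (intro add_nonneg_pos) auto
  define Q where "Q = q0 + V / 2"
  \<comment> \<open>The optimal weight \<open>H / (Q + H)\<close> for
    \<open>H = 1 / (2 * V)\<close>.\<close>
  define w where "w = 1 / (2 * V * Q + 1)"
  define D where "D x = \<sigma> * (2 * m * \<eta> x + (\<eta> x)\<^sup>2 - v)" for x
  define g where "g x = 32 * (m + \<eta> x)\<^sup>2 * v + 32 * v\<^sup>2" for x
  define U where "U x = w\<^sup>2 * (q0 + b * D x + (D x)\<^sup>2 / 2) + (1 - w)\<^sup>2 * ((1 + (\<eta> x)\<^sup>2 / v) / (4 * V))" for x
  have g0: "g x > 0" for x unfolding g_def using v by (intro add_nonneg_pos) auto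
  \<comment> \<open>The factor \<open>1 + (\<eta> x)\<^sup>2 / v\<close> has mean 2 and covers the
    points where \<open>m + \<eta> x\<close> is small. Since \<open>m\<^sup>2\<close> is bounded by
    twice the sum of two squares, the term \<open>16 * m\<^sup>2 * v\<close> of \<open>4 * V\<close>
    calls for the constant 32.\<close>
  have inv_g: "inverse (g x) \<le> (1 + (\<eta> x)\<^sup>2 / v) / (4 * V)" for x
  proof -
    have "m\<^sup>2 \<le> 2 * (m + \<eta> x)\<^sup>2 + 2 * (\<eta> x)\<^sup>2"
    proof -
      have "2 * (m + \<eta> x)\<^sup>2 + 2 * (\<eta> x)\<^sup>2 - m\<^sup>2 = (m + 2 * \<eta> x)\<^sup>2"
        by (simp add: power2_eq_square algebra_simps)
      then show ?thesis using zero_le_power2[of "m + 2 * \<eta> x"] by linarith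
    qed
    then have "m\<^sup>2 * v \<le> (2 * (m + \<eta> x)\<^sup>2 + 2 * (\<eta> x)\<^sup>2) * v" using v by (intro mult_right_mono) auto
    then have "m\<^sup>2 * v \<le> 2 * ((m + \<eta> x)\<^sup>2 * v) + 2 * ((\<eta> x)\<^sup>2 * v)" by (simp add: algebra_simps)
    moreover have "0 \<le> (m + \<eta> x)\<^sup>2 * (\<eta> x)\<^sup>2" "0 \<le> v\<^sup>2" using v by simp_all
    moreover have "(1 + (\<eta> x)\<^sup>2 / v) * g x
        = 32 * ((m + \<eta> x)\<^sup>2 * v + v\<^sup>2 + (m + \<eta> x)\<^sup>2 * (\<eta> x)\<^sup>2 + (\<eta> x)\<^sup>2 * v)"
      unfolding g_def using v by (simp add: divide_simps power2_eq_square) (simp add: algebra_simps)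
    moreover have "4 * V = 16 * (m\<^sup>2 * v) + 8 * v\<^sup>2" unfolding V_def by simp
    ultimately have "4 * V \<le> (1 + (\<eta> x)\<^sup>2 / v) * g x" by argo
    then show ?thesis using V g0[of x] by (simp add: field_simps)
  qed
  have pw: "- ln q0 + 1 - U x / q0 \<le> ln (lower_quad (t + D x) + g x)" for x
  proof -
    define Y where "Y = lower_quad (t + D x) + g x"
    have Y: "Y > 0" using lower_quad_ge_half[of "t + D x"] g0[of x] by (simp add: Y_def)
    have "inverse Y \<le> w\<^sup>2 * inverse (lower_quad (t + D x)) + (1 - w)\<^sup>2 * inverse (g x)"
      unfolding Y_def using lower_quad_ge_half[of "t + D x"] g0[of x] by (intro inverse_add_le) auto
    also have "\<dots> \<le> U x" unfolding U_def
      using q[of "t + D x"] inv_g[of x] by (intro add_mono mult_left_mono) auto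
    finally have "inverse Y / q0 \<le> U x / q0" using q0 by (intro divide_right_mono) auto
    moreover have "ln (inverse (Y * q0)) \<le> inverse (Y * q0) - 1"
      using Y q0 by (intro ln_le_minus_one) auto
    moreover have "ln (inverse (Y * q0)) = - (ln Y + ln q0)" using Y q0(2) by (simp add: ln_inverse ln_mult)
    moreover have "inverse (Y * q0) = inverse Y / q0" by (simp add: divide_inverse)
    ultimately show ?thesis unfolding Y_def[symmetric] by linarith
  qed
  have D2: "(D x)\<^sup>2 = (2 * m * \<eta> x + (\<eta> x)\<^sup>2 - v)\<^sup>2" for x by (simp add: D_def power_mult_distrib s)
  have ID: "integrable G D" "(\<integral>x. D x \<partial>G) = 0"
    using has_integral_quartic[of D "- (\<sigma> * v)" "2 * m * \<sigma>" \<sigma> 0 0] by (simp_all add: D_def algebra_simps)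
  have "(D x)\<^sup>2 = v\<^sup>2 + (- 4 * m * v) * \<eta> x + (4 * m\<^sup>2 - 2 * v) * (\<eta> x)\<^sup>2 + (4 * m) * (\<eta> x) ^ 3 + 1 * (\<eta> x) ^ 4" for x
    unfolding D2 by (simp add: algebra_simps power2_eq_square power3_eq_cube power4_eq_xxxx)
  from has_integral_quartic[of "\<lambda>x. (D x)\<^sup>2", OF this]
  have ID2: "integrable G (\<lambda>x. (D x)\<^sup>2)" "(\<integral>x. (D x)\<^sup>2 \<partial>G) = V"
    by (simp_all add: V_def algebra_simps power2_eq_square)
  have IU: "integrable G U" unfolding U_def[abs_def] using ID ID2 int2 by auto
  have "(\<integral>x. U x \<partial>G) = w\<^sup>2 * Q + (1 - w)\<^sup>2 * (1 / (2 * V))"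
    unfolding U_def[abs_def] using ID ID2 int2 v V by (simp add: prob_space Q_def mom2 field_simps)
  also have "\<dots> = Q / (2 * V * Q + 1)"
  proof -
    have "2 * V * Q + 1 > 0" using V q0 by (simp add: Q_def add_pos_nonneg)
    moreover have "1 - w = 2 * V * Q / (2 * V * Q + 1)" unfolding w_def using calculation by (simp add: field_simps)
    ultimately show ?thesis unfolding w_def using V
      by (simp add: divide_simps power2_eq_square) (simp add: algebra_simps)
  qed
  also have "\<dots> \<le> q0"
  proof -
    have "1/2 * (1/2) \<le> q0 * Q" using q0 V by (intro mult_mono) (auto simp: Q_def)
    then have "V * (1/4) \<le> V * (q0 * Q)" using V by simp
    then have "Q \<le> q0 * (2 * V * Q + 1)" by (simp add: Q_def algebra_simps)
    moreover have "2 * V * Q + 1 > 0" using V q0 by (simp add: Q_def add_pos_nonneg)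
    ultimately show ?thesis by (simp add: field_simps)
  qed
  finally have U: "(\<integral>x. U x \<partial>G) \<le> q0" .
  have "psi t = - ln q0" by (simp add: q0)
  also have "\<dots> \<le> - ln q0 + 1 - (\<integral>x. U x \<partial>G) / q0" using U q0 by (simp add: field_simps)
  also have "\<dots> = (\<integral>x. - ln q0 + 1 - U x / q0 \<partial>G)" using IU by (simp add: prob_space)
  also have "\<dots> \<le> (\<integral>x. ln (lower_quad (t + D x) + g x) \<partial>G)"
  proof (rule integral_mono)
    show "integrable G (\<lambda>x. - ln q0 + 1 - U x / q0)" using IU by simp
    \<comment> \<open>\<open>m\<^sup>2 - \<sigma> * t\<close> is the level \<open>l\<close> for
      which \<open>\<sigma> * (m\<^sup>2 - l) = t\<close>, as
      \<open>\<sigma>\<^sup>2 = 1\<close>.\<close>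
    have "(\<lambda>x. ln (lower_quad (t + D x) + g x)) = (\<lambda>x. ln (pert \<sigma> (m\<^sup>2 - \<sigma> * t) v (m + \<eta> x)))"
    proof
      fix x
      have "t + D x = \<sigma> * ((m + \<eta> x)\<^sup>2 - v - (m\<^sup>2 - \<sigma> * t))"
        using s by (simp add: D_def algebra_simps power2_eq_square)
      then show "ln (lower_quad (t + D x) + g x) = ln (pert \<sigma> (m\<^sup>2 - \<sigma> * t) v (m + \<eta> x))"
        by (simp add: pert_def g_def add.assoc)
    qed
    then show "integrable G (\<lambda>x. ln (lower_quad (t + D x) + g x))" using pert_integrable(2)[of \<sigma> "m\<^sup>2 - \<sigma> * t" m] v by simp
  qed (rule pw)
  finally show ?thesis by (simp add: D_def g_def add.assoc)
qed

text \<open>Below -1 the floor 1/2 of \<open>lower_quad\<close> is enough, since \<open>psi\<close>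
  equals \<open>- ln 2\<close> there. For \<open>v = 0\<close> the perturbation vanishes almost
  surely and the pointwise comparison \<open>psi_le_ln_lower_quad\<close> remains.\<close>

lemma psi_le_integral:
  assumes v: "v \<ge> 0" and s: "\<sigma>\<^sup>2 = 1"
  shows "psi (\<sigma> * (m\<^sup>2 - l)) \<le> (\<integral>x. ln (pert \<sigma> l v (m + \<eta> x)) \<partial>G)"
proof -
  define t where "t = \<sigma> * (m\<^sup>2 - l)"
  have eq: "\<sigma> * ((m + \<eta> x)\<^sup>2 - v - l) = t + \<sigma> * (2 * m * \<eta> x + (\<eta> x)\<^sup>2 - v)" for x
    by (simp add: t_def algebra_simps power2_eq_square)
  consider "v = 0" | "t \<le> -1" | "v > 0" "-1 \<le> t" "t \<le> 1" | "v > 0" "t \<ge> 1" using v by linarith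
  then show ?thesis
  proof cases
    case 1
    have "(\<integral>x. (\<eta> x)\<^sup>2 \<partial>G) = 0" using mom2 1 by simp
    then have "AE x in G. \<eta> x = 0" using int2 by (simp add: integral_nonneg_eq_0_iff_AE)
    then have "(\<integral>x. ln (pert \<sigma> l v (m + \<eta> x)) \<partial>G) = (\<integral>x. ln (lower_quad t) \<partial>G)"
      using pert_integrable[OF v] by (intro integral_cong_AE) (auto simp: pert_def 1 t_def)
    then show ?thesis using psi_le_ln_lower_quad[of t] by (simp add: prob_space t_def)
  next
    case 2
    have "psi t \<le> - ln 2" using 2 by (auto simp: psi_def psi_nonneg_def ln_div power2_eq_square)
    also have "\<dots> = (\<integral>x. ln (1/2) \<partial>G)" by (simp add: prob_space ln_div)
    also have "\<dots> \<le> (\<integral>x. ln (pert \<sigma> l v (m + \<eta> x)) \<partial>G)"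
    proof (intro integral_mono pert_integrable v)
      fix x show "ln (1/2) \<le> ln (pert \<sigma> l v (m + \<eta> x))" using pert_ge_half[OF v, of \<sigma> l "m + \<eta> x"] by simp
    qed simp
    finally show ?thesis by (simp add: t_def)
  next
    case 3
    then show ?thesis using psi_le_integral_aux[OF 3(1) s 3(2,3), of m]
      unfolding pert_def eq t_def by simp
  next
    case 4
    txt \<open>Since \<^const>\<open>lower_quad\<close> is monotone and \<^const>\<open>psi\<close> is constant beyond 1, the value 1 of \<open>t\<close> is the worst.\<close>
    define l' where "l' = m\<^sup>2 - \<sigma>"
    have eq': "\<sigma> * ((m + \<eta> x)\<^sup>2 - v - l') = 1 + \<sigma> * (2 * m * \<eta> x + (\<eta> x)\<^sup>2 - v)" for x
      using s by (simp add: l'_def algebra_simps power2_eq_square)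
    have "psi t = psi 1" using 4 by (auto simp: psi_def psi_nonneg_def ln_div)
    also have "\<dots> \<le> (\<integral>x. ln (pert \<sigma> l' v (m + \<eta> x)) \<partial>G)"
      using psi_le_integral_aux[OF 4(1) s, of 1 m] unfolding pert_def eq' by simp
    also have "\<dots> \<le> (\<integral>x. ln (pert \<sigma> l v (m + \<eta> x)) \<partial>G)"
    proof (intro integral_mono pert_integrable v)
      fix x
      have "pert \<sigma> l' v (m + \<eta> x) \<le> pert \<sigma> l v (m + \<eta> x)"
        unfolding pert_def eq eq' using 4 by (intro add_right_mono lower_quad_mono) auto
      then show "ln (pert \<sigma> l' v (m + \<eta> x)) \<le> ln (pert \<sigma> l v (m + \<eta> x))"
        using pert_ge_half[OF v, of \<sigma> l' "m + \<eta> x"] by simp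
    qed
    finally show ?thesis by (simp add: t_def)
  qed
qed

text \<open>Half of the variance of the quadratic form contributes
  \<open>2 * m\<^sup>2 * v + v\<^sup>2\<close>, and the compensator has mean
  \<open>32 * m\<^sup>2 * v + 64 * v\<^sup>2\<close>; hence 34 and 65.\<close>

lemma integral_pert_le:
  assumes v: "v \<ge> 0" and s: "\<sigma>\<^sup>2 = 1"
  shows "(\<integral>x. pert \<sigma> l v (m + \<eta> x) \<partial>G)
      \<le> 1 + \<sigma> * (m\<^sup>2 - l) + (m\<^sup>2 - l)\<^sup>2 / 2 + 34 * m\<^sup>2 * v + 65 * v\<^sup>2"
proof -
  have "(\<integral>x. pert \<sigma> l v (m + \<eta> x) \<partial>G) \<le> (\<integral>x. pert_poly \<sigma> l v (m + \<eta> x) \<partial>G)"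
    by (intro integral_mono pert_integrable v integral_pert_poly pert_le_poly)
  then show ?thesis unfolding integral_pert_poly(2) s by simp
qed

end

subsection \<open>The standard Gaussian measure\<close>

abbreviation std_normal :: "real measure" where
  "std_normal \<equiv> density lborel (\<lambda>x. ennreal (std_normal_density x))"

lemma prob_space_std_normal: "prob_space std_normal"
  by (rule prob_space_normal_density) simp

text \<open>Cameron-Martin formula in dimension one: translate Lebesgue measure and expand the
  square in the Gaussian exponent.\<close>

lemma std_normal_shift:
  "distr std_normal borel (\<lambda>y. y + a) = density std_normal (\<lambda>y. ennreal (exp (a * y - a\<^sup>2 / 2)))"
proof (rule measure_eqI)
  fix A assume "A \<in> sets (distr std_normal borel (\<lambda>y. y + a))"
  then have A[measurable]: "A \<in> sets borel" by simp
  have "emeasure (distr std_normal borel (\<lambda>y. y + a)) A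
      = (\<integral>\<^sup>+ y. ennreal (std_normal_density y) * indicator A (y + a) \<partial>lborel)"
  proof -
    have "(\<lambda>y. y + a) -` A \<inter> space borel \<in> sets borel" by (rule measurable_sets[of _ borel borel]) auto
    then have "emeasure std_normal ((\<lambda>y. y + a) -` A)
        = (\<integral>\<^sup>+ y. ennreal (std_normal_density y) * indicator ((\<lambda>y. y + a) -` A) y \<partial>lborel)"
      by (intro emeasure_density) auto
    then show ?thesis by (subst emeasure_distr) (auto simp: indicator_vimage comp_def)
  qed
  also have "\<dots> = (\<integral>\<^sup>+ y. ennreal (std_normal_density (y - a)) * indicator A y \<partial>lborel)"
    by (subst nn_integral_real_affine[where c=1 and t="-a"]) auto
  also have "\<dots> = (\<integral>\<^sup>+ y. ennreal (std_normal_density y) * (ennreal (exp (a * y - a\<^sup>2 / 2)) * indicator A y) \<partial>lborel)"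
  proof (rule nn_integral_cong)
    fix y
    have "std_normal_density (y - a) = std_normal_density y * exp (a * y - a\<^sup>2 / 2)"
      unfolding std_normal_density_def mult.assoc exp_add[symmetric]
      by (simp add: power2_eq_square field_simps)
    then show "ennreal (std_normal_density (y - a)) * indicator A y
        = ennreal (std_normal_density y) * (ennreal (exp (a * y - a\<^sup>2 / 2)) * indicator A y)"
      by (simp add: ennreal_mult' mult.assoc)
  qed
  also have "\<dots> = emeasure (density std_normal (\<lambda>y. ennreal (exp (a * y - a\<^sup>2 / 2)))) A"
    by (simp add: emeasure_density nn_integral_density)
  finally show "emeasure (distr std_normal borel (\<lambda>y. y + a)) A
      = emeasure (density std_normal (\<lambda>y. ennreal (exp (a * y - a\<^sup>2 / 2)))) A" .
qed simp

abbreviation std_normal_pi :: "('d::finite \<Rightarrow> real) measure" where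
  "std_normal_pi \<equiv> PiM UNIV (\<lambda>_. std_normal)"

lemma prob_space_std_normal_pi: "prob_space std_normal_pi"
  by (intro prob_space_PiM prob_space_std_normal)

text \<open>On rectangles both measures factor into the translated marginals \<open>K i\<close>, and
  this determines a product measure.\<close>

lemma std_normal_pi_shift:
  fixes u :: "'d::finite \<Rightarrow> real"
  shows "distr std_normal_pi (PiM UNIV (\<lambda>_. borel)) (\<lambda>f i. f i + u i)
    = density std_normal_pi (\<lambda>f. ennreal (exp ((\<Sum>i\<in>UNIV. u i * f i) - (\<Sum>i\<in>UNIV. (u i)\<^sup>2) / 2)))"
    (is "?D = ?E")
proof -
  interpret N: product_prob_space "\<lambda>_::'d. std_normal" UNIV
    by (intro product_prob_spaceI prob_space_std_normal)
  define K where "K i = distr std_normal borel (\<lambda>y. y + u i)" for i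
  have K: "prob_space (K i)" for i unfolding K_def
    by (intro prob_space.prob_space_distr prob_space_std_normal) simp
  interpret K: product_prob_space K UNIV by (intro product_prob_spaceI K)
  have sK[measurable_cong]: "sets (K i) = sets borel" for i by (simp add: K_def)
  have sP: "sets std_normal_pi = sets (PiM UNIV (\<lambda>_::'d. borel))" by (intro sets_PiM_cong) auto
  have [measurable]: "(\<lambda>f i. f i + u i) \<in> measurable std_normal_pi (PiM UNIV (\<lambda>_. borel))"
    by (rule measurable_PiM_single') (auto simp: space_PiM PiE_def)
  have D: "?D = PiM UNIV K"
  proof (rule K.PiM_eqI)
    show "sets ?D = sets (PiM UNIV K)" by (simp add: sK cong: sets_PiM_cong)
    fix A assume "\<And>i. i \<in> UNIV \<Longrightarrow> A i \<in> sets (K i)"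
    then have A[measurable]: "\<And>i. A i \<in> sets borel" by (simp add: sK)
    have "(\<lambda>f i. f i + u i) -` Pi\<^sub>E UNIV A \<inter> space std_normal_pi = Pi\<^sub>E UNIV (\<lambda>i. (\<lambda>y. y + u i) -` A i)"
      by (auto simp: space_PiM PiE_def)
    moreover have "Pi\<^sub>E UNIV A \<in> sets (PiM UNIV (\<lambda>_::'d. borel :: real measure))"
      by (intro sets_PiM_I_finite) auto
    ultimately have "emeasure ?D (Pi\<^sub>E UNIV A) = emeasure std_normal_pi (Pi\<^sub>E UNIV (\<lambda>i. (\<lambda>y. y + u i) -` A i))"
      by (subst emeasure_distr) auto
    also have "\<dots> = (\<Prod>i\<in>UNIV. emeasure std_normal ((\<lambda>y. y + u i) -` A i))"
    proof (rule N.emeasure_PiM)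
      fix i
      have "(\<lambda>y. y + u i) -` A i \<inter> space borel \<in> sets borel" by (rule measurable_sets[of _ borel borel]) auto
      then show "(\<lambda>y. y + u i) -` A i \<in> sets std_normal" by simp
    qed simp
    also have "\<dots> = (\<Prod>i\<in>UNIV. emeasure (K i) (A i))"
      unfolding K_def by (intro prod.cong refl, subst emeasure_distr) auto
    finally show "emeasure ?D (Pi\<^sub>E UNIV A) = (\<Prod>i\<in>UNIV. emeasure (K i) (A i))" .
  qed simp
  have E: "?E = PiM UNIV K"
  proof (rule K.PiM_eqI)
    show "sets ?E = sets (PiM UNIV K)" by (simp add: sK sP cong: sets_PiM_cong)
    fix A assume "\<And>i. i \<in> UNIV \<Longrightarrow> A i \<in> sets (K i)"
    then have A[measurable]: "\<And>i. A i \<in> sets borel" by (simp add: sK)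
    have B: "Pi\<^sub>E UNIV A \<in> sets std_normal_pi"
      unfolding sP by (intro sets_PiM_I_finite) auto
    have "emeasure ?E (Pi\<^sub>E UNIV A)
        = (\<integral>\<^sup>+ f. (\<Prod>i\<in>UNIV. ennreal (exp (u i * f i - (u i)\<^sup>2 / 2)) * indicator (A i) (f i)) \<partial>std_normal_pi)"
    proof (subst emeasure_density)
      show "(\<lambda>f. ennreal (exp ((\<Sum>i\<in>UNIV. u i * f i) - (\<Sum>i\<in>UNIV. (u i)\<^sup>2) / 2))) \<in> borel_measurable std_normal_pi"
        by measurable
      show "(\<integral>\<^sup>+ f. ennreal (exp ((\<Sum>i\<in>UNIV. u i * f i) - (\<Sum>i\<in>UNIV. (u i)\<^sup>2) / 2)) * indicator (Pi\<^sub>E UNIV A) f \<partial>std_normal_pi)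
        = (\<integral>\<^sup>+ f. (\<Prod>i\<in>UNIV. ennreal (exp (u i * f i - (u i)\<^sup>2 / 2)) * indicator (A i) (f i)) \<partial>std_normal_pi)"
      proof (rule nn_integral_cong)
        fix f :: "'d \<Rightarrow> real"
        have "(\<Prod>i\<in>UNIV. ennreal (exp (u i * f i - (u i)\<^sup>2 / 2))) = ennreal (exp (\<Sum>i\<in>UNIV. u i * f i - (u i)\<^sup>2 / 2))"
          by (simp add: prod_ennreal exp_sum)
        moreover have "(\<Sum>i\<in>UNIV. u i * f i - (u i)\<^sup>2 / 2) = (\<Sum>i\<in>UNIV. u i * f i) - (\<Sum>i\<in>UNIV. (u i)\<^sup>2) / 2"
          by (simp add: sum_subtractf sum_divide_distrib)
        moreover have "(\<Prod>i\<in>UNIV. indicator (A i) (f i)) = (indicator (Pi\<^sub>E UNIV A) f :: ennreal)"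
          by (cases "f \<in> Pi UNIV A") (auto simp: indicator_def PiE_def prod_zero_iff intro!: prod.neutral)
        ultimately show "ennreal (exp ((\<Sum>i\<in>UNIV. u i * f i) - (\<Sum>i\<in>UNIV. (u i)\<^sup>2) / 2)) * indicator (Pi\<^sub>E UNIV A) f
            = (\<Prod>i\<in>UNIV. ennreal (exp (u i * f i - (u i)\<^sup>2 / 2)) * indicator (A i) (f i))"
          by (simp add: prod.distrib)
      qed
    qed (use B in simp)
    also have "\<dots> = (\<Prod>i\<in>UNIV. \<integral>\<^sup>+ y. ennreal (exp (u i * y - (u i)\<^sup>2 / 2)) * indicator (A i) y \<partial>std_normal)"
      by (intro N.product_nn_integral_prod[where f="\<lambda>i y. ennreal (exp (u i * y - (u i)\<^sup>2 / 2)) * indicator (A i) y"]) auto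
    also have "\<dots> = (\<Prod>i\<in>UNIV. emeasure (K i) (A i))"
      unfolding K_def std_normal_shift by (intro prod.cong refl) (simp add: emeasure_density)
    finally show "emeasure ?E (Pi\<^sub>E UNIV A) = (\<Prod>i\<in>UNIV. emeasure (K i) (A i))" .
  qed simp
  show ?thesis unfolding D E ..
qed

text \<open>The product measure lives on functions; its image under \<open>vec_lambda\<close> lives
  on the Euclidean space, where inner products and the Borel structure are at hand.\<close>

definition gauss :: "(real ^ 'd) measure" where
  "gauss = distr std_normal_pi borel vec_lambda"

lemma measurable_vec_lambda[measurable]: "vec_lambda \<in> measurable std_normal_pi (borel :: (real ^ 'd) measure)"
proof (rule borel_measurable_euclidean_space[THEN iffD2], rule ballI)
  fix b :: "real ^ 'd" assume "b \<in> Basis"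
  then obtain i where "b = axis i 1" by (auto simp: Basis_vec_def)
  then show "(\<lambda>f. vec_lambda f \<bullet> b) \<in> borel_measurable std_normal_pi" by (simp add: inner_axis)
qed

lemma sets_gauss[simp, measurable_cong]: "sets gauss = sets borel"
  by (simp add: gauss_def)

lemma space_gauss[simp]: "space gauss = UNIV"
  by (simp add: gauss_def)

lemma prob_space_gauss: "prob_space gauss"
  unfolding gauss_def by (intro prob_space.prob_space_distr prob_space_std_normal_pi measurable_vec_lambda)

lemma measure_gauss_UNIV[simp]: "measure gauss UNIV = 1"
  using prob_space.prob_space[OF prob_space_gauss] by simp

lemma gauss_shift:
  assumes [measurable]: "F \<in> borel_measurable (borel :: (real ^ 'd) measure)"
  shows "(\<integral>\<^sup>+ y. F (y + u) \<partial>gauss) = (\<integral>\<^sup>+ y. ennreal (exp (u \<bullet> y - (norm u)\<^sup>2 / 2)) * F y \<partial>gauss)"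
proof -
  have sP: "sets std_normal_pi = sets (PiM UNIV (\<lambda>_::'d. borel))" by (intro sets_PiM_cong) auto
  have m1[measurable]: "(\<lambda>f i. f i + u $ i) \<in> measurable std_normal_pi (PiM UNIV (\<lambda>_. borel))"
    by (rule measurable_PiM_single') (auto simp: space_PiM PiE_def)
  have m2[measurable]: "vec_lambda \<in> measurable (PiM UNIV (\<lambda>_. borel)) (borel :: (real ^ 'd) measure)"
    using measurable_vec_lambda measurable_cong_sets[OF sP refl] by blast
  have "(\<integral>\<^sup>+ y. F (y + u) \<partial>gauss) = (\<integral>\<^sup>+ f. F (vec_lambda f + u) \<partial>std_normal_pi)"
    unfolding gauss_def by (subst nn_integral_distr) auto
  also have "\<dots> = (\<integral>\<^sup>+ f. F (vec_lambda (\<lambda>i. f i + u $ i)) \<partial>std_normal_pi)"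
  proof -
    have "vec_lambda f + u = vec_lambda (\<lambda>i. f i + u $ i)" for f by (simp add: vec_eq_iff)
    then show ?thesis by simp
  qed
  also have "\<dots> = (\<integral>\<^sup>+ f. F (vec_lambda f) \<partial>distr std_normal_pi (PiM UNIV (\<lambda>_. borel)) (\<lambda>f i. f i + u $ i))"
    by (subst nn_integral_distr) auto
  also have "\<dots> = (\<integral>\<^sup>+ f. ennreal (exp ((\<Sum>i\<in>UNIV. u $ i * f i) - (\<Sum>i\<in>UNIV. (u $ i)\<^sup>2) / 2)) * F (vec_lambda f) \<partial>std_normal_pi)"
    unfolding std_normal_pi_shift by (subst nn_integral_density) auto
  also have "\<dots> = (\<integral>\<^sup>+ f. ennreal (exp (u \<bullet> vec_lambda f - (norm u)\<^sup>2 / 2)) * F (vec_lambda f) \<partial>std_normal_pi)"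
    by (simp only: inner_vec_def power2_norm_eq_inner) (simp add: power2_eq_square)
  also have "\<dots> = (\<integral>\<^sup>+ y. ennreal (exp (u \<bullet> y - (norm u)\<^sup>2 / 2)) * F y \<partial>gauss)"
    unfolding gauss_def by (subst nn_integral_distr) auto
  finally show ?thesis .
qed

lemma gauss_inner_distributed:
  fixes x :: "real ^ 'd"
  assumes "x \<noteq> 0"
  shows "distributed gauss lborel (\<lambda>y. y \<bullet> x) (normal_density 0 (norm x))"
proof -
  interpret prob_space "std_normal_pi :: ('d \<Rightarrow> real) measure" by (rule prob_space_std_normal_pi)
  interpret N: product_prob_space "\<lambda>_::'d. std_normal" UNIV
    by (intro product_prob_spaceI prob_space_std_normal)
  have comp: "distr std_normal_pi borel (\<lambda>f. f i) = std_normal" for i :: 'd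
  proof -
    have "distr std_normal_pi borel (\<lambda>f. f i) = distr std_normal_pi std_normal (\<lambda>f. f i)"
      by (intro distr_cong) auto
    also have "\<dots> = std_normal" using N.PiM_component[of i] by simp
    finally show ?thesis .
  qed
  have indep: "indep_vars (\<lambda>_. borel) (\<lambda>i f. f i) (UNIV :: 'd set)"
  proof (subst indep_vars_iff_distr_eq_PiM)
    have "distr std_normal_pi (PiM (UNIV :: 'd set) (\<lambda>_. borel)) (\<lambda>f. \<lambda>i\<in>UNIV. f i) = distr std_normal_pi std_normal_pi (\<lambda>f. f)"
      by (intro distr_cong sets_PiM_cong) (auto simp: restrict_def)
    also have "\<dots> = PiM (UNIV :: 'd set) (\<lambda>i. distr std_normal_pi borel (\<lambda>f. f i))"
      by (simp only: comp distr_id)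
    finally show "distr std_normal_pi (PiM UNIV (\<lambda>_. borel)) (\<lambda>f. \<lambda>i\<in>UNIV. f i) = PiM (UNIV :: 'd set) (\<lambda>i. distr std_normal_pi borel (\<lambda>f. f i))" .
  qed auto
  \<comment> \<open>Coordinates with \<open>x $ i = 0\<close> would contribute a point mass, which
    has no normal density, so they are dropped from the sum.\<close>
  define I where "I = {i. x $ i \<noteq> 0}"
  have I: "finite I" "I \<noteq> {}" using assms by (auto simp: I_def vec_eq_iff)
  have d1: "distributed std_normal_pi lborel (\<lambda>f. f i) std_normal_density" for i :: 'd
    unfolding distributed_def using comp[of i]
    by (auto simp: distr_cong[OF refl sets_lborel refl])
  have d2: "distributed std_normal_pi lborel (\<lambda>f. x $ i * f i) (normal_density 0 \<bar>x $ i\<bar>)" if "i \<in> I" for i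
    using normal_density_affine[OF d1, of "x $ i" 0 i] that by (simp add: I_def)
  have "distributed std_normal_pi lborel (\<lambda>f. \<Sum>i\<in>I. x $ i * f i)
      (normal_density (\<Sum>i\<in>I. 0) (sqrt (\<Sum>i\<in>I. \<bar>x $ i\<bar>\<^sup>2)))"
  proof (rule sum_indep_normal[OF I _ _ d2])
    show "indep_vars (\<lambda>_. borel) (\<lambda>i f. x $ i * f i) I"
      by (rule indep_vars_compose2[where X="\<lambda>i f. f i" and M'="\<lambda>_. borel"])
         (auto intro: indep_vars_subset[OF indep])
  qed (auto simp: I_def)
  moreover have "(\<Sum>i\<in>I. x $ i * f i) = vec_lambda f \<bullet> x" for f
    unfolding inner_vec_def by (intro sum.mono_neutral_cong_left) (auto simp: I_def)
  moreover have "(\<Sum>i\<in>I. \<bar>x $ i\<bar>\<^sup>2) = (norm x)\<^sup>2"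
    unfolding power2_norm_eq_inner inner_vec_def
    by (intro sum.mono_neutral_cong_left) (auto simp: I_def power2_eq_square)
  ultimately have D: "distributed std_normal_pi lborel (\<lambda>f. vec_lambda f \<bullet> x) (normal_density 0 (norm x))"
    by simp
  show ?thesis
    unfolding distributed_def
  proof (intro conjI)
    have "distr gauss lborel (\<lambda>y. y \<bullet> x) = distr std_normal_pi lborel (\<lambda>f. vec_lambda f \<bullet> x)"
      unfolding gauss_def by (subst distr_distr) (auto simp: comp_def)
    then show "distr gauss lborel (\<lambda>y. y \<bullet> x) = density lborel (\<lambda>z. ennreal (normal_density 0 (norm x) z))"
      using D unfolding distributed_def by simp
  qed auto
qed

lemma gauss_moments:
  fixes x :: "real ^ 'd"
  shows "gaussian_moments gauss (\<lambda>y. y \<bullet> x) ((norm x)\<^sup>2)"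
proof -
  interpret prob_space gauss by (rule prob_space_gauss)
  show ?thesis
  proof (cases "x = 0")
    case True
    then show ?thesis by unfold_locales auto
  next
    case False
    note D = gauss_inner_distributed[OF False]
    have int: "integrable gauss (\<lambda>y. (y \<bullet> x) ^ k)" for k
      using distributed_integrable[OF D, of "\<lambda>z. z ^ k"] integrable_normal_moment[of "norm x" 0 k] False by simp
    have eq: "(\<integral>y. (y \<bullet> x) ^ k \<partial>gauss) = (\<integral>z. normal_density 0 (norm x) z * z ^ k \<partial>lborel)" for k
      using distributed_integral[OF D, of "\<lambda>z. z ^ k"] by simp
    have m: "(\<integral>y. (y \<bullet> x) ^ 1 \<partial>gauss) = 0" "(\<integral>y. (y \<bullet> x) ^ 2 \<partial>gauss) = (norm x)\<^sup>2"
       "(\<integral>y. (y \<bullet> x) ^ 3 \<partial>gauss) = 0" "(\<integral>y. (y \<bullet> x) ^ 4 \<partial>gauss) = 3 * ((norm x)\<^sup>2)\<^sup>2"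
      unfolding eq using False integral_normal_moment_even[of "norm x" 0 1] integral_normal_moment_even[of "norm x" 0 2]
        integral_normal_moment_odd[of "norm x" 0 0] integral_normal_moment_odd[of "norm x" 0 1]
      by (simp_all add: fact_numeral power2_eq_square power4_eq_xxxx numeral_3_eq_3 field_simps)
    show ?thesis
      using int[of 1] int[of 2] int[of 3] int[of 4] m by unfold_locales auto
  qed
qed

subsection \<open>A PAC-Bayesian inequality\<close>

text \<open>This is the Donsker-Varadhan inequality for the translate of \<^const>\<open>gauss\<close> by \<open>u\<close>, whose
  relative entropy with respect to \<^const>\<open>gauss\<close> is \<open>(norm u)\<^sup>2 / 2\<close>.\<close>

lemma gauss_change_of_measure:
  fixes h :: "real ^ 'd \<Rightarrow> real"
  assumes [measurable]: "h \<in> borel_measurable borel" and "C > 0"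
    and le: "(\<integral>\<^sup>+ y. ennreal (exp (h y)) \<partial>gauss) \<le> ennreal C"
    and int: "integrable gauss (\<lambda>y. h (y + u))"
  shows "(\<integral>y. h (y + u) \<partial>gauss) \<le> ln C + (norm u)\<^sup>2 / 2"
proof -
  interpret prob_space "gauss :: (real ^ 'd) measure" by (rule prob_space_gauss)
  interpret gaussian_moments gauss "\<lambda>y. y \<bullet> u" "(norm u)\<^sup>2" by (rule gauss_moments)
  \<comment> \<open>\<open>y \<bullet> u + (norm u)\<^sup>2 / 2\<close> is the log-density, at the
    point \<open>y + u\<close>, of the translate of \<open>gauss\<close> with respect to
    \<open>gauss\<close>. Subtracting it makes the mean of \<open>exp (k y)\<close> equal to that of
    \<open>exp (h y)\<close>.\<close>
  define k where "k y = h (y + u) - y \<bullet> u - (norm u)\<^sup>2 / 2" for y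
  have [measurable]: "k \<in> borel_measurable borel" unfolding k_def by measurable
  have k: "integrable gauss k" "(\<integral>y. k y \<partial>gauss) = (\<integral>y. h (y + u) \<partial>gauss) - (norm u)\<^sup>2 / 2"
    unfolding k_def[abs_def] using int int1 mom1 by simp_all
  define K where "K = (\<integral>y. k y \<partial>gauss)"
  define F where "F y = ennreal (exp (h y - y \<bullet> u + (norm u)\<^sup>2 / 2))" for y
  have [measurable]: "F \<in> borel_measurable borel" unfolding F_def by measurable
  have "(\<integral>\<^sup>+ y. ennreal (exp (k y)) \<partial>gauss) = (\<integral>\<^sup>+ y. F (y + u) \<partial>gauss)"
    by (intro nn_integral_cong) (simp add: F_def k_def inner_add_left power2_norm_eq_inner algebra_simps)
  also have "\<dots> = (\<integral>\<^sup>+ y. ennreal (exp (h y)) \<partial>gauss)"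
    unfolding gauss_shift[OF \<open>F \<in> borel_measurable borel\<close>]
    by (intro nn_integral_cong, unfold F_def) (simp add: ennreal_mult'[symmetric] exp_add[symmetric] inner_commute)
  finally have nn: "(\<integral>\<^sup>+ y. ennreal (exp (k y)) \<partial>gauss) \<le> ennreal C" using le by simp
  have ek: "integrable gauss (\<lambda>y. exp (k y))"
    using nn by (intro integrableI_bounded) (auto intro: le_less_trans simp: ennreal_less_top)
  have "(\<integral>y. exp (k y) \<partial>gauss) \<le> C"
    using nn nn_integral_eq_integral[OF ek] \<open>C > 0\<close> by simp
  \<comment> \<open>Jensen's inequality, obtained from the tangent of \<open>exp\<close> at the mean
    \<open>K\<close>.\<close>
  moreover have "(\<integral>y. exp K * (1 + k y - K) \<partial>gauss) \<le> (\<integral>y. exp (k y) \<partial>gauss)"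
  proof (rule integral_mono)
    fix y
    have "1 + (k y - K) \<le> exp (k y - K)" by (rule exp_ge_add_one_self)
    then have "exp K * (1 + k y - K) \<le> exp K * exp (k y - K)" by (intro mult_left_mono) (auto simp: algebra_simps)
    then show "exp K * (1 + k y - K) \<le> exp (k y)" by (simp add: exp_add[symmetric])
  qed (use ek k in auto)
  moreover have "(\<integral>y. exp K * (1 + k y - K) \<partial>gauss) = exp K"
    using k by (simp add: K_def)
  ultimately have "exp K \<le> C" by simp
  then have "K \<le> ln C" using \<open>C > 0\<close> by (simp add: ln_ge_iff)
  then show ?thesis unfolding K_def k(2) by simp
qed

text \<open>Dividing by the mean \<open>L y\<close> gives factors of mean one, so that by
  independence and Fubini \<open>W\<close> has mean one and reaches \<open>1 / \<epsilon>\<close>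
  with probability at most \<open>\<epsilon>\<close>. The exceptional event involves
  \<open>gauss\<close> but no translate of it, hence the uniformity in \<open>u\<close>. Finally
  \<open>ln L \<le> L - 1\<close> makes the bound linear in \<open>L\<close>.\<close>

lemma pac_bayes:
  fixes M :: "'w measure" and P :: "'x :: topological_space measure" and X :: "nat \<Rightarrow> 'w \<Rightarrow> 'x"
    and Y :: "real ^ 'd \<Rightarrow> 'x \<Rightarrow> real"
  assumes M: "prob_space M" and P: "prob_space P" and sP[measurable_cong]: "sets P = sets borel"
    and indep: "prob_space.indep_vars M (\<lambda>_. borel) X {1..n}"
    and law: "\<And>i. i \<in> {1..n} \<Longrightarrow> distr M borel (X i) = P"
    and Ym[measurable]: "case_prod Y \<in> borel_measurable (borel \<Otimes>\<^sub>M borel)"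
    and Yge: "\<And>y x. Y y x \<ge> 1 / 2" and Yint: "\<And>y. integrable P (Y y)"
    and "\<epsilon> > 0"
  shows "\<exists>E \<in> sets M. measure M E \<ge> 1 - \<epsilon> \<and> (\<forall>\<omega>\<in>E. \<forall>u.
      (\<forall>x. integrable gauss (\<lambda>y. Y (y + u) x)) \<longrightarrow>
      integrable gauss (\<lambda>y. \<integral>x. Y (y + u) x \<partial>P) \<longrightarrow>
      (\<Sum>i = 1..n. \<integral>y. ln (Y (y + u) (X i \<omega>)) \<partial>gauss)
        \<le> real n * ((\<integral>y. (\<integral>x. Y (y + u) x \<partial>P) \<partial>gauss) - 1) + ln (1 / \<epsilon>) + (norm u)\<^sup>2 / 2)"
proof -
  interpret M: prob_space M by (rule M)
  interpret P: prob_space P by (rule P)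
  interpret G: prob_space "gauss :: (real ^ 'd) measure" by (rule prob_space_gauss)
  interpret GM: pair_prob_space "gauss :: (real ^ 'd) measure" M ..
  have Xm[measurable]: "X i \<in> measurable M borel" if "i \<in> {1..n}" for i
    using indep that by (auto simp: M.indep_vars_def)
  define L where "L y = (\<integral>x. Y y x \<partial>P)" for y
  have [measurable]: "L \<in> borel_measurable borel"
    unfolding L_def by measurable
  have L: "L y \<ge> 1 / 2" for y
  proof -
    have "(\<integral>x. 1 / 2 \<partial>P) \<le> L y" unfolding L_def by (intro integral_mono Yint Yge) simp
    then show ?thesis by (simp add: P.prob_space)
  qed
  define W where "W \<omega> = (\<integral>\<^sup>+ y. (\<Prod>i\<in>{1..n}. ennreal (Y y (X i \<omega>) / L y)) \<partial>gauss)" for \<omega>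
  have Wm[measurable]: "(\<lambda>(y, \<omega>). \<Prod>i\<in>{1..n}. ennreal (Y y (X i \<omega>) / L y)) \<in> borel_measurable (gauss \<Otimes>\<^sub>M M)"
    by measurable
  have [measurable]: "W \<in> borel_measurable M"
    unfolding W_def by measurable
  have "(\<integral>\<^sup>+ \<omega>. W \<omega> \<partial>M) = (\<integral>\<^sup>+ y. (\<integral>\<^sup>+ \<omega>. (\<Prod>i\<in>{1..n}. ennreal (Y y (X i \<omega>) / L y)) \<partial>M) \<partial>gauss)"
    unfolding W_def using GM.Fubini[OF Wm] by simp
  also have "\<dots> = (\<integral>\<^sup>+ y. 1 \<partial>(gauss :: (real ^ 'd) measure))"
  proof (rule nn_integral_cong)
    fix y :: "real ^ 'd"
    have "(\<integral>\<^sup>+ \<omega>. (\<Prod>i\<in>{1..n}. ennreal (Y y (X i \<omega>) / L y)) \<partial>M)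
        = (\<Prod>i\<in>{1..n}. \<integral>\<^sup>+ \<omega>. ennreal (Y y (X i \<omega>) / L y) \<partial>M)"
    proof (rule M.indep_vars_nn_integral)
      show "M.indep_vars (\<lambda>_. borel) (\<lambda>i \<omega>. ennreal (Y y (X i \<omega>) / L y)) {1..n}"
        by (rule M.indep_vars_compose2[OF indep]) measurable
    qed auto
    also have "\<dots> = 1"
    proof (rule prod.neutral, rule ballI)
      fix i assume i: "i \<in> {1..n}"
      have "(\<integral>\<^sup>+ \<omega>. ennreal (Y y (X i \<omega>) / L y) \<partial>M) = (\<integral>\<^sup>+ x. ennreal (Y y x / L y) \<partial>distr M borel (X i))"
        using i by (subst nn_integral_distr) auto
      also have "\<dots> = ennreal (\<integral>x. Y y x / L y \<partial>P)"
        unfolding law[OF i] using Yint Yge[of y] L[of y]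
        by (intro nn_integral_eq_integral) (auto intro!: AE_I2 divide_nonneg_nonneg order_trans[OF _ Yge] order_trans[OF _ L])
      also have "(\<integral>x. Y y x / L y \<partial>P) = 1"
        using L[of y] by (simp add: L_def[symmetric])
      finally show "(\<integral>\<^sup>+ \<omega>. ennreal (Y y (X i \<omega>) / L y) \<partial>M) = 1" by simp
    qed
    finally show "(\<integral>\<^sup>+ \<omega>. (\<Prod>i\<in>{1..n}. ennreal (Y y (X i \<omega>) / L y)) \<partial>M) = 1" .
  qed
  also have "\<dots> = 1" using G.emeasure_space_1 by simp
  finally have W1: "(\<integral>\<^sup>+ \<omega>. W \<omega> \<partial>M) = 1" .
  define B where "B = {\<omega> \<in> space M. 1 \<le> ennreal \<epsilon> * W \<omega>}"
  have [measurable]: "B \<in> sets M" unfolding B_def by measurable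
  have "emeasure M B \<le> ennreal \<epsilon> * (\<integral>\<^sup>+ \<omega>. W \<omega> * indicator (space M) \<omega> \<partial>M)"
    unfolding B_def by (rule nn_integral_Markov_inequality) auto
  also have "(\<integral>\<^sup>+ \<omega>. W \<omega> * indicator (space M) \<omega> \<partial>M) = (\<integral>\<^sup>+ \<omega>. W \<omega> \<partial>M)"
    by (intro nn_integral_cong) auto
  finally have B: "measure M B \<le> \<epsilon>" using W1 \<open>\<epsilon> > 0\<close> by (simp add: M.emeasure_eq_measure)
  show ?thesis
  proof (intro bexI[of _ "space M - B"] conjI ballI allI impI)
    show "1 - \<epsilon> \<le> measure M (space M - B)" using B by (simp add: M.prob_compl)
    fix \<omega> u assume \<omega>: "\<omega> \<in> space M - B" and I1: "\<forall>x. integrable gauss (\<lambda>y. Y (y + u) x)"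
      and I2: "integrable gauss (\<lambda>y. \<integral>x. Y (y + u) x \<partial>P)"
    have Wle: "W \<omega> \<le> ennreal (1 / \<epsilon>)"
    proof -
      have "ennreal \<epsilon> * W \<omega> \<le> 1" using \<omega> by (auto simp: B_def)
      then have "ennreal (1 / \<epsilon>) * (ennreal \<epsilon> * W \<omega>) \<le> ennreal (1 / \<epsilon>) * 1" by (rule mult_left_mono) simp
      then show ?thesis using \<open>\<epsilon> > 0\<close> by (simp add: mult.assoc[symmetric] ennreal_mult'[symmetric])
    qed
    define h where "h y = (\<Sum>i = 1..n. ln (Y y (X i \<omega>)) - ln (L y))" for y
    have lnint: "integrable gauss (\<lambda>y. ln (f (y + u)))"
      if "integrable gauss (\<lambda>y. f (y + u))" "\<And>y. f y \<ge> 1 / 2" for f :: "real ^ 'd \<Rightarrow> real"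
    proof (rule Bochner_Integration.integrable_bound[of _ "\<lambda>y. f (y + u) + ln 2"])
      show "integrable gauss (\<lambda>y. f (y + u) + ln 2)" using that(1) by simp
      have [measurable]: "(\<lambda>y. f (y + u)) \<in> borel_measurable gauss" using that(1) by simp
      show "(\<lambda>y. ln (f (y + u))) \<in> borel_measurable gauss" by measurable
      show "AE y in gauss. norm (ln (f (y + u))) \<le> norm (f (y + u) + ln 2)"
      proof (rule AE_I2)
        fix y
        have "\<bar>ln (f (y + u))\<bar> \<le> f (y + u) + ln 2" using abs_ln_le[OF that(2)] .
        then show "norm (ln (f (y + u))) \<le> norm (f (y + u) + ln 2)" by simp
      qed
    qed
    have i1: "integrable gauss (\<lambda>y. ln (Y (y + u) x))" for x
      using lnint[of "\<lambda>y. Y y x"] I1 Yge by simp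
    have i2: "integrable gauss (\<lambda>y. ln (L (y + u)))"
      using lnint[of L] I2 L by (simp add: L_def)
    have "(\<integral>y. h (y + u) \<partial>gauss) \<le> ln (1 / \<epsilon>) + (norm u)\<^sup>2 / 2"
    proof (rule gauss_change_of_measure)
      show "h \<in> borel_measurable borel" unfolding h_def by measurable
      have "exp (h y) = (\<Prod>i\<in>{1..n}. Y y (X i \<omega>) / L y)" for y
      proof -
        have "0 < Y y x" "0 < L y" for x using Yge[of y x] L[of y] by linarith+
        then show ?thesis unfolding h_def by (simp add: exp_sum exp_diff)
      qed
      moreover have "0 \<le> Y y x / L y" for x y using Yge[of y x] L[of y] by simp
      ultimately show "(\<integral>\<^sup>+ y. ennreal (exp (h y)) \<partial>gauss) \<le> ennreal (1 / \<epsilon>)"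
        using Wle unfolding W_def by (simp add: prod_ennreal)
      show "integrable gauss (\<lambda>y. h (y + u))" unfolding h_def using i1 i2 by simp
    qed (use \<open>\<epsilon> > 0\<close> in simp)
    moreover have "(\<integral>y. h (y + u) \<partial>gauss)
        = (\<Sum>i = 1..n. \<integral>y. ln (Y (y + u) (X i \<omega>)) \<partial>gauss) - real n * (\<integral>y. ln (L (y + u)) \<partial>gauss)"
      unfolding h_def using i1 i2 by (simp add: sum_subtractf)
    moreover have "(\<integral>y. ln (L (y + u)) \<partial>gauss) \<le> (\<integral>y. L (y + u) - 1 \<partial>gauss)"
    proof (rule integral_mono[OF i2])
      fix y show "ln (L (y + u)) \<le> L (y + u) - 1" using L[of "y + u"] by (intro ln_le_minus_one) auto
    qed (use I2 in \<open>simp add: L_def\<close>)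
    moreover have "(\<integral>y. L (y + u) - 1 \<partial>gauss) = (\<integral>y. (\<integral>x. Y (y + u) x \<partial>P) \<partial>gauss) - 1"
      using I2 by (simp add: L_def)
    ultimately have "(\<Sum>i = 1..n. \<integral>y. ln (Y (y + u) (X i \<omega>)) \<partial>gauss)
        - real n * (\<integral>y. ln (L (y + u)) \<partial>gauss) \<le> ln (1 / \<epsilon>) + (norm u)\<^sup>2 / 2"
      "real n * (\<integral>y. ln (L (y + u)) \<partial>gauss) \<le> real n * ((\<integral>y. (\<integral>x. Y (y + u) x \<partial>P) \<partial>gauss) - 1)"
      by (auto intro: mult_left_mono)
    then show "(\<Sum>i = 1..n. \<integral>y. ln (Y (y + u) (X i \<omega>)) \<partial>gauss)
        \<le> real n * ((\<integral>y. (\<integral>x. Y (y + u) x \<partial>P) \<partial>gauss) - 1) + ln (1 / \<epsilon>) + (norm u)\<^sup>2 / 2"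
      by linarith
  qed simp
qed

subsection \<open>Moments and deviations\<close>

lemma Cauchy_Schwarz_integral:
  fixes f g :: "'a \<Rightarrow> real"
  assumes f: "f \<in> borel_measurable M" "integrable M (\<lambda>x. (f x)\<^sup>2)"
    and g: "g \<in> borel_measurable M" "integrable M (\<lambda>x. (g x)\<^sup>2)"
  shows "integrable M (\<lambda>x. f x * g x)"
    and "(\<integral>x. f x * g x \<partial>M)\<^sup>2 \<le> (\<integral>x. (f x)\<^sup>2 \<partial>M) * (\<integral>x. (g x)\<^sup>2 \<partial>M)"
proof -
  note [measurable] = f(1) g(1)
  show fg: "integrable M (\<lambda>x. f x * g x)"
  proof (rule Bochner_Integration.integrable_bound[of _ "\<lambda>x. (f x)\<^sup>2 + (g x)\<^sup>2"])
    show "integrable M (\<lambda>x. (f x)\<^sup>2 + (g x)\<^sup>2)" using f g by simp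
    show "AE x in M. norm (f x * g x) \<le> norm ((f x)\<^sup>2 + (g x)\<^sup>2)"
    proof (rule AE_I2)
      fix x
      have "0 \<le> (\<bar>f x\<bar> - \<bar>g x\<bar>)\<^sup>2" by simp
      then have "2 * (\<bar>f x\<bar> * \<bar>g x\<bar>) \<le> (f x)\<^sup>2 + (g x)\<^sup>2" by (simp add: power2_diff)
      moreover have "0 \<le> \<bar>f x\<bar> * \<bar>g x\<bar>" by simp
      ultimately have "\<bar>f x\<bar> * \<bar>g x\<bar> \<le> (f x)\<^sup>2 + (g x)\<^sup>2" by linarith
      then show "norm (f x * g x) \<le> norm ((f x)\<^sup>2 + (g x)\<^sup>2)" by (simp add: abs_mult)
    qed
  qed measurable
  define A B C where "A = (\<integral>x. (f x)\<^sup>2 \<partial>M)" and "B = (\<integral>x. f x * g x \<partial>M)" and "C = (\<integral>x. (g x)\<^sup>2 \<partial>M)"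
  have C0: "C \<ge> 0" by (simp add: C_def)
  have "B\<^sup>2 \<le> A * C"
  proof (cases "C = 0")
    case True
    then have "AE x in M. g x = 0" using g by (simp add: C_def integral_nonneg_eq_0_iff_AE)
    then have "B = (\<integral>x. 0 \<partial>M)" unfolding B_def by (intro integral_cong_AE) auto
    then show ?thesis using True by simp
  next
    case False
    have "0 \<le> (\<integral>x. (C * f x - B * g x)\<^sup>2 \<partial>M)" by simp
    also have "(\<lambda>x. (C * f x - B * g x)\<^sup>2) = (\<lambda>x. C\<^sup>2 * (f x)\<^sup>2 - 2 * C * B * (f x * g x) + B\<^sup>2 * (g x)\<^sup>2)"
      by (simp add: power2_eq_square algebra_simps)
    also have "(\<integral>x. C\<^sup>2 * (f x)\<^sup>2 - 2 * C * B * (f x * g x) + B\<^sup>2 * (g x)\<^sup>2 \<partial>M) = C\<^sup>2 * A - 2 * C * B * B + B\<^sup>2 * C"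
      using f g fg by (simp add: A_def B_def C_def)
    also have "\<dots> = C * (A * C - B\<^sup>2)" by (simp add: power2_eq_square algebra_simps)
    finally show ?thesis using C0 False by (simp add: zero_le_mult_iff)
  qed
  then show "(\<integral>x. f x * g x \<partial>M)\<^sup>2 \<le> (\<integral>x. (f x)\<^sup>2 \<partial>M) * (\<integral>x. (g x)\<^sup>2 \<partial>M)"
    by (simp add: A_def B_def C_def)
qed

section \<open>Moment inequalities under bounded kurtosis, and the uniform deviation bound\<close>

lemma quad_moment_nonneg: "0 \<le> quad_moment P \<theta>"
  by (simp add: quad_moment_def)

lemma quad_moment_scale: "quad_moment P (a *\<^sub>R \<theta>) = a\<^sup>2 * quad_moment P \<theta>"
  by (simp add: quad_moment_def power_mult_distrib)

text \<open>The bracket multiplied by \<open>n\<close> bounds the mean under \<open>P\<close> of the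
  right-hand side of \<open>integral_pert_le\<close>, less one, with
  \<open>v = (norm x)\<^sup>2 / b\<close>; the last term is the relative entropy of the translate by
  \<open>sqrt b *\<^sub>R \<theta>\<close>. The sign \<open>s\<close> selects the upper or the lower
  deviation.\<close>

definition deviation_bound ::
    "(real ^ 'd) measure \<Rightarrow> nat \<Rightarrow> real \<Rightarrow> real \<Rightarrow> real \<Rightarrow> real ^ 'd \<Rightarrow> real" where
  "deviation_bound P n l b s \<theta> =
     real n * (s * (quad_moment P \<theta> - l)
       + (kappa P * (quad_moment P \<theta>)\<^sup>2 - 2 * l * quad_moment P \<theta> + l\<^sup>2) / 2
       + 34 * sqrt (kappa P) * (s4 P)\<^sup>2 * quad_moment P \<theta> / b + 65 * s4 P ^ 4 / b\<^sup>2)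
     + b * (norm \<theta>)\<^sup>2 / 2"

locale quartic_law =
  fixes P :: "(real ^ 'd) measure"
  assumes prob: "prob_space P" and sets_P[measurable_cong]: "sets P = sets borel"
    and int_norm4: "integrable P (\<lambda>x. norm x ^ 4)"
    and kurt: "bdd_above (kurtosis_ratios P)" and kappa_ge: "kappa P \<ge> 3 / 2"
begin

sublocale prob_space P by (rule prob)

lemma kappa_pos: "kappa P > 0" "sqrt (kappa P) > 0" "kappa P - 1 > 0"
  using kappa_ge by auto

lemma int_norm2: "integrable P (\<lambda>x. (norm x)\<^sup>2)"
proof (rule Bochner_Integration.integrable_bound[of _ "\<lambda>x. 1 + norm x ^ 4"])
  show "integrable P (\<lambda>x. 1 + norm x ^ 4)" using int_norm4 by simp
  show "AE x in P. norm ((norm x)\<^sup>2) \<le> norm (1 + norm x ^ 4)"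
  proof (rule AE_I2)
    fix x :: "real ^ 'd"
    have "0 \<le> ((norm x)\<^sup>2 - 1)\<^sup>2" by simp
    then have "2 * (norm x)\<^sup>2 \<le> 1 + norm x ^ 4" by (simp add: power2_eq_square power4_eq_xxxx algebra_simps)
    then have "(norm x)\<^sup>2 \<le> 1 + norm x ^ 4" using zero_le_power2[of "norm x"] by linarith
    then show "norm ((norm x)\<^sup>2) \<le> norm (1 + norm x ^ 4)" by simp
  qed
qed measurable

lemma int_inner:
  shows "integrable P (\<lambda>x. (\<theta> \<bullet> x)\<^sup>2)" "integrable P (\<lambda>x. (\<theta> \<bullet> x) ^ 4)"
    "integrable P (\<lambda>x. (\<theta> \<bullet> x)\<^sup>2 * (norm x)\<^sup>2)"
proof -
  have cs: "(\<theta> \<bullet> x)\<^sup>2 \<le> (norm \<theta>)\<^sup>2 * (norm x)\<^sup>2" for x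
    using Cauchy_Schwarz_ineq2[of \<theta> x] by (metis abs_ge_zero power2_abs power_mono power_mult_distrib)
  show "integrable P (\<lambda>x. (\<theta> \<bullet> x)\<^sup>2)"
    by (rule Bochner_Integration.integrable_bound[of _ "\<lambda>x. (norm \<theta>)\<^sup>2 * (norm x)\<^sup>2"])
       (use int_norm2 cs in auto)
  show "integrable P (\<lambda>x. (\<theta> \<bullet> x)\<^sup>2 * (norm x)\<^sup>2)"
  proof (rule Bochner_Integration.integrable_bound[of _ "\<lambda>x. (norm \<theta>)\<^sup>2 * norm x ^ 4"])
    show "AE x in P. norm ((\<theta> \<bullet> x)\<^sup>2 * (norm x)\<^sup>2) \<le> norm ((norm \<theta>)\<^sup>2 * norm x ^ 4)"
    proof (rule AE_I2)
      fix x :: "real ^ 'd"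
      have "(\<theta> \<bullet> x)\<^sup>2 * (norm x)\<^sup>2 \<le> (norm \<theta>)\<^sup>2 * (norm x)\<^sup>2 * (norm x)\<^sup>2"
        using cs by (rule mult_right_mono) simp
      also have "\<dots> = (norm \<theta>)\<^sup>2 * norm x ^ 4" by (simp add: power4_eq_xxxx power2_eq_square mult.assoc)
      finally show "norm ((\<theta> \<bullet> x)\<^sup>2 * (norm x)\<^sup>2) \<le> norm ((norm \<theta>)\<^sup>2 * norm x ^ 4)" by simp
    qed
  qed (use int_norm4 in auto)
  show "integrable P (\<lambda>x. (\<theta> \<bullet> x) ^ 4)"
  proof (rule Bochner_Integration.integrable_bound[of _ "\<lambda>x. norm \<theta> ^ 4 * norm x ^ 4"])
    have "(\<theta> \<bullet> x) ^ 4 \<le> norm \<theta> ^ 4 * norm x ^ 4" for x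
      using power_mono[OF Cauchy_Schwarz_ineq2[of \<theta> x], of 4] by (simp add: power_mult_distrib)
    then show "AE x in P. norm ((\<theta> \<bullet> x) ^ 4) \<le> norm (norm \<theta> ^ 4 * norm x ^ 4)" by auto
  qed (use int_norm4 in auto)
qed

text \<open>Directions of zero second moment are absent from \<open>kurtosis_ratios\<close>, but
  there \<open>\<theta> \<bullet> x\<close> vanishes almost surely and both sides are zero.\<close>

lemma fourth_moment_le: "(\<integral>x. (\<theta> \<bullet> x) ^ 4 \<partial>P) \<le> kappa P * (quad_moment P \<theta>)\<^sup>2"
proof (cases "quad_moment P \<theta> > 0")
  case True
  then have "(\<integral>x. (\<theta> \<bullet> x) ^ 4 \<partial>P) / (\<integral>x. (\<theta> \<bullet> x)\<^sup>2 \<partial>P)\<^sup>2 \<in> kurtosis_ratios P"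
    by (auto simp: kurtosis_ratios_def quad_moment_def)
  then have "(\<integral>x. (\<theta> \<bullet> x) ^ 4 \<partial>P) / (\<integral>x. (\<theta> \<bullet> x)\<^sup>2 \<partial>P)\<^sup>2 \<le> kappa P"
    unfolding kappa_def by (intro cSup_upper kurt)
  then show ?thesis using True by (simp add: quad_moment_def field_simps)
next
  case False
  then have "quad_moment P \<theta> = 0" using quad_moment_nonneg[of P \<theta>] by simp
  then have "AE x in P. (\<theta> \<bullet> x)\<^sup>2 = 0"
    using int_inner(1) by (simp add: quad_moment_def integral_nonneg_eq_0_iff_AE)
  then have "(\<integral>x. (\<theta> \<bullet> x) ^ 4 \<partial>P) = (\<integral>x. 0 \<partial>P)"
    by (intro integral_cong_AE) auto
  then show ?thesis using kappa_pos by simp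
qed

lemma s4_nonneg: "s4 P \<ge> 0"
  by (simp add: s4_def)

lemma s4_power4: "s4 P ^ 4 = (\<integral>x. norm x ^ 4 \<partial>P)"
  by (simp add: s4_def)

text \<open>Cauchy-Schwarz, then the kurtosis bound for the fourth moment. This controls the term
  \<open>m\<^sup>2 * v\<close> of the perturbation, whose variance is proportional to
  \<open>(norm x)\<^sup>2\<close>.\<close>

lemma mixed_moment_le: "(\<integral>x. (\<theta> \<bullet> x)\<^sup>2 * (norm x)\<^sup>2 \<partial>P) \<le> sqrt (kappa P) * quad_moment P \<theta> * (s4 P)\<^sup>2"
proof (rule power2_le_imp_le)
  have "(\<integral>x. (\<theta> \<bullet> x)\<^sup>2 * (norm x)\<^sup>2 \<partial>P)\<^sup>2
      \<le> (\<integral>x. ((\<theta> \<bullet> x)\<^sup>2)\<^sup>2 \<partial>P) * (\<integral>x. ((norm x)\<^sup>2)\<^sup>2 \<partial>P)"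
    by (rule Cauchy_Schwarz_integral(2)) (use int_inner int_norm4 in auto)
  also have "\<dots> \<le> (kappa P * (quad_moment P \<theta>)\<^sup>2) * s4 P ^ 4"
    unfolding s4_power4 using fourth_moment_le[of \<theta>] by (intro mult_mono) (use kappa_pos in auto)
  also have "\<dots> = (sqrt (kappa P) * quad_moment P \<theta> * (s4 P)\<^sup>2)\<^sup>2"
    using kappa_pos by (simp add: power_mult_distrib)
  finally show "(\<integral>x. (\<theta> \<bullet> x)\<^sup>2 * (norm x)\<^sup>2 \<partial>P)\<^sup>2 \<le> (sqrt (kappa P) * quad_moment P \<theta> * (s4 P)\<^sup>2)\<^sup>2" .
qed (use kappa_pos quad_moment_nonneg[of P \<theta>] in simp)

lemma quad_moment_le:
  assumes "norm \<theta> = 1"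
  shows "quad_moment P \<theta> \<le> (s4 P)\<^sup>2"
proof (rule power2_le_imp_le)
  have "(\<integral>x. (\<theta> \<bullet> x)\<^sup>2 * 1 \<partial>P)\<^sup>2 \<le> (\<integral>x. ((\<theta> \<bullet> x)\<^sup>2)\<^sup>2 \<partial>P) * (\<integral>x. 1\<^sup>2 \<partial>P)"
    by (rule Cauchy_Schwarz_integral(2)) (use int_inner in auto)
  also have "\<dots> = (\<integral>x. (\<theta> \<bullet> x) ^ 4 \<partial>P)" by (simp add: prob_space)
  also have "\<dots> \<le> (\<integral>x. norm x ^ 4 \<partial>P)"
  proof (intro integral_mono int_inner int_norm4)
    fix x show "(\<theta> \<bullet> x) ^ 4 \<le> norm x ^ 4"
      using power_mono[OF Cauchy_Schwarz_ineq2[of \<theta> x], of 4] assms by simp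
  qed
  finally show "(quad_moment P \<theta>)\<^sup>2 \<le> ((s4 P)\<^sup>2)\<^sup>2" by (simp add: quad_moment_def s4_power4)
qed simp

lemma trace_gram: "trace (gram_matrix P) = (\<Sum>i\<in>UNIV. quad_moment P (axis i 1))"
  by (simp add: trace_def gram_matrix_def quad_moment_def inner_axis' power2_eq_square)

text \<open>Summing \<open>mixed_moment_le\<close> over the coordinate axes bounds
  \<open>s4 P ^ 4\<close> by the right-hand side times \<open>(s4 P)\<^sup>2\<close>. This links the
  grid, scaled by \<open>s4\<close>, with \<open>zeta_star\<close>, written with the trace.\<close>

lemma s4_le_trace: "(s4 P)\<^sup>2 \<le> sqrt (kappa P) * trace (gram_matrix P)"
proof (cases "s4 P = 0")
  case True
  then show ?thesis using kappa_pos by (simp add: trace_gram sum_nonneg quad_moment_nonneg)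
next
  case False
  have norm2: "(\<Sum>i\<in>UNIV. (axis i 1 \<bullet> x)\<^sup>2) = (norm x)\<^sup>2" for x :: "real ^ 'd"
    unfolding power2_norm_eq_inner inner_vec_def[of x x] by (simp add: inner_axis' power2_eq_square)
  have "s4 P ^ 4 = (\<integral>x. (\<Sum>i\<in>UNIV. (axis i 1 \<bullet> x)\<^sup>2 * (norm x)\<^sup>2) \<partial>P)"
    unfolding s4_power4 sum_distrib_right[symmetric] norm2
    by (simp add: power4_eq_xxxx power2_eq_square mult.assoc)
  also have "\<dots> = (\<Sum>i\<in>UNIV. \<integral>x. (axis i 1 \<bullet> x)\<^sup>2 * (norm x)\<^sup>2 \<partial>P)"
    using int_inner(3) by (intro Bochner_Integration.integral_sum) auto
  also have "\<dots> \<le> (\<Sum>i\<in>UNIV. sqrt (kappa P) * quad_moment P (axis i 1) * (s4 P)\<^sup>2)"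
    by (intro sum_mono mixed_moment_le)
  also have "\<dots> = sqrt (kappa P) * trace (gram_matrix P) * (s4 P)\<^sup>2"
    by (simp add: trace_gram sum_distrib_left sum_distrib_right)
  finally have "(s4 P)\<^sup>2 * (s4 P)\<^sup>2 \<le> sqrt (kappa P) * trace (gram_matrix P) * (s4 P)\<^sup>2"
    by (simp add: power4_eq_xxxx power2_eq_square mult.assoc)
  then show ?thesis using False by (metis mult_le_cancel_right_pos zero_less_power2)
qed

lemma variance_le:
  "(\<integral>x. ((\<theta> \<bullet> x)\<^sup>2 - l)\<^sup>2 \<partial>P) \<le> kappa P * (quad_moment P \<theta>)\<^sup>2 - 2 * l * quad_moment P \<theta> + l\<^sup>2"
proof -
  have "(\<lambda>x. ((\<theta> \<bullet> x)\<^sup>2 - l)\<^sup>2) = (\<lambda>x. (\<theta> \<bullet> x) ^ 4 - 2 * l * (\<theta> \<bullet> x)\<^sup>2 + l\<^sup>2)"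
    by (simp add: power2_eq_square power4_eq_xxxx algebra_simps)
  then have "(\<integral>x. ((\<theta> \<bullet> x)\<^sup>2 - l)\<^sup>2 \<partial>P) = (\<integral>x. (\<theta> \<bullet> x) ^ 4 \<partial>P) - 2 * l * quad_moment P \<theta> + l\<^sup>2"
    using int_inner[of \<theta>] by (simp add: quad_moment_def prob_space)
  then show ?thesis using fourth_moment_le[of \<theta>] by simp
qed

text \<open>\<open>pac_bayes\<close> is applied in coordinates rescaled by \<open>sqrt b\<close>:
  \<open>gauss\<close> becomes the centred Gaussian of covariance \<open>I / b\<close>, and its
  translate the law of a perturbation of \<open>\<theta>\<close>. Exchanging the two means allows
  the Gaussian one to be bounded pointwise in \<open>x\<close> before the moments of
  \<open>P\<close> are used.\<close>

lemma deviation: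
  fixes M :: "'w measure" and X :: "nat \<Rightarrow> 'w \<Rightarrow> real ^ 'd"
  assumes M: "prob_space M" and indep: "prob_space.indep_vars M (\<lambda>_. borel) X {1..n}"
    and law: "\<And>i. i \<in> {1..n} \<Longrightarrow> distr M borel (X i) = P"
    and "\<epsilon> > 0" and b: "b > 0" and s: "s\<^sup>2 = 1"
  shows "\<exists>E \<in> sets M. measure M E \<ge> 1 - \<epsilon> \<and> (\<forall>\<omega>\<in>E. \<forall>\<theta>.
      (\<Sum>i = 1..n. psi (s * ((\<theta> \<bullet> X i \<omega>)\<^sup>2 - l)))
        \<le> deviation_bound P n l b s \<theta> + ln (1 / \<epsilon>))"
proof -
  define Y where "Y y x = pert s l ((norm x)\<^sup>2 / b) (y \<bullet> x / sqrt b)" for y x :: "real ^ 'd"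
  have v0: "(norm x)\<^sup>2 / b \<ge> 0" for x :: "real ^ 'd" using b by simp
  have Yshift: "Y (y + sqrt b *\<^sub>R \<theta>) x = pert s l ((norm x)\<^sup>2 / b) (\<theta> \<bullet> x + y \<bullet> (x /\<^sub>R sqrt b))" for y \<theta> x
    using b unfolding Y_def by (simp add: inner_add_left field_simps)
  have mom: "gaussian_moments gauss (\<lambda>y. y \<bullet> (x /\<^sub>R sqrt b)) ((norm x)\<^sup>2 / b)" for x :: "real ^ 'd"
    using gauss_moments[of "x /\<^sub>R sqrt b"] b by (simp add: power_mult_distrib power_divide field_simps)
  have Ym[measurable]: "case_prod Y \<in> borel_measurable (borel \<Otimes>\<^sub>M borel)"
    unfolding Y_def pert_def lower_quad_def by measurable
  have Yge: "Y y x \<ge> 1 / 2" for y x unfolding Y_def by (intro pert_ge_half v0)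
  interpret G: prob_space "gauss :: (real ^ 'd) measure" by (rule prob_space_gauss)
  interpret PG: pair_prob_space P "gauss :: (real ^ 'd) measure" ..
  define R where "R \<theta> x = 1 + s * ((\<theta> \<bullet> x)\<^sup>2 - l) + ((\<theta> \<bullet> x)\<^sup>2 - l)\<^sup>2 / 2
      + 34 * (\<theta> \<bullet> x)\<^sup>2 * ((norm x)\<^sup>2 / b) + 65 * ((norm x)\<^sup>2 / b)\<^sup>2" for \<theta> x :: "real ^ 'd"
  have var_int: "integrable P (\<lambda>x. ((\<theta> \<bullet> x)\<^sup>2 - l)\<^sup>2)" for \<theta>
  proof -
    have "(\<lambda>x. ((\<theta> \<bullet> x)\<^sup>2 - l)\<^sup>2) = (\<lambda>x. (\<theta> \<bullet> x) ^ 4 - 2 * l * (\<theta> \<bullet> x)\<^sup>2 + l\<^sup>2)"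
      by (simp add: power2_eq_square power4_eq_xxxx algebra_simps)
    then show ?thesis using int_inner[of \<theta>] by simp
  qed
  define B where "B \<theta> = s * (quad_moment P \<theta> - l)
      + (kappa P * (quad_moment P \<theta>)\<^sup>2 - 2 * l * quad_moment P \<theta> + l\<^sup>2) / 2
      + 34 * sqrt (kappa P) * (s4 P)\<^sup>2 * quad_moment P \<theta> / b + 65 * s4 P ^ 4 / b\<^sup>2" for \<theta>
  have R_int: "integrable P (R \<theta>)"
    and R_le: "(\<integral>x. R \<theta> x \<partial>P) \<le> 1 + B \<theta>" for \<theta>
  proof -
    have R: "R \<theta> = (\<lambda>x. 1 + s * ((\<theta> \<bullet> x)\<^sup>2 - l) + ((\<theta> \<bullet> x)\<^sup>2 - l)\<^sup>2 / 2
      + 34 / b * ((\<theta> \<bullet> x)\<^sup>2 * (norm x)\<^sup>2) + 65 / b\<^sup>2 * norm x ^ 4)"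
      by (auto simp: R_def power_divide)
    show "integrable P (R \<theta>)" unfolding R using int_inner[of \<theta>] int_norm4 var_int[of \<theta>] by auto
    have "(\<integral>x. R \<theta> x \<partial>P) = 1 + s * (quad_moment P \<theta> - l) + (\<integral>x. ((\<theta> \<bullet> x)\<^sup>2 - l)\<^sup>2 \<partial>P) / 2
      + 34 / b * (\<integral>x. (\<theta> \<bullet> x)\<^sup>2 * (norm x)\<^sup>2 \<partial>P) + 65 / b\<^sup>2 * s4 P ^ 4"
      unfolding R s4_power4 quad_moment_def using int_inner[of \<theta>] int_norm4 var_int[of \<theta>]
      by (simp add: prob_space)
    moreover have "34 / b * (\<integral>x. (\<theta> \<bullet> x)\<^sup>2 * (norm x)\<^sup>2 \<partial>P) \<le> 34 / b * (sqrt (kappa P) * quad_moment P \<theta> * (s4 P)\<^sup>2)"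
      using mixed_moment_le b by (intro mult_left_mono) auto
    ultimately show "(\<integral>x. R \<theta> x \<partial>P) \<le> 1 + B \<theta>"
      unfolding B_def using variance_le[of \<theta> l] by (simp add: mult_ac) argo
  qed
  have int_y: "integrable gauss (\<lambda>y. Y (y + sqrt b *\<^sub>R \<theta>) x)" for \<theta> x
    unfolding Yshift by (rule gaussian_moments.pert_integrable(1)[OF mom v0])
  have int_y_le: "(\<integral>y. Y (y + sqrt b *\<^sub>R \<theta>) x \<partial>gauss) \<le> R \<theta> x" for \<theta> x
    unfolding Yshift R_def by (rule gaussian_moments.integral_pert_le[OF mom v0 s])
  have int_y_ge: "0 \<le> (\<integral>y. Y (y + sqrt b *\<^sub>R \<theta>) x \<partial>gauss)" for \<theta> x
    by (intro integral_nonneg_AE AE_I2 order_trans[OF _ Yge]) simp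
  have int_xy: "integrable P (\<lambda>x. \<integral>y. Y (y + sqrt b *\<^sub>R \<theta>) x \<partial>gauss)" for \<theta>
  proof (rule Bochner_Integration.integrable_bound[OF R_int[of \<theta>]])
    show "AE x in P. norm (\<integral>y. Y (y + sqrt b *\<^sub>R \<theta>) x \<partial>gauss) \<le> norm (R \<theta> x)"
    proof (rule AE_I2)
      fix x
      show "norm (\<integral>y. Y (y + sqrt b *\<^sub>R \<theta>) x \<partial>gauss) \<le> norm (R \<theta> x)"
        using int_y_le[of \<theta> x] int_y_ge[of \<theta> x] by simp
    qed
  qed measurable
  have pairm[measurable]: "(\<lambda>(x, y). Y (y + sqrt b *\<^sub>R \<theta>) x) \<in> borel_measurable (P \<Otimes>\<^sub>M gauss)" for \<theta>
    by measurable
  have int_pair: "integrable (P \<Otimes>\<^sub>M gauss) (\<lambda>(x, y). Y (y + sqrt b *\<^sub>R \<theta>) x)" for \<theta>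
  proof (rule PG.Fubini_integrable)
    have "norm (Y y x) = Y y x" for y x using Yge[of y x] by simp
    then show "integrable P (\<lambda>x. \<integral>y. norm (case (x, y) of (x, y) \<Rightarrow> Y (y + sqrt b *\<^sub>R \<theta>) x) \<partial>gauss)"
      using int_xy[of \<theta>] by simp
  qed (use int_y in auto)
  \<comment> \<open>Here \<open>y\<close> is fixed and no Gaussian averaging helps; the dominating
    polynomial has degree at most 4 in \<open>x\<close>, within reach of the fourth moment of the
    norm.\<close>
  have Yint: "integrable P (Y y)" for y
  proof -
    define Z where "Z x = pert_poly s l ((norm x)\<^sup>2 / b) (y \<bullet> x / sqrt b)" for x
    have "Z = (\<lambda>x. 1 - s * l + l\<^sup>2 / 2 + (s - l) * ((y \<bullet> x)\<^sup>2 / b) - (s - l) * ((norm x)\<^sup>2 / b)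
        + (y \<bullet> x) ^ 4 / b\<^sup>2 / 2 + 31 * ((y \<bullet> x)\<^sup>2 * (norm x)\<^sup>2 / b\<^sup>2) + 65 / 2 * (norm x ^ 4 / b\<^sup>2))"
    proof
      fix x
      define p q where "p = (y \<bullet> x)\<^sup>2 / b" and "q = (norm x)\<^sup>2 / b"
      have "(y \<bullet> x / sqrt b)\<^sup>2 = p" using b by (simp add: p_def power_divide)
      moreover have "(y \<bullet> x) ^ 4 / b\<^sup>2 = p\<^sup>2" "norm x ^ 4 / b\<^sup>2 = q\<^sup>2" "(y \<bullet> x)\<^sup>2 * (norm x)\<^sup>2 / b\<^sup>2 = p * q"
        by (simp_all add: p_def q_def power_divide) (simp add: power2_eq_square)
      moreover have "(s * (p - q - l))\<^sup>2 = (p - q - l)\<^sup>2" using s by (simp add: power_mult_distrib)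
      ultimately show "Z x = 1 - s * l + l\<^sup>2 / 2 + (s - l) * ((y \<bullet> x)\<^sup>2 / b) - (s - l) * ((norm x)\<^sup>2 / b)
        + (y \<bullet> x) ^ 4 / b\<^sup>2 / 2 + 31 * ((y \<bullet> x)\<^sup>2 * (norm x)\<^sup>2 / b\<^sup>2) + 65 / 2 * (norm x ^ 4 / b\<^sup>2)"
        unfolding Z_def pert_poly_def p_def[symmetric] q_def[symmetric]
        by (simp only:) (simp add: power2_eq_square field_simps)
    qed
    moreover have "integrable P (\<lambda>x. 1 - s * l + l\<^sup>2 / 2 + (s - l) * ((y \<bullet> x)\<^sup>2 / b) - (s - l) * ((norm x)\<^sup>2 / b)
        + (y \<bullet> x) ^ 4 / b\<^sup>2 / 2 + 31 * ((y \<bullet> x)\<^sup>2 * (norm x)\<^sup>2 / b\<^sup>2) + 65 / 2 * (norm x ^ 4 / b\<^sup>2))"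
      using int_inner[of y] int_norm2 int_norm4
      by (intro Bochner_Integration.integrable_add Bochner_Integration.integrable_diff integrable_mult_right
          integrable_divide integrable_const)
    ultimately have "integrable P Z" by simp
    then show ?thesis
    proof (rule Bochner_Integration.integrable_bound)
      have "norm (Y y x) \<le> norm (Z x)" for x
        using pert_le_poly[of s l "(norm x)\<^sup>2 / b" "y \<bullet> x / sqrt b"] Yge[of y x] unfolding Y_def Z_def by simp
      then show "AE x in P. norm (Y y x) \<le> norm (Z x)" by simp
    qed measurable
  qed
  obtain E where E: "E \<in> sets M" "measure M E \<ge> 1 - \<epsilon>"
    and bound: "\<And>\<omega> u. \<omega> \<in> E \<Longrightarrow> (\<forall>x. integrable gauss (\<lambda>y. Y (y + u) x)) \<Longrightarrow>
      integrable gauss (\<lambda>y. \<integral>x. Y (y + u) x \<partial>P) \<Longrightarrow>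
      (\<Sum>i = 1..n. \<integral>y. ln (Y (y + u) (X i \<omega>)) \<partial>gauss)
        \<le> real n * ((\<integral>y. (\<integral>x. Y (y + u) x \<partial>P) \<partial>gauss) - 1) + ln (1 / \<epsilon>) + (norm u)\<^sup>2 / 2"
    using pac_bayes[OF M prob sets_P indep law Ym Yge Yint \<open>\<epsilon> > 0\<close>] by blast
  show ?thesis
  proof (intro bexI[of _ E] conjI ballI allI)
    fix \<omega> \<theta> assume "\<omega> \<in> E"
    have "(\<Sum>i = 1..n. psi (s * ((\<theta> \<bullet> X i \<omega>)\<^sup>2 - l))) \<le> (\<Sum>i = 1..n. \<integral>y. ln (Y (y + sqrt b *\<^sub>R \<theta>) (X i \<omega>)) \<partial>gauss)"
      unfolding Yshift by (intro sum_mono gaussian_moments.psi_le_integral[OF mom v0 s])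
    also have "\<dots> \<le> real n * ((\<integral>y. (\<integral>x. Y (y + sqrt b *\<^sub>R \<theta>) x \<partial>P) \<partial>gauss) - 1) + ln (1 / \<epsilon>) + (norm (sqrt b *\<^sub>R \<theta>))\<^sup>2 / 2"
      using bound[OF \<open>\<omega> \<in> E\<close>] int_y PG.integrable_snd[OF int_pair[of \<theta>]] by blast
    also have "(\<integral>y. (\<integral>x. Y (y + sqrt b *\<^sub>R \<theta>) x \<partial>P) \<partial>gauss) = (\<integral>x. (\<integral>y. Y (y + sqrt b *\<^sub>R \<theta>) x \<partial>gauss) \<partial>P)"
      using PG.Fubini_integral[OF int_pair[of \<theta>]] by simp
    also have "real n * ((\<integral>x. (\<integral>y. Y (y + sqrt b *\<^sub>R \<theta>) x \<partial>gauss) \<partial>P) - 1) \<le> real n * ((\<integral>x. R \<theta> x \<partial>P) - 1)"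
      by (intro mult_left_mono diff_right_mono integral_mono int_xy R_int int_y_le) auto
    also have "\<dots> \<le> real n * ((1 + B \<theta>) - 1)"
      by (intro mult_left_mono diff_right_mono R_le) auto
    finally show "(\<Sum>i = 1..n. psi (s * ((\<theta> \<bullet> X i \<omega>)\<^sup>2 - l)))
        \<le> deviation_bound P n l b s \<theta> + ln (1 / \<epsilon>)"
      unfolding deviation_bound_def B_def[symmetric] using b by (simp add: power_mult_distrib)
  qed (use E in auto)
qed

end

subsection \<open>Symmetric matrices\<close>

lemma symmetric_inner:
  fixes Q :: "real ^ 'd ^ 'd"
  assumes "transpose Q = Q"
  shows "x \<bullet> (Q *v y) = y \<bullet> (Q *v x)"
  using assms by (metis dot_lmul_matrix inner_commute vector_transpose_matrix)

text \<open>The first-order condition at a maximum of the Rayleigh quotient.\<close>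

lemma linear_term_zero:
  fixes b c :: real
  assumes "\<And>t. 2 * t * b \<le> t\<^sup>2 * c"
  shows "b = 0"
proof (rule ccontr)
  assume b: "b \<noteq> 0"
  define K where "K = \<bar>c\<bar> + 1"
  have K: "K > 0" "c < K" by (auto simp: K_def)
  have "2 * (b / K) * b * K\<^sup>2 \<le> (b / K)\<^sup>2 * c * K\<^sup>2" by (intro mult_right_mono assms) simp
  moreover have "2 * (b / K) * b * K\<^sup>2 = 2 * b\<^sup>2 * K" "(b / K)\<^sup>2 * c * K\<^sup>2 = b\<^sup>2 * c"
    using K(1) by (simp_all add: power2_eq_square)
  ultimately have "2 * b\<^sup>2 * K \<le> b\<^sup>2 * c" by simp
  moreover have "b\<^sup>2 * c < b\<^sup>2 * K" "0 < b\<^sup>2 * K" using b K by simp_all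
  ultimately show False by linarith
qed

text \<open>A maximiser of the quadratic form on the unit sphere of \<open>S\<close> makes
  \<open>Q *v v - c *\<^sub>R v\<close> orthogonal to \<open>S\<close>; by invariance this vector
  also lies in \<open>S\<close>, so it is zero.\<close>

lemma symmetric_eigenvector:
  fixes Q :: "real ^ 'd ^ 'd"
  assumes sym: "transpose Q = Q" and S: "subspace S" "S \<noteq> {0}" and inv: "\<And>x. x \<in> S \<Longrightarrow> Q *v x \<in> S"
  obtains v c where "v \<in> S" "norm v = 1" "Q *v v = c *\<^sub>R v"
proof -
  have cS: "closed S" using S(1) by (rule closed_subspace)
  obtain w where w: "w \<in> S" "w \<noteq> 0" using S subspace_0 by blast
  have "w /\<^sub>R norm w \<in> S \<inter> sphere 0 1" using w S by (auto intro: subspace_scale)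
  moreover have "compact (S \<inter> sphere 0 1)" using cS by (intro closed_Int_compact) auto
  moreover have "continuous_on (S \<inter> sphere 0 1) (\<lambda>x. x \<bullet> (Q *v x))"
    by (intro continuous_on_inner continuous_on_id matrix_vector_mult_linear_continuous_on)
  ultimately have "\<exists>v\<in>S \<inter> sphere 0 1. \<forall>x\<in>S \<inter> sphere 0 1. x \<bullet> (Q *v x) \<le> v \<bullet> (Q *v v)"
    by (intro continuous_attains_sup) auto
  then obtain v where v: "v \<in> S \<inter> sphere 0 1"
    and max: "\<And>x. x \<in> S \<inter> sphere 0 1 \<Longrightarrow> x \<bullet> (Q *v x) \<le> v \<bullet> (Q *v v)"
    by blast
  define c where "c = v \<bullet> (Q *v v)"
  have maxS: "x \<bullet> (Q *v x) \<le> c * (x \<bullet> x)" if "x \<in> S" for x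
  proof (cases "x = 0")
    case False
    have "x /\<^sub>R norm x \<in> S \<inter> sphere 0 1" using that False S by (auto intro: subspace_scale)
    then have "inverse (norm x) * (inverse (norm x) * (x \<bullet> (Q *v x))) \<le> c"
      using max[of "x /\<^sub>R norm x"] unfolding c_def matrix_vector_mult_scaleR by simp
    then have "(x \<bullet> (Q *v x)) / (norm x)\<^sup>2 \<le> c"
      by (simp add: power2_eq_square divide_inverse mult_ac)
    then show ?thesis using False by (simp add: dot_square_norm divide_le_eq)
  qed simp
  have v1: "v \<in> S" "norm v = 1" "v \<bullet> v = 1" using v by (auto simp: norm_eq_1)
  have "w \<bullet> (Q *v v - c *\<^sub>R v) = 0" if w: "w \<in> S" for w
  proof (rule linear_term_zero)
    fix t :: real
    have "v + t *\<^sub>R w \<in> S" using v1 w S by (auto intro: subspace_add subspace_scale)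
    then have "(v + t *\<^sub>R w) \<bullet> (Q *v v + t *\<^sub>R (Q *v w)) \<le> c * ((v + t *\<^sub>R w) \<bullet> (v + t *\<^sub>R w))"
      using maxS[of "v + t *\<^sub>R w"] unfolding matrix_vector_right_distrib matrix_vector_mult_scaleR by blast
    moreover have "(v + t *\<^sub>R w) \<bullet> (Q *v v + t *\<^sub>R (Q *v w))
        = c + 2 * t * (w \<bullet> (Q *v v)) + t\<^sup>2 * (w \<bullet> (Q *v w))"
      using symmetric_inner[OF sym, of v w]
      by (simp add: inner_add_left inner_add_right c_def power2_eq_square distrib_left)
    moreover have "(v + t *\<^sub>R w) \<bullet> (v + t *\<^sub>R w) = 1 + 2 * t * (w \<bullet> v) + t\<^sup>2 * (w \<bullet> w)"
      using v1(3) by (simp add: inner_add_left inner_add_right inner_commute[of v w] power2_eq_square distrib_left)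
    ultimately have "c + 2 * t * (w \<bullet> (Q *v v)) + t\<^sup>2 * (w \<bullet> (Q *v w))
        \<le> c * (1 + 2 * t * (w \<bullet> v) + t\<^sup>2 * (w \<bullet> w))" by (simp only:)
    then show "2 * t * (w \<bullet> (Q *v v - c *\<^sub>R v)) \<le> t\<^sup>2 * (c * (w \<bullet> w) - w \<bullet> (Q *v w))"
      by (simp add: inner_diff_right algebra_simps)
  qed
  moreover have "Q *v v - c *\<^sub>R v \<in> S" using v1 inv S by (auto intro: subspace_diff subspace_scale)
  ultimately have "(Q *v v - c *\<^sub>R v) \<bullet> (Q *v v - c *\<^sub>R v) = 0" by blast
  then have "Q *v v = c *\<^sub>R v" by simp
  then show ?thesis using that v1 by blast
qed

text \<open>By symmetry the orthogonal complement of an eigenvector inside an invariant subspace is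
  again invariant, with dimension one less; the general \<open>S\<close> is what lets the induction
  run.\<close>

lemma symmetric_eigenbasis:
  fixes Q :: "real ^ 'd ^ 'd"
  assumes sym: "transpose Q = Q"
  shows "subspace S \<Longrightarrow> (\<And>x. x \<in> S \<Longrightarrow> Q *v x \<in> S) \<Longrightarrow>
    \<exists>B. pairwise orthogonal B \<and> B \<subseteq> S \<and> card B = dim S \<and> finite B \<and>
      (\<forall>v\<in>B. norm v = 1 \<and> (\<exists>c. Q *v v = c *\<^sub>R v))"
proof (induction "dim S" arbitrary: S)
  case 0
  then show ?case by (intro exI[of _ "{}"]) auto
next
  case (Suc n)
  have "S \<noteq> {0}" using Suc(2) by auto
  then obtain v c where v: "v \<in> S" "norm v = 1" "Q *v v = c *\<^sub>R v"
    using symmetric_eigenvector[OF sym Suc.prems(1) _ Suc.prems(2)] by metis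
  define T where "T = {x \<in> S. x \<bullet> v = 0}"
  have T: "subspace T" using Suc.prems(1)
    by (auto simp: T_def subspace_def inner_add_left)
  have invT: "Q *v x \<in> T" if "x \<in> T" for x
    using that Suc.prems(2) symmetric_inner[OF sym, of v x] v(3)
    by (auto simp: T_def inner_commute)
  have dT: "n = dim T"
  proof -
    have "S = span (insert v T)"
    proof
      show "S \<subseteq> span (insert v T)"
      proof
        fix x assume x: "x \<in> S"
        have "x - (x \<bullet> v) *\<^sub>R v \<in> T" using x v Suc.prems(1)
          by (auto simp: T_def inner_diff_left norm_eq_1 intro: subspace_diff subspace_scale)
        then have "x - (x \<bullet> v) *\<^sub>R v \<in> span (insert v T)" by (intro span_base) auto
        moreover have "(x \<bullet> v) *\<^sub>R v \<in> span (insert v T)" by (intro span_scale span_base) auto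
        ultimately have "(x - (x \<bullet> v) *\<^sub>R v) + (x \<bullet> v) *\<^sub>R v \<in> span (insert v T)" by (rule span_add)
        then show "x \<in> span (insert v T)" by simp
      qed
      show "span (insert v T) \<subseteq> S"
        using Suc.prems(1) v by (intro span_minimal) (auto simp: T_def)
    qed
    then have "dim S = dim (insert v T)" by simp
    moreover have "v \<notin> span T"
    proof
      assume "v \<in> span T"
      then have "v \<in> T" using T by (simp add: span_eq_iff[THEN iffD2])
      then show False using v by (simp add: T_def norm_eq_1)
    qed
    ultimately show ?thesis using Suc(2) by (simp add: dim_insert)
  qed
  obtain B where B: "pairwise orthogonal B" "B \<subseteq> T" "card B = dim T" "finite B"
      "\<forall>v\<in>B. norm v = 1 \<and> (\<exists>c. Q *v v = c *\<^sub>R v)"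
    using Suc(1)[OF dT T invT] by blast
  have "v \<notin> B" using B(2) v by (auto simp: T_def norm_eq_1)
  show ?case
  proof (intro exI[of _ "insert v B"] conjI)
    show "pairwise orthogonal (insert v B)"
      using B(1,2) by (auto simp: pairwise_insert T_def orthogonal_def inner_commute)
    show "card (insert v B) = dim S" using B \<open>v \<notin> B\<close> dT Suc(2) by simp
    show "insert v B \<subseteq> S" "finite (insert v B)" using B(2,4) v(1) by (auto simp: T_def)
    show "\<forall>w\<in>insert v B. norm w = 1 \<and> (\<exists>c. Q *v w = c *\<^sub>R w)" using B(5) v(2,3) by blast
  qed
qed

lemma diagonal_matrix_mult:
  "(A ** diagonal_matrix v) $ i $ j = A $ i $ j * v $ j"
  "(diagonal_matrix v ** A) $ i $ j = v $ i * A $ i $ j"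
  "(diagonal_matrix v *v y) $ i = v $ i * y $ i"
  by (simp_all add: matrix_matrix_mult_def matrix_vector_mult_def diagonal_matrix_def mult_delta_right mult_delta_left)

lemma spectral_decomposition:
  fixes Q :: "real ^ 'd ^ 'd"
  assumes sym: "transpose Q = Q"
  obtains U v where "orthogonal_matrix U" "Q = U ** diagonal_matrix v ** transpose U"
proof -
  obtain B :: "(real ^ 'd) set" where B: "pairwise orthogonal B" "card B = dim (UNIV :: (real ^ 'd) set)" "finite B"
      "\<forall>v\<in>B. norm v = 1 \<and> (\<exists>c. Q *v v = c *\<^sub>R v)"
    using symmetric_eigenbasis[OF sym subspace_UNIV UNIV_I] by (elim exE conjE)
  have "card B = CARD('d)" using B(2) by simp
  then obtain f where f: "bij_betw f (UNIV :: 'd set) B"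
    using B(3) bij_betw_iff_card[of "UNIV :: 'd set" B] by auto
  obtain e where e: "\<And>w. w \<in> B \<Longrightarrow> Q *v w = e w *\<^sub>R w" using B(4) by metis
  have fB: "f i \<in> B" for i using f by (auto simp: bij_betw_def)
  have ff: "f i \<bullet> f j = (if i = j then 1 else 0)" for i j
  proof (cases "i = j")
    case True then show ?thesis using bspec[OF B(4) fB[of i]] by (simp add: norm_eq_1)
  next
    case False
    then have "f i \<noteq> f j" using f by (auto simp: bij_betw_def inj_on_def)
    then show ?thesis using B(1) fB False by (auto simp: pairwise_def orthogonal_def)
  qed
  define U :: "real ^ 'd ^ 'd" where "U = (\<chi> i j. f j $ i)"
  define v :: "real ^ 'd" where "v = (\<chi> i. e (f i))"
  have UU: "transpose U ** U = mat 1"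
    using ff by (simp add: vec_eq_iff matrix_matrix_mult_def transpose_def U_def mat_def inner_vec_def)
  then have O: "orthogonal_matrix U" by (simp add: orthogonal_matrix)
  have "Q ** U = U ** diagonal_matrix v"
  proof -
    have "(Q ** U) $ i $ j = (U ** diagonal_matrix v) $ i $ j" for i j
    proof -
      have "(Q ** U) $ i $ j = (Q *v f j) $ i"
        by (simp add: matrix_matrix_mult_def matrix_vector_mult_def U_def)
      also have "\<dots> = e (f j) * f j $ i" using e[OF fB[of j]] by simp
      also have "\<dots> = (U ** diagonal_matrix v) $ i $ j"
        by (simp add: diagonal_matrix_mult U_def v_def)
      finally show ?thesis .
    qed
    then show ?thesis by (simp add: vec_eq_iff)
  qed
  then have "U ** diagonal_matrix v ** transpose U = Q ** (U ** transpose U)"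
    by (simp add: matrix_mul_assoc)
  also have "\<dots> = Q" using O by (simp add: orthogonal_matrix_def)
  finally show ?thesis using that O by metis
qed

text \<open>Well-definedness of the description operator. For two decompositions,
  \<open>V = transpose U' ** U\<close> intertwines the diagonal matrices, so a nonzero entry
  \<open>V $ i $ j\<close> forces \<open>v $ j = v' $ i\<close>. Then \<open>V\<close> intertwines
  any function of the eigenvalues as well, in particular the positive parts.\<close>

lemma positive_part_eq:
  fixes U :: "real ^ 'd ^ 'd"
  assumes U: "orthogonal_matrix U" and Q: "Q = U ** diagonal_matrix v ** transpose U"
  shows "positive_part Q = U ** diagonal_matrix (\<chi> i. max (v $ i) 0) ** transpose U"
  unfolding positive_part_def
proof (rule the_equality)
  show "\<exists>U' v'. orthogonal_matrix U' \<and> Q = U' ** diagonal_matrix v' ** transpose U' \<and>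
      U ** diagonal_matrix (\<chi> i. max (v $ i) 0) ** transpose U
        = U' ** diagonal_matrix (\<chi> i. max (v' $ i) 0) ** transpose U'"
    using U Q by blast
  fix R assume "\<exists>U v. orthogonal_matrix U \<and> Q = U ** diagonal_matrix v ** transpose U \<and>
      R = U ** diagonal_matrix (\<chi> i. max (v $ i) 0) ** transpose U"
  then obtain U' v' where U': "orthogonal_matrix U'" and Q': "Q = U' ** diagonal_matrix v' ** transpose U'"
    and R: "R = U' ** diagonal_matrix (\<chi> i. max (v' $ i) 0) ** transpose U'" by blast
  have UU: "transpose U ** U = mat 1" "U ** transpose U = mat 1"
     "transpose U' ** U' = mat 1" "U' ** transpose U' = mat 1"
    using U U' by (auto simp: orthogonal_matrix_def)
  have UZ: "transpose U' ** (U' ** Z) = Z" "U' ** (transpose U' ** Z) = Z" for Z :: "real ^ 'd ^ 'd"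
    by (simp_all add: matrix_mul_assoc UU)
  define V where "V = transpose U' ** U"
  have "V ** diagonal_matrix v = transpose U' ** (U ** diagonal_matrix v ** transpose U) ** U"
    by (simp add: V_def UU(1) flip: matrix_mul_assoc)
  also have "\<dots> = transpose U' ** (U' ** diagonal_matrix v' ** transpose U') ** U"
    using Q Q' by simp
  also have "\<dots> = diagonal_matrix v' ** V"
    by (simp add: V_def UZ flip: matrix_mul_assoc)
  finally have VD: "V ** diagonal_matrix v = diagonal_matrix v' ** V" .
  have "V $ i $ j * max (v $ j) 0 = max (v' $ i) 0 * V $ i $ j" for i j
  proof -
    have "V $ i $ j * v $ j = v' $ i * V $ i $ j"
      using arg_cong[OF VD, of "\<lambda>A. A $ i $ j"] by (simp add: diagonal_matrix_mult)
    then have "V $ i $ j = 0 \<or> v $ j = v' $ i" by auto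
    then show ?thesis by auto
  qed
  then have *: "V ** diagonal_matrix (\<chi> i. max (v $ i) 0) = diagonal_matrix (\<chi> i. max (v' $ i) 0) ** V"
    by (simp add: vec_eq_iff diagonal_matrix_mult)
  have "R = U' ** (diagonal_matrix (\<chi> i. max (v' $ i) 0) ** V) ** transpose U"
    by (simp add: R V_def UU(2) flip: matrix_mul_assoc)
  also have "\<dots> = U ** diagonal_matrix (\<chi> i. max (v $ i) 0) ** transpose U"
    unfolding *[symmetric] by (simp add: V_def UZ flip: matrix_mul_assoc)
  finally show "R = U ** diagonal_matrix (\<chi> i. max (v $ i) 0) ** transpose U" .
qed

lemma trace_square:
  fixes Q :: "real ^ 'd ^ 'd"
  assumes "transpose Q = Q"
  shows "trace (Q ** Q) = (\<Sum>i\<in>UNIV. (norm (Q $ i))\<^sup>2)"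
proof -
  have "Q $ i $ j = Q $ j $ i" for i j using assms by (metis transpose_def vec_lambda_beta)
  then show ?thesis
    unfolding trace_def matrix_matrix_mult_def power2_norm_eq_inner inner_vec_def by simp
qed

text \<open>For symmetric \<open>Q\<close> the trace of the square is the squared Frobenius norm,
  which dominates the squared operator norm.\<close>

lemma inner_mult_le_trace:
  fixes Q :: "real ^ 'd ^ 'd"
  assumes "transpose Q = Q"
  shows "\<bar>x \<bullet> (Q *v y)\<bar> \<le> sqrt (trace (Q ** Q)) * norm x * norm y"
proof -
  have "(norm (Q *v y))\<^sup>2 = (\<Sum>i\<in>UNIV. (Q $ i \<bullet> y)\<^sup>2)"
    unfolding power2_norm_eq_inner inner_vec_def[of "Q *v y"]
    by (simp add: matrix_mult_dot power2_eq_square)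
  also have "\<dots> \<le> (\<Sum>i\<in>UNIV. (norm (Q $ i))\<^sup>2 * (norm y)\<^sup>2)"
  proof (rule sum_mono)
    fix i
    show "(Q $ i \<bullet> y)\<^sup>2 \<le> (norm (Q $ i))\<^sup>2 * (norm y)\<^sup>2"
      using Cauchy_Schwarz_ineq2[of "Q $ i" y]
      by (metis abs_ge_zero power2_abs power_mono power_mult_distrib)
  qed
  also have "\<dots> = trace (Q ** Q) * (norm y)\<^sup>2" by (simp add: trace_square[OF assms] sum_distrib_right)
  also have "\<dots> = (sqrt (trace (Q ** Q)) * norm y)\<^sup>2"
    by (simp add: power_mult_distrib trace_square[OF assms] sum_nonneg)
  finally have "norm (Q *v y) \<le> sqrt (trace (Q ** Q)) * norm y"
    by (rule power2_le_imp_le) (simp add: trace_square[OF assms] sum_nonneg)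
  then have "norm x * norm (Q *v y) \<le> norm x * (sqrt (trace (Q ** Q)) * norm y)" by (rule mult_left_mono) simp
  then show ?thesis using Cauchy_Schwarz_ineq2[of x "Q *v y"] by (simp add: mult_ac)
qed

text \<open>By symmetry the difference of the two values is
  \<open>(x - y) \<bullet> (Q *v (x + y))\<close>, and \<open>x + y\<close> has norm at most
  2.\<close>

lemma quadratic_form_lipschitz:
  fixes Q :: "real ^ 'd ^ 'd"
  assumes "transpose Q = Q" "norm x = 1" "norm y = 1"
  shows "\<bar>x \<bullet> (Q *v x) - y \<bullet> (Q *v y)\<bar> \<le> 2 * norm (x - y) * sqrt (trace (Q ** Q))"
proof -
  have "x \<bullet> (Q *v x) - y \<bullet> (Q *v y) = (x - y) \<bullet> (Q *v (x + y))"
    using symmetric_inner[OF assms(1), of x y]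
    by (simp add: matrix_vector_right_distrib inner_diff_left inner_add_right)
  then have "\<bar>x \<bullet> (Q *v x) - y \<bullet> (Q *v y)\<bar> \<le> sqrt (trace (Q ** Q)) * norm (x - y) * norm (x + y)"
    using inner_mult_le_trace[OF assms(1)] by simp
  also have "\<dots> \<le> sqrt (trace (Q ** Q)) * norm (x - y) * 2"
    using norm_triangle_ineq[of x y] assms
    by (intro mult_left_mono) (auto simp: trace_square sum_nonneg)
  finally show ?thesis by (simp add: mult_ac)
qed

text \<open>Every eigenvalue is at least \<open>- \<eta>\<close>, and
  \<open>max c 0 \<le> c + \<eta>\<close> for such \<open>c\<close>; in an orthonormal eigenbasis
  the squared coordinates of \<open>x\<close> add up to 1.\<close>

lemma positive_part_bounds:
  fixes Q :: "real ^ 'd ^ 'd"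
  assumes sym: "transpose Q = Q" and \<eta>: "\<eta> \<ge> 0" and low: "\<And>x. norm x = 1 \<Longrightarrow> x \<bullet> (Q *v x) \<ge> - \<eta>"
    and x: "norm x = 1"
  shows "x \<bullet> (Q *v x) \<le> x \<bullet> (positive_part Q *v x)" "x \<bullet> (positive_part Q *v x) \<le> x \<bullet> (Q *v x) + \<eta>"
proof -
  obtain U v where U: "orthogonal_matrix U" and Q: "Q = U ** diagonal_matrix v ** transpose U"
    using spectral_decomposition[OF sym] by metis
  have UU: "transpose U ** U = mat 1" "U ** transpose U = mat 1" using U by (auto simp: orthogonal_matrix_def)
  have form: "x \<bullet> ((U ** diagonal_matrix d ** transpose U) *v x) = (\<Sum>i\<in>UNIV. d $ i * ((transpose U *v x) $ i)\<^sup>2)" for d x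
  proof -
    define y where "y = transpose U *v x"
    have "x \<bullet> ((U ** diagonal_matrix d ** transpose U) *v x) = x \<bullet> (U *v (diagonal_matrix d *v y))"
      by (simp only: y_def matrix_vector_mul_assoc matrix_mul_assoc)
    also have "\<dots> = y \<bullet> (diagonal_matrix d *v y)"
      unfolding y_def by (simp add: dot_lmul_matrix)
    also have "\<dots> = (\<Sum>i\<in>UNIV. d $ i * (y $ i)\<^sup>2)"
      by (simp add: inner_vec_def power2_eq_square mult_ac diagonal_matrix_mult)
    finally show ?thesis by (simp add: y_def)
  qed
  \<comment> \<open>The lower bound is tested at the \<open>i\<close>-th column of \<open>U\<close>,
    a unit eigenvector.\<close>
  have v: "v $ i \<ge> - \<eta>" for i
  proof -
    define z where "z = U *v axis i 1"
    have z: "transpose U *v z = axis i 1" by (simp add: z_def matrix_vector_mul_assoc UU)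
    have "z \<bullet> z = (z v* U) \<bullet> axis i 1" by (simp add: dot_lmul_matrix z_def)
    also have "\<dots> = 1" using z by (simp add: inner_axis')
    finally have "norm z = 1" by (simp add: norm_eq_1)
    from low[OF this] have "- \<eta> \<le> (\<Sum>j\<in>UNIV. v $ j * (axis i 1 $ j)\<^sup>2)" unfolding Q form z .
    also have "\<dots> = (\<Sum>j\<in>UNIV. if j = i then v $ i else 0)"
      by (intro sum.cong) (auto simp: axis_def)
    finally show ?thesis by simp
  qed
  define y where "y = transpose U *v x"
  have y: "(\<Sum>i\<in>UNIV. (y $ i)\<^sup>2) = 1"
  proof -
    have "y \<bullet> y = x \<bullet> (U *v (transpose U *v x))"
      unfolding y_def by (simp add: dot_lmul_matrix)
    also have "\<dots> = 1" unfolding matrix_vector_mul_assoc UU using x by (simp add: norm_eq_1)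
    finally show ?thesis by (simp add: inner_vec_def power2_eq_square)
  qed
  have P: "x \<bullet> (positive_part Q *v x) = (\<Sum>i\<in>UNIV. max (v $ i) 0 * (y $ i)\<^sup>2)"
    unfolding positive_part_eq[OF U Q] form y_def by simp
  have Qx: "x \<bullet> (Q *v x) = (\<Sum>i\<in>UNIV. v $ i * (y $ i)\<^sup>2)"
    unfolding y_def by (subst Q, subst form) simp
  show "x \<bullet> (Q *v x) \<le> x \<bullet> (positive_part Q *v x)"
    unfolding P Qx by (intro sum_mono mult_right_mono) auto
  have "(\<Sum>i\<in>UNIV. max (v $ i) 0 * (y $ i)\<^sup>2) \<le> (\<Sum>i\<in>UNIV. (v $ i + \<eta>) * (y $ i)\<^sup>2)"
  proof (intro sum_mono mult_right_mono)
    fix i show "max (v $ i) 0 \<le> v $ i + \<eta>" using v[of i] \<eta> by simp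
  qed simp
  also have "\<dots> = (\<Sum>i\<in>UNIV. v $ i * (y $ i)\<^sup>2) + \<eta> * (\<Sum>i\<in>UNIV. (y $ i)\<^sup>2)"
    by (simp add: distrib_right sum.distrib sum_distrib_left)
  finally show "x \<bullet> (positive_part Q *v x) \<le> x \<bullet> (Q *v x) + \<eta>"
    unfolding P Qx y by simp
qed

subsection \<open>The grid of parameters\<close>

lemma exp_le_power:
  fixes x a b :: real
  assumes "exp (x / real k) \<le> a" "a ^ k \<le> b" "k > 0"
  shows "exp x \<le> b"
proof -
  have "exp x = exp (x / real k) ^ k" using assms(3) by (simp flip: exp_of_nat_mult)
  also have "\<dots> \<le> a ^ k" using assms(1) by (intro power_mono) auto
  finally show ?thesis using assms(2) by simp
qed

lemma exp_ge_power:
  fixes x a b :: real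
  assumes "a \<le> exp (x / real k)" "0 \<le> a" "b \<le> a ^ k" "k > 0"
  shows "b \<le> exp x"
proof -
  have "a ^ k \<le> exp (x / real k) ^ k" using assms(1,2) by (intro power_mono) auto
  also have "\<dots> = exp x" using assms(4) by (simp flip: exp_of_nat_mult)
  finally show ?thesis using assms(3) by simp
qed

lemma exp_le_inverse:
  fixes x a :: real
  assumes "x < 1" "1 \<le> a * (1 - x)"
  shows "exp x \<le> a"
proof -
  have "1 - x \<le> exp (- x)" using exp_ge_add_one_self[of "- x"] by simp
  then have "exp x * (1 - x) \<le> 1" by (simp add: exp_minus field_simps)
  then have "exp x * (1 - x) \<le> a * (1 - x)" using assms(2) by linarith
  then show ?thesis using assms(1) by simp
qed

text \<open>A first-order bound is sharp at the argument divided by 512; three eighth powers return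
  to the full argument, with rational rounding upwards each time. The argument is just above
  \<open>(1 + 2 * sqrt 2) / 2\<close>.\<close>

lemma exp_19143_le: "exp (19143 / 10000) \<le> (682 / 100 :: real)"
proof -
  have "exp (19143 / 5120000) \<le> (10037529 / 10000000 :: real)" by (rule exp_le_inverse) simp_all
  then have "exp (19143 / 640000) \<le> (51521027 / 50000000 :: real)"
    by - (rule exp_le_power[where a = "10037529 / 10000000" and k = 8], simp_all add: power_divide)
  then have "exp (19143 / 80000) \<le> (127091369 / 100000000 :: real)"
    by - (rule exp_le_power[where a = "51521027 / 50000000" and k = 8], simp_all add: power_divide)
  then have "exp (19143 / 10000) \<le> (682 / 100 :: real)"
    by - (rule exp_le_power[where a = "127091369 / 100000000" and k = 8], simp_all add: power_divide)
  then show ?thesis .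
qed

lemma exp_19142_ge: "(67 / 10 :: real) \<le> exp (9571 / 5000)"
proof -
  have "(50373867 / 50000000 :: real) \<le> exp (9571 / 1280000)" using exp_ge_add_one_self[of "9571 / 1280000 :: real"] by simp
  then have "(103024649 / 100000000 :: real) \<le> exp (9571 / 320000)"
    by - (rule exp_ge_power[where a = "50373867 / 50000000" and k = 4], simp_all add: power_divide)
  then have "(31729933 / 25000000 :: real) \<le> exp (9571 / 40000)"
    by - (rule exp_ge_power[where a = "103024649 / 100000000" and k = 8], simp_all add: power_divide)
  then have "(67 / 10 :: real) \<le> exp (9571 / 5000)"
    by - (rule exp_ge_power[where a = "31729933 / 25000000" and k = 8], simp_all add: power_divide)
  then show ?thesis .
qed

lemma exp_692_le: "exp (173 / 250) \<le> (2 :: real)"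
proof -
  have "exp (173 / 64000) \<le> (50135523 / 50000000 :: real)" by (rule exp_le_inverse) simp_all
  then have "exp (173 / 16000) \<le> (505443 / 500000 :: real)"
    by - (rule exp_le_power[where a = "50135523 / 50000000" and k = 4], simp_all add: power_divide)
  then have "exp (173 / 2000) \<le> (54523969 / 50000000 :: real)"
    by - (rule exp_le_power[where a = "505443 / 500000" and k = 8], simp_all add: power_divide)
  then have "exp (173 / 250) \<le> (2 :: real)"
    by - (rule exp_le_power[where a = "54523969 / 50000000" and k = 8], simp_all add: power_divide)
  then show ?thesis .
qed

lemma exp_7_ge: "(2 :: real) \<le> exp (7 / 10)"
proof -
  have "(647 / 640 :: real) \<le> exp (7 / 640)" using exp_ge_add_one_self[of "7 / 640 :: real"] by simp
  then have "(109092389 / 100000000 :: real) \<le> exp (7 / 80)"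
    by - (rule exp_ge_power[where a = "647 / 640" and k = 8], simp_all add: power_divide)
  then have "(2 :: real) \<le> exp (7 / 10)"
    by - (rule exp_ge_power[where a = "109092389 / 100000000" and k = 8], simp_all add: power_divide)
  then show ?thesis .
qed

lemma exp_eighth_le: "exp (1 / 8) \<le> (11333 / 10000 :: real)"
proof -
  have "exp (1 / 512) \<le> (20039139 / 20000000 :: real)" by (rule exp_le_inverse) simp_all
  then have "exp (1 / 64) \<le> (50788163 / 50000000 :: real)"
    by - (rule exp_le_power[where a = "20039139 / 20000000" and k = 8], simp_all add: power_divide)
  then have "exp (1 / 8) \<le> (11333 / 10000 :: real)"
    by - (rule exp_le_power[where a = "50788163 / 50000000" and k = 8], simp_all add: power_divide)
  then show ?thesis .
qed

text \<open>The lower bound lets the grid constants absorb 34 and 65 (the second is the tight one: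
  \<open>2 * 65 \<le> 2 + 3 * 43\<close>). The upper bound enters the comparison with the constants
  0.73 and 98.5 of \<open>zeta_star\<close>.\<close>

lemma c_const_bounds: "43 \<le> c_const" "c_const \<le> 447 / 10"
proof -
  have s2: "1.4142 \<le> sqrt 2" "sqrt 2 \<le> 1.41422" "1.41421 \<le> sqrt 2"
    by (rule real_le_rsqrt real_le_lsqrt; simp add: power2_eq_square)+
  have "ln 2 \<le> ln (exp (7 / 10 :: real))" using exp_7_ge by (subst ln_le_cancel_iff) auto
  moreover have "173 / 250 \<le> ln (2::real)" using exp_692_le by (subst ln_ge_iff) auto
  ultimately have l: "0.692 \<le> ln (2::real)" "ln (2::real) \<le> 0.7" by simp_all
  define e where "e = exp ((1 + 2 * sqrt 2) / 2)"
  have e: "6.7 \<le> e" "e \<le> 6.82"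
  proof -
    have "exp (9571 / 5000) \<le> e" "e \<le> exp (19143 / 10000)"
      using s2 by (auto simp: e_def)
    then have "67 / 10 \<le> e" "e \<le> 682 / 100" using exp_19142_ge exp_19143_le by linarith+
    then show "6.7 \<le> e" "e \<le> 6.82" by simp_all
  qed
  define d where "d = 8 * ln 2 * (sqrt 2 - 1)"
  have "8 * 0.692 * 0.41421 \<le> d" unfolding d_def using s2 l by (intro mult_mono) auto
  moreover have "d \<le> 8 * 0.7 * 0.41422" unfolding d_def using s2 l by (intro mult_mono) auto
  ultimately have d: "2.293 \<le> d" "d \<le> 2.32" by simp_all
  have c: "c_const = 15 * e / d" by (simp add: c_const_def e_def d_def)
  show "43 \<le> c_const" "c_const \<le> 447 / 10" unfolding c using e d by (simp_all add: field_simps)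
qed

text \<open>Triangle inequality in the plane: from \<open>(sqrt x, sqrt y)\<close> to
  \<open>(p * sqrt x, sqrt y)\<close> the distance is \<open>(p - 1) * sqrt x\<close>.\<close>

lemma sqrt_shift_le:
  fixes p x y :: real
  assumes "x \<ge> 0" "y \<ge> 0" "p \<ge> 1"
  shows "sqrt (x * p\<^sup>2 + y) \<le> sqrt (x + y) + (p - 1) * sqrt x"
proof (rule real_le_lsqrt)
  have "0 \<le> sqrt x * (sqrt (x + y) - sqrt x)" using assms by simp
  then have "x \<le> sqrt x * sqrt (x + y)" using assms by (simp add: right_diff_distrib)
  then have "(p - 1) * x \<le> (p - 1) * (sqrt x * sqrt (x + y))" using assms by (intro mult_left_mono) auto
  moreover have "(sqrt (x + y) + (p - 1) * sqrt x)\<^sup>2 = x + y + (p - 1)\<^sup>2 * x + 2 * ((p - 1) * (sqrt x * sqrt (x + y)))"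
    using assms by (simp add: power2_sum power_mult_distrib)
  moreover have "x * p\<^sup>2 + y = x + y + (p - 1)\<^sup>2 * x + 2 * ((p - 1) * x)"
    by (simp add: power2_eq_square algebra_simps)
  ultimately show "x * p\<^sup>2 + y \<le> (sqrt (x + y) + (p - 1) * sqrt x)\<^sup>2" by linarith
qed (use assms in simp)

text \<open>The function \<open>p + inverse p\<close> takes the same value at \<open>m\<close> and
  \<open>inverse m\<close> and is no larger in between, as
  \<open>(m - p) * (m * p - 1) \<ge> 0\<close>.\<close>

lemma sum_inverse_le:
  fixes p m :: real
  assumes "0 < m" "inverse m \<le> p" "p \<le> m"
  shows "p + inverse p \<le> m + inverse m"
proof -
  have p: "p > 0" using assms by (meson less_le_trans positive_imp_inverse_positive)
  have "1 \<le> m * p" using assms by (simp add: field_simps)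
  then have "0 \<le> (m - p) * (m * p - 1)" using assms by simp
  then have "p * p * m + m \<le> m * m * p + p" by (simp add: algebra_simps)
  then show ?thesis using p assms(1) by (simp add: field_simps)
qed

text \<open>The slack between the constants of the grid and those of \<^const>\<open>zeta_star\<close> pays for the
  discretization: \<open>p\<^sup>2\<close> is the ratio between the closest grid point and the optimal value
  of the parameter.\<close>

lemma zeta_slack:
  fixes \<kappa> T L p c :: real
  assumes \<kappa>: "\<kappa> \<ge> 3 / 2" and T: "T \<ge> 0" and L: "L \<ge> 0" and c: "c \<le> 447 / 10" "c \<ge> 0"
    and p: "inverse (11333 / 10000) \<le> p" "p \<le> 11333 / 10000"
  shows "sqrt (2.032 * (\<kappa> - 1) * (0.73 * T * p\<^sup>2 + L)) + sqrt ((2 + c) * \<kappa> * T / 2) * (p + inverse p)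
    \<le> sqrt (2.032 * (\<kappa> - 1) * (0.73 * T + L)) + sqrt (98.5 * \<kappa> * T)"
proof -
  define w where "w = sqrt (\<kappa> * T)"
  have w: "w \<ge> 0" using \<kappa> T by (simp add: w_def)
  define x where "x = 2.032 * 0.73 * (\<kappa> - 1) * T"
  define y where "y = 2.032 * (\<kappa> - 1) * L"
  have xy: "x \<ge> 0" "y \<ge> 0" using \<kappa> T L by (auto simp: x_def y_def)
  have p0: "0 < p" using p by (auto intro: less_le_trans)
  \<comment> \<open>1.218 lies just above the square root of \<open>2.032 * 0.73\<close>.\<close>
  have "sqrt x \<le> 1.218 * w"
  proof -
    have "x \<le> (1.218)\<^sup>2 * (\<kappa> * T)" 
    proof -
      have "0 \<le> (\<kappa> - 1) * T" "(\<kappa> - 1) * T \<le> \<kappa> * T" using \<kappa> T by (auto intro: mult_right_mono)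
      moreover have "x = 2.032 * 0.73 * ((\<kappa> - 1) * T)" by (simp add: x_def)
      ultimately show ?thesis by (simp add: power2_eq_square)
    qed
    then have "sqrt x \<le> sqrt ((1.218)\<^sup>2 * (\<kappa> * T))" by (rule real_sqrt_le_mono)
    also have "\<dots> = 1.218 * w" by (simp add: real_sqrt_mult w_def)
    finally show ?thesis .
  qed
  have A: "sqrt (x * p\<^sup>2 + y) \<le> sqrt (x + y) + 0.1333 * 1.218 * w"
  proof (cases "p \<ge> 1")
    case True
    have "sqrt (x * p\<^sup>2 + y) \<le> sqrt (x + y) + (p - 1) * sqrt x"
      using xy True by (rule sqrt_shift_le)
    also have "(p - 1) * sqrt x \<le> 0.1333 * (1.218 * w)"
      using p True xy \<open>sqrt x \<le> 1.218 * w\<close> by (intro mult_mono) auto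
    finally show ?thesis by simp
  next
    case False
    then have "p\<^sup>2 \<le> 1" using p0 by (simp add: power_le_one)
    then have "x * p\<^sup>2 \<le> x * 1" using xy by (intro mult_left_mono) auto
    then have "sqrt (x * p\<^sup>2 + y) \<le> sqrt (x + y)" by simp
    moreover have "0 \<le> 0.1333 * 1.218 * w" using w by simp
    ultimately show ?thesis by linarith
  qed
  \<comment> \<open>4.8322 lies just above the square root of \<open>46.7 / 2\<close>, the largest
    value of \<open>(2 + c) / 2\<close>; 2.0158 bounds \<open>m + inverse m\<close> at
    \<open>m = 1.1333\<close>.\<close>
  have B: "sqrt ((2 + c) * \<kappa> * T / 2) * (p + inverse p) \<le> (4.8322 * w) * 2.0158"
  proof (rule mult_mono)
    have "sqrt ((2 + c) * \<kappa> * T / 2) \<le> sqrt ((4.8322)\<^sup>2 * (\<kappa> * T))"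
    proof (rule real_sqrt_le_mono)
      have "(2 + c) / 2 * (\<kappa> * T) \<le> (4.8322)\<^sup>2 * (\<kappa> * T)"
        using c \<kappa> T by (intro mult_right_mono) (auto simp: power2_eq_square)
      then show "(2 + c) * \<kappa> * T / 2 \<le> (4.8322)\<^sup>2 * (\<kappa> * T)" by simp
    qed
    also have "\<dots> = 4.8322 * w" by (simp add: real_sqrt_mult w_def)
    finally show "sqrt ((2 + c) * \<kappa> * T / 2) \<le> 4.8322 * w" .
    show "p + inverse p \<le> 2.0158"
      using sum_inverse_le[OF _ p] by simp
  qed (use w p0 in auto)
  have C: "9.924 * w \<le> sqrt (98.5 * \<kappa> * T)"
  proof (rule real_le_rsqrt)
    show "(9.924 * w)\<^sup>2 \<le> 98.5 * \<kappa> * T"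
    proof -
      have "(9.924 * w)\<^sup>2 = (9.924)\<^sup>2 * (\<kappa> * T)" using \<kappa> T by (simp only: power_mult_distrib w_def) simp
      also have "\<dots> \<le> 98.5 * (\<kappa> * T)" using \<kappa> T by (intro mult_right_mono) (auto simp: power2_eq_square)
      finally show ?thesis by simp
    qed
  qed
  have "2.032 * (\<kappa> - 1) * (0.73 * T * p\<^sup>2 + L) = x * p\<^sup>2 + y" "2.032 * (\<kappa> - 1) * (0.73 * T + L) = x + y"
    by (simp_all only: x_def y_def distrib_left distrib_right mult_ac)
  \<comment> \<open>The loss 0.1333 on the first root and the inflated second root together fit
    below 9.924, itself just below the square root of 98.5.\<close>
  moreover have "0.1333 * 1.218 * w + (4.8322 * w) * 2.0158 \<le> 9.924 * w" using w by simp
  ultimately show ?thesis using A B C by (simp only:)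
qed

section \<open>The grid point adapted to a given scale\<close>

context quartic_law
begin

lemma finite_Lambda_grid: "finite (Lambda_grid P n \<epsilon>)"
  and card_Lambda_grid: "card (Lambda_grid P n \<epsilon>) \<le> nat (grid_size P n)"
proof -
  have eq: "Lambda_grid P n \<epsilon> = (\<lambda>j. (lambda_grid P n \<epsilon> j, beta_grid P n j)) ` {..<nat (grid_size P n)}"
    by (auto simp: Lambda_grid_def)
  show "finite (Lambda_grid P n \<epsilon>)" unfolding eq by simp
  show "card (Lambda_grid P n \<epsilon>) \<le> nat (grid_size P n)"
    unfolding eq using card_image_le[of "{..<nat (grid_size P n)}"] by simp
qed

lemma card_Lambda_grid_pos:
  assumes "grid_size P n \<ge> 1"
  shows "1 \<le> card (Lambda_grid P n \<epsilon>)"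
proof -
  have "(lambda_grid P n \<epsilon> 0, beta_grid P n 0) \<in> Lambda_grid P n \<epsilon>"
    using assms by (force simp: Lambda_grid_def)
  then show ?thesis using finite_Lambda_grid by (auto simp: Suc_le_eq card_gt_0_iff)
qed

lemma grid_positive:
  assumes "n \<ge> 1" "grid_size P n \<ge> 1" "0 < \<epsilon>" "\<epsilon> < 1" "s4 P > 0" "(l, b) \<in> Lambda_grid P n \<epsilon>"
  shows "l > 0" "b > 0"
proof -
  obtain j where j: "l = lambda_grid P n \<epsilon> j" "b = beta_grid P n j" using assms(6) by (auto simp: Lambda_grid_def)
  have "1 \<le> real_of_int (grid_size P n)" using assms(2) by simp
  then have "1 \<le> real_of_int (grid_size P n) / \<epsilon>" using assms by (simp add: field_simps)
  then have "0 \<le> ln (real_of_int (grid_size P n) / \<epsilon>)" by simp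
  moreover have "0 < (2 + 3 * c_const) / (4 * (2 + c_const) * sqrt (kappa P) * exp (- (real j * a_const)))"
    using c_const_bounds kappa_pos by (intro divide_pos_pos mult_pos_pos) auto
  moreover have "c_const > 0" using c_const_bounds by linarith
  ultimately show "l > 0" unfolding j lambda_grid_def using assms kappa_pos by (auto intro!: mult_pos_pos divide_pos_pos add_pos_nonneg)
  have "c_const > 0" using c_const_bounds by linarith
  then show "b > 0" unfolding j beta_grid_def using assms kappa_pos by simp
qed

text \<open>In the units \<open>w\<close>, \<open>A'\<close>, \<open>L\<close> the choice of
  \<open>l\<close> is an exact balance: the term of \<open>gamma_coef\<close> proportional to
  \<open>l\<close> equals \<open>(A' * exp (1 / 4) + L) / (real n * l)\<close>. The factor
  \<open>exp (1 / 4)\<close> is the half-step by which the exponents of \<open>beta_grid\<close> and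
  \<open>lambda_grid\<close> differ, \<open>a_const\<close> being 1/2.\<close>

lemma grid_coef:
  assumes n: "n \<ge> 1" and K: "grid_size P n \<ge> 1" and \<epsilon>: "0 < \<epsilon>" "\<epsilon> < 1" and s4: "s4 P > 0"
    and lb: "(lambda_grid P n \<epsilon> j, beta_grid P n j) \<in> Lambda_grid P n \<epsilon>"
  fixes w E A' L Lc l b
  defines "w \<equiv> (2 + c_const) * sqrt (kappa P)" and "E \<equiv> exp ((real j - 1 / 2) / 2)"
    and "A' \<equiv> (2 + 3 * c_const) / (4 * w) * E" and "L \<equiv> ln (real_of_int (grid_size P n) / \<epsilon>)"
    and "Lc \<equiv> ln (real (card (Lambda_grid P n \<epsilon>)) / \<epsilon>)"
    and "l \<equiv> lambda_grid P n \<epsilon> j" and "b \<equiv> beta_grid P n j"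
  shows "0 < w" "0 < A'" "0 \<le> Lc" "Lc \<le> L"
    and "l\<^sup>2 = 2 / (real n * (kappa P - 1)) * (A' * exp (1 / 4) + L)"
    and "l / 2 * (kappa P - 1) = (A' * exp (1 / 4) + L) / (real n * l)"
    and "b = (s4 P)\<^sup>2 * sqrt (2 * w * real n) / sqrt E"
    and "gamma_coef P n \<epsilon> l b = l / 2 * (kappa P - 1) + w * (s4 P)\<^sup>2 / b + A' / (real n * l) + Lc / (real n * l)"
proof -
  have pos: "l > 0" "b > 0" using grid_positive[OF n K \<epsilon> s4 lb] by (auto simp: l_def b_def)
  have n0: "real n > 0" using n by simp
  have c: "43 \<le> c_const" using c_const_bounds by auto
  show w: "0 < w" using c kappa_pos by (simp add: w_def)
  have E: "E > 0" by (simp add: E_def)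
  show A': "0 < A'" using c w E by (simp add: A'_def)
  have c1: "1 \<le> card (Lambda_grid P n \<epsilon>)" using card_Lambda_grid_pos[OF K] .
  have "1 \<le> real (card (Lambda_grid P n \<epsilon>)) / \<epsilon>" using c1 \<epsilon> by (simp add: field_simps)
  then show Lc0: "0 \<le> Lc" by (simp add: Lc_def)
  have "real (card (Lambda_grid P n \<epsilon>)) \<le> real_of_int (grid_size P n)"
    using card_Lambda_grid[of n \<epsilon>] K by linarith
  then have "real (card (Lambda_grid P n \<epsilon>)) / \<epsilon> \<le> real_of_int (grid_size P n) / \<epsilon>"
    using \<epsilon> by (intro divide_right_mono) auto
  then show Lc: "Lc \<le> L" unfolding Lc_def L_def using c1 \<epsilon> K by (subst ln_le_cancel_iff) auto
  show l2: "l\<^sup>2 = 2 / (real n * (kappa P - 1)) * (A' * exp (1 / 4) + L)"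
  proof -
    have "real j * a_const = (real j - 1 / 2) / 2 + 1 / 4" by (simp add: a_const_def field_simps)
    then have "A' * exp (1 / 4) = (2 + 3 * c_const) / (4 * w) * exp (real j * a_const)"
      by (simp only: A'_def E_def exp_add mult.assoc)
    moreover have "x / (4 * y * y' * exp (- z)) = x / (4 * (y * y')) * exp z" for x y y' z :: real
      by (simp add: exp_minus field_simps)
    ultimately have "l = sqrt (2 / (real n * (kappa P - 1)) * (A' * exp (1 / 4) + L))"
      by (simp only: l_def lambda_grid_def L_def w_def)
    then show ?thesis using A' Lc0 Lc n0 kappa_pos by simp
  qed
  have "real n * l * (l * (kappa P - 1) / 2) = l\<^sup>2 * (real n * (kappa P - 1)) / 2" by (simp add: power2_eq_square)
  then have "real n * l * (l * (kappa P - 1) / 2) = A' * exp (1 / 4) + L"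
    unfolding l2 using n0 kappa_pos by simp
  then show "l / 2 * (kappa P - 1) = (A' * exp (1 / 4) + L) / (real n * l)" using n0 pos by (simp add: field_simps)
  have b: "b = sqrt (2 * w * ((s4 P)\<^sup>2)\<^sup>2 * real n / E)"
    by (simp add: b_def beta_grid_def w_def E_def a_const_def exp_minus field_simps flip: power_mult)
  have "sqrt (((s4 P)\<^sup>2)\<^sup>2) = (s4 P)\<^sup>2" by (simp only: real_sqrt_abs abs_power2)
  then show "b = (s4 P)\<^sup>2 * sqrt (2 * w * real n) / sqrt E"
    unfolding b by (simp only: real_sqrt_mult real_sqrt_divide mult_ac)
  have b2: "b\<^sup>2 = 2 * w * ((s4 P)\<^sup>2)\<^sup>2 * real n / E" unfolding b using w n0 E by simp
  have "(2 + 3 * c_const) * s4 P ^ 4 / (2 * b\<^sup>2 * l) = A' / (real n * l)"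
  proof -
    have "s4 P ^ 4 = ((s4 P)\<^sup>2)\<^sup>2" by (simp flip: power_mult)
    then show ?thesis unfolding b2 A'_def using w s4 n0 E pos by (simp add: field_simps)
  qed
  then show "gamma_coef P n \<epsilon> l b = l / 2 * (kappa P - 1) + w * (s4 P)\<^sup>2 / b + A' / (real n * l) + Lc / (real n * l)"
    unfolding gamma_coef_def Lc_def by (simp add: w_def)
qed

text \<open>The left-hand side is \<open>gamma + \<tau>\<close> at moment \<open>s\<close>, the
  quantity that governs the relative error there. It splits into terms in \<open>l\<close>
  (\<open>part1\<close>) and terms in \<open>b\<close> (\<open>part2\<close>), each a sum of an
  increasing and a decreasing function of the parameter that the grid nearly balances.\<close>

lemma exists_grid_point:
  assumes n: "n \<ge> 1" and K: "grid_size P n \<ge> 1" and \<epsilon>: "0 < \<epsilon>" "\<epsilon> < 1"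
    and s: "0 < s" "s \<le> (s4 P)\<^sup>2" and z: "8 * zeta_star P n \<epsilon> s \<le> sqrt (real n)"
  shows "\<exists>(l, b)\<in>Lambda_grid P n \<epsilon>. gamma_coef P n \<epsilon> l b + b / (2 * real n * s) \<le> zeta_star P n \<epsilon> s / sqrt (real n)"
proof -
  define \<kappa> where "\<kappa> = kappa P"
  have \<kappa>: "\<kappa> \<ge> 3 / 2" "sqrt \<kappa> > 0" using kappa_ge by (auto simp: \<kappa>_def)
  define S where "S = (s4 P)\<^sup>2"
  define T where "T = trace (gram_matrix P) / s"
  define R where "R = S / s"
  define c where "c = c_const"
  have c: "43 \<le> c" "c \<le> 447 / 10" using c_const_bounds by (auto simp: c_def)
  have S: "S > 0" using s unfolding S_def by linarith
  have R1: "R \<ge> 1" using s by (simp add: R_def S_def)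
  have RT: "R \<le> sqrt \<kappa> * T" using s4_le_trace s by (simp add: R_def T_def S_def \<kappa>_def divide_right_mono)
  have T0: "T > 0" using zero_less_mult_pos[of "sqrt \<kappa>" T] R1 RT \<kappa> by linarith
  have n0: "real n > 0" using n by simp
  define L where "L = ln (real_of_int (grid_size P n) / \<epsilon>)"
  have K1: "1 \<le> real_of_int (grid_size P n)" using K by simp
  have L: "L = ln (real_of_int (grid_size P n)) + ln (inverse \<epsilon>)"
    using K1 \<epsilon> by (simp add: L_def ln_div ln_inverse)
  have "1 \<le> real_of_int (grid_size P n) / \<epsilon>" using K1 \<epsilon> by (simp add: field_simps)
  then have L0: "L \<ge> 0" by (simp add: L_def)
  have zeta: "zeta_star P n \<epsilon> s = sqrt (2.032 * (\<kappa> - 1) * (0.73 * T + L)) + sqrt (98.5 * \<kappa> * T)"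
    by (simp add: zeta_star_def \<kappa>_def T_def L add.assoc)
  txt \<open>Up to discretization, \<open>exp ((j - 1 / 2) / 2) = R\<close> balances the two terms of \<open>part2\<close> below.\<close>
  define j where "j = nat \<lceil>2 * ln R\<rceil>"
  have lnR: "ln R \<ge> 0" using R1 by simp
  have j: "2 * ln R \<le> real j" "real j < 2 * ln R + 1" unfolding j_def using lnR by linarith+
  have jK: "int j < grid_size P n"
  proof -
    have "sqrt (98.5 * \<kappa> * T) \<le> zeta_star P n \<epsilon> s" unfolding zeta using \<kappa> T0 L0 by simp
    then have "8 * sqrt (98.5 * \<kappa> * T) \<le> sqrt (real n)" using z by linarith
    then have "(8 * sqrt (98.5 * \<kappa> * T))\<^sup>2 \<le> (sqrt (real n))\<^sup>2" using \<kappa> T0 by (intro power_mono) auto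
    \<comment> \<open>\<open>6304 = 64 * 98.5\<close>. It exceeds \<open>72 * (2 + c)\<close>, so
      the index suited to \<open>s\<close> does not overshoot \<open>grid_size\<close>.\<close>
    then have nT: "6304 * (\<kappa> * T) \<le> real n" using \<kappa> T0 by (simp add: power_mult_distrib mult_ac)
    have "R * (72 * (2 + c) * sqrt \<kappa>) \<le> (sqrt \<kappa> * T) * (6304 * sqrt \<kappa>)"
      using RT c \<kappa> R1 by (intro mult_mono) auto
    also have "\<dots> = 6304 * (\<kappa> * T)" using \<kappa> by simp
    finally have "R * (72 * (2 + c) * sqrt \<kappa>) \<le> real n" using nT by linarith
    moreover have "0 < 72 * (2 + c) * sqrt \<kappa>" using c \<kappa> by simp
    ultimately have "R \<le> real n / (72 * (2 + c) * sqrt \<kappa>)" by (simp only: pos_le_divide_eq)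
    then have "ln R \<le> ln (real n / (72 * (2 + c) * sqrt \<kappa>))"
      using R1 n0 c \<kappa> by (subst ln_le_cancel_iff) auto
    then have "\<lceil>2 * ln R\<rceil> \<le> \<lceil>inverse a_const * ln (real n / (72 * (2 + c) * sqrt \<kappa>))\<rceil>"
      by (intro ceiling_mono) (simp add: a_const_def)
    moreover have "0 \<le> \<lceil>2 * ln R\<rceil>" using lnR by simp
    ultimately show ?thesis by (simp add: j_def grid_size_def c_def \<kappa>_def)
  qed
  define l b where "l = lambda_grid P n \<epsilon> j" and "b = beta_grid P n j"
  have lb: "(l, b) \<in> Lambda_grid P n \<epsilon>" using jK by (auto simp: Lambda_grid_def l_def b_def)
  have s4p: "s4 P > 0" using S s4_nonneg by (auto simp: S_def less_le)
  have pos: "l > 0" "b > 0" using grid_positive[OF n K \<epsilon> s4p lb] by auto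
  define E where "E = exp ((real j - 1 / 2) / 2)"
  have E: "E > 0" by (simp add: E_def)
  \<comment> \<open>\<open>p\<^sup>2 = E / R\<close> measures the distance to the ideal index. As
    \<open>j\<close> is within half a step of \<open>2 * ln R + 1 / 2\<close>, it stays between
    \<open>exp (- 1 / 4)\<close> and \<open>exp (1 / 4)\<close>.\<close>
  define p where "p = exp (((real j - 1 / 2) / 2 - ln R) / 2)"
  have p0: "p > 0" by (simp add: p_def)
  have ERp: "E = R * p\<^sup>2"
  proof -
    have "p\<^sup>2 = exp ((real j - 1 / 2) / 2 - ln R)" unfolding p_def by (simp add: power2_eq_square flip: exp_add)
    then show ?thesis using R1 by (simp add: E_def exp_diff)
  qed
  have p_bounds: "inverse (11333 / 10000) \<le> p" "p \<le> 11333 / 10000"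
  proof -
    have "((real j - 1 / 2) / 2 - ln R) / 2 = (real j - 2 * ln R) / 4 - 1 / 8" by (simp add: field_simps)
    then have jR: "((real j - 1 / 2) / 2 - ln R) / 2 \<le> 1 / 8" "- (1 / 8) \<le> ((real j - 1 / 2) / 2 - ln R) / 2"
      using j by simp_all
    have "p \<le> exp (1 / 8)" unfolding p_def exp_le_cancel_iff by (rule jR)
    also have "\<dots> \<le> 11333 / 10000" by (rule exp_eighth_le)
    finally show "p \<le> 11333 / 10000" .
    have "inverse (11333 / 10000) \<le> inverse (exp (1 / 8 :: real))"
      using exp_eighth_le by (intro le_imp_inverse_le) auto
    also have "\<dots> = exp (- (1 / 8))" by (simp only: exp_minus)
    also have "\<dots> \<le> p" unfolding p_def exp_le_cancel_iff by (rule jR)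
    finally show "inverse (11333 / 10000) \<le> p" .
  qed
  define w where "w = (2 + c) * sqrt \<kappa>"
  have w: "w > 0" using c \<kappa> by (simp add: w_def)
  define A' where "A' = (2 + 3 * c) / (4 * w) * E"
  define A where "A = A' * exp (1 / 4)"
  define Lc where "Lc = ln (real (card (Lambda_grid P n \<epsilon>)) / \<epsilon>)"
  note gc = grid_coef[OF n K \<epsilon> s4p lb[unfolded l_def b_def], folded l_def b_def \<kappa>_def L_def Lc_def c_def S_def E_def,
      folded w_def, folded A'_def, folded A_def]
  note A' = gc(2) and Lc = gc(4) and l2 = gc(5) and nl = gc(6) and bE = gc(7) and gam = gc(8)
  have e4: "1 \<le> exp (1 / 4 :: real)" "exp (1 / 4 :: real) \<le> 1.285"
  proof -
    have "exp (1 / 4 :: real) = (exp (1 / 8))\<^sup>2" by (simp add: power2_eq_square flip: exp_add)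
    also have "\<dots> \<le> (11333 / 10000)\<^sup>2" using exp_eighth_le by (intro power_mono) auto
    finally show "exp (1 / 4 :: real) \<le> 1.285" by (simp add: power2_eq_square)
  qed simp
  have AA': "A' \<le> A" "A \<le> 1.285 * A'" using A' e4 by (simp_all add: A_def)
  have part1: "l / 2 * (\<kappa> - 1) + A' / (real n * l) + Lc / (real n * l)
      \<le> sqrt (2.032 * (\<kappa> - 1) * (A' + L)) / sqrt (real n)"
  proof -
    define u v where "u = A + L" and "v = A' + L"
    have uv: "0 < v" "v \<le> u" "u \<le> 1.285 * v" using A' AA' L0 by (auto simp: u_def v_def)
    \<comment> \<open>The ratio of \<open>u\<close> to \<open>v\<close> lies between 1 and 1.285,
      where 1.285 bounds \<open>exp (1 / 4)\<close>. On that range \<open>u / v + v / u + 2\<close>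
      stays below \<open>4.064 = 2 * 2.032\<close>, the origin of 2.032 here.\<close>
    have quad: "(u + v)\<^sup>2 \<le> 4.064 * u * v"
    proof -
      have "0 \<le> (u - v) * (1.285 * v - u)" using uv by simp
      also have "(u - v) * (1.285 * v - u) = 2.285 * (u * v) - 1.285 * v\<^sup>2 - u\<^sup>2"
        by (simp add: power2_eq_square field_simps)
      finally have "u\<^sup>2 \<le> 2.285 * (u * v) - 1.285 * v\<^sup>2" by simp
      moreover have "u * v \<le> 1.285 * v\<^sup>2" using uv by (simp add: power2_eq_square)
      moreover have "0 < v\<^sup>2" using uv by simp
      ultimately show ?thesis by (simp add: power2_eq_square algebra_simps)
    qed
    have "Lc / (real n * l) \<le> L / (real n * l)" using Lc n0 pos by (intro divide_right_mono) auto
    moreover have "l / 2 * (\<kappa> - 1) = u / (real n * l)"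
      unfolding u_def by (rule nl)
    ultimately have "l / 2 * (\<kappa> - 1) + A' / (real n * l) + Lc / (real n * l) \<le> (u + v) / (real n * l)"
      by (simp add: v_def add_divide_distrib)
    also have "\<dots> \<le> sqrt (2.032 * (\<kappa> - 1) * v / real n)"
    proof (rule real_le_rsqrt)
      have "((u + v) / (real n * l))\<^sup>2 = (u + v)\<^sup>2 / ((real n)\<^sup>2 * l\<^sup>2)" by (simp add: power_divide power_mult_distrib)
      also have "(real n)\<^sup>2 * l\<^sup>2 = 2 * real n * u / (\<kappa> - 1)"
        unfolding l2 u_def using n0 \<kappa> by (simp add: power2_eq_square)
      also have "(u + v)\<^sup>2 / (2 * real n * u / (\<kappa> - 1)) \<le> (4.064 * u * v) / (2 * real n * u / (\<kappa> - 1))"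
        using quad n0 uv \<kappa> by (intro divide_right_mono) auto
      also have "\<dots> = 2.032 * (\<kappa> - 1) * v / real n" using n0 uv \<kappa> by (simp add: field_simps)
      finally show "((u + v) / (real n * l))\<^sup>2 \<le> 2.032 * (\<kappa> - 1) * v / real n" .
    qed
    finally show ?thesis by (simp only: v_def real_sqrt_divide)
  qed
  have sR: "sqrt E = sqrt R * p" using R1 p0 by (simp add: ERp real_sqrt_mult)
  \<comment> \<open>The two terms in \<open>b\<close> are the same quantity multiplied by
    \<open>p\<close> and by \<open>inverse p\<close>.\<close>
  have part2: "w * S / b + b / (2 * real n * s) = sqrt (w * R / 2) * (p + inverse p) / sqrt (real n)"
  proof -
    define r where "r = sqrt R"
    define f where "f = sqrt (2 * w * real n)"
    have r: "r > 0" "r * r = R" using R1 by (auto simp: r_def)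
    have f: "f > 0" "f * f = 2 * w * real n" using w n0 by (auto simp: f_def)
    have bb: "b = S * f / (r * p)" using bE sR by (simp add: f_def r_def)
    have "w * S / b = w * r * p / f" unfolding bb using S r p0 f by simp
    also have "\<dots> = f * r / (2 * real n) * p" using f w n0 by (simp add: field_simps)
    finally have 1: "w * S / b = f * r / (2 * real n) * p" .
    have "b / (2 * real n * s) = (S / s) * f / (2 * real n * (r * p))" unfolding bb by (simp add: field_simps)
    also have "S / s = r * r" using r by (simp add: R_def)
    also have "(r * r) * f / (2 * real n * (r * p)) = f * r / (2 * real n) * inverse p" using r p0 n0 by (simp add: field_simps)
    finally have 2: "b / (2 * real n * s) = f * r / (2 * real n) * inverse p" .
    have 3: "f * r / (2 * real n) = sqrt (w * R / 2) / sqrt (real n)"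
    proof -
      have "f * r = sqrt (4 * (w * R / 2) * real n)" by (simp add: f_def r_def mult_ac flip: real_sqrt_mult)
      also have "\<dots> = 2 * sqrt (w * R / 2) * sqrt (real n)" by (simp only: real_sqrt_mult real_sqrt_four)
      finally have "f * r = 2 * sqrt (w * R / 2) * sqrt (real n)" .
      then show ?thesis using n0 by (simp add: real_div_sqrt field_simps)
    qed
    show ?thesis unfolding 1 2 3 by (simp add: distrib_left add_divide_distrib)
  qed
  have A'T: "A' \<le> 0.73 * T * p\<^sup>2"
  proof -
    have "(2 + 3 * c) / (4 * (2 + c)) \<le> 0.73" using c by (simp add: field_simps)
    moreover have "R / sqrt \<kappa> \<le> T" using RT \<kappa> by (simp add: field_simps)
    ultimately have "(2 + 3 * c) / (4 * (2 + c)) * (R / sqrt \<kappa>) \<le> 0.73 * T"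
      using c R1 \<kappa> by (intro mult_mono) auto
    then have "(2 + 3 * c) / (4 * (2 + c)) * (R / sqrt \<kappa>) * p\<^sup>2 \<le> 0.73 * T * p\<^sup>2" by (rule mult_right_mono) simp
    moreover have "A' = (2 + 3 * c) / (4 * (2 + c)) * (R / sqrt \<kappa>) * p\<^sup>2"
      by (simp only: A'_def w_def ERp times_divide_eq_left times_divide_eq_right mult_ac divide_divide_eq_left)
    ultimately show ?thesis by (simp only:)
  qed
  have wR: "w * R \<le> (2 + c) * \<kappa> * T"
  proof -
    have "w * R \<le> w * (sqrt \<kappa> * T)" using RT w by (intro mult_left_mono) auto
    also have "\<dots> = (2 + c) * \<kappa> * T" using \<kappa> by (simp add: w_def mult_ac)
    finally show ?thesis .
  qed
  have "gamma_coef P n \<epsilon> l b + b / (2 * real n * s)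
      \<le> (sqrt (2.032 * (\<kappa> - 1) * (A' + L)) + sqrt (w * R / 2) * (p + inverse p)) / sqrt (real n)"
    using part1 part2 unfolding gam by (simp add: add_divide_distrib)
  also have "\<dots> \<le> (sqrt (2.032 * (\<kappa> - 1) * (0.73 * T * p\<^sup>2 + L)) + sqrt ((2 + c) * \<kappa> * T / 2) * (p + inverse p)) / sqrt (real n)"
    using A'T wR \<kappa> p0 by (intro divide_right_mono add_mono mult_right_mono real_sqrt_le_mono mult_left_mono) auto
  also have "\<dots> \<le> zeta_star P n \<epsilon> s / sqrt (real n)"
    unfolding zeta using zeta_slack[OF \<kappa>(1) _ L0 _ _ p_bounds] c T0 by (intro divide_right_mono) auto
  finally show ?thesis using lb by blast
qed

text \<open>The balance defining \<open>l\<close> makes the entropy and logarithm terms of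
  \<open>gamma_coef\<close> at most \<open>l / 2 * (kappa P - 1)\<close>, whence
  \<open>gamma_coef \<le> mu_coef\<close>. The bound on \<open>xi_coef\<close> comes from
  \<open>kappa / (kappa - 1) = 1 + inverse (kappa - 1)\<close> and accounts for the inverse in the
  condition of \<open>B_star\<close>.\<close>

lemma coef_bounds:
  assumes n: "n \<ge> 1" and K: "grid_size P n \<ge> 1" and \<epsilon>: "0 < \<epsilon>" "\<epsilon> < 1" and s4: "s4 P > 0"
    and lb: "(l, b) \<in> Lambda_grid P n \<epsilon>"
  shows "0 < gamma_coef P n \<epsilon> l b" "gamma_coef P n \<epsilon> l b \<le> mu_coef P l b"
    "mu_coef P l b \<le> 2 * gamma_coef P n \<epsilon> l b" "0 \<le> xi_coef P l"
    "xi_coef P l \<le> (1 + inverse (kappa P - 1)) * gamma_coef P n \<epsilon> l b"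
    "0 < delta_coef n l b"
proof -
  have pos: "l > 0" "b > 0" using grid_positive[OF n K \<epsilon> s4 lb] by auto
  obtain j where j: "l = lambda_grid P n \<epsilon> j" "b = beta_grid P n j" using lb by (auto simp: Lambda_grid_def)
  have k: "kappa P - 1 > 0" using kappa_pos by auto
  define v where "v = (2 + c_const) * sqrt (kappa P)"
  define w where "w = v * (s4 P)\<^sup>2 / b"
  define A' where "A' = (2 + 3 * c_const) / (4 * v) * exp ((real j - 1 / 2) / 2)"
  define L where "L = ln (real_of_int (grid_size P n) / \<epsilon>)"
  define Lc where "Lc = ln (real (card (Lambda_grid P n \<epsilon>)) / \<epsilon>)"
  note gc = grid_coef[OF n K \<epsilon> s4 lb[unfolded j], folded j, folded v_def L_def Lc_def, folded A'_def w_def]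
  note gam = gc(8)
  have nl: "real n * l > 0" using n pos by simp
  have w: "w > 0" using gc(1) s4 pos by (simp add: w_def)
  have lk: "0 < l / 2 * (kappa P - 1)" using pos k by simp
  have mu: "mu_coef P l b = 2 * (l / 2 * (kappa P - 1)) + w" by (simp add: mu_coef_def w_def v_def)
  have nonneg: "0 \<le> A' / (real n * l)" "0 \<le> Lc / (real n * l)" using gc(2,3) nl by auto
  have "A' * 1 \<le> A' * exp (1 / 4)" using gc(2) by (intro mult_left_mono) auto
  then have "(A' + Lc) / (real n * l) \<le> (A' * exp (1 / 4) + L) / (real n * l)"
    using gc(4) nl by (intro divide_right_mono) auto
  then have half: "A' / (real n * l) + Lc / (real n * l) \<le> l / 2 * (kappa P - 1)"
    unfolding gc(6) by (simp add: add_divide_distrib)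
  show "0 < gamma_coef P n \<epsilon> l b" unfolding gam using w lk nonneg by linarith
  show "gamma_coef P n \<epsilon> l b \<le> mu_coef P l b" unfolding gam mu using half by linarith
  have "2 * x + w \<le> 2 * (x + w + y + z)" if "0 \<le> y" "0 \<le> z" for x y z using w that by simp
  then show "mu_coef P l b \<le> 2 * gamma_coef P n \<epsilon> l b" unfolding gam mu using nonneg by blast
  show "0 \<le> xi_coef P l" using pos kappa_pos by (simp add: xi_coef_def)
  show "0 < delta_coef n l b" using pos n by (simp add: delta_coef_def)
  have "xi_coef P l = (1 + inverse (kappa P - 1)) * (l / 2 * (kappa P - 1))"
    using k by (simp add: xi_coef_def field_simps)
  also have "\<dots> \<le> (1 + inverse (kappa P - 1)) * gamma_coef P n \<epsilon> l b"
  proof (rule mult_left_mono)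
    show "l / 2 * (kappa P - 1) \<le> gamma_coef P n \<epsilon> l b" unfolding gam using w nonneg by linarith
  qed (use k in simp)
  finally show "xi_coef P l \<le> (1 + inverse (kappa P - 1)) * gamma_coef P n \<epsilon> l b" .
qed

end

subsection \<open>The confidence bounds\<close>

lemma psi_eq: "psi t = ln (lower_quad (min t 0)) - ln (lower_quad (- max t 0))"
proof -
  have *: "psi_nonneg s = - ln (lower_quad (- s))" if "s \<ge> 0" for s
  proof (cases "s \<le> 1")
    case True
    have "1 - s + s\<^sup>2 / 2 = lower_quad (- s)" using True by (simp add: lower_quad_def power2_eq_square field_simps)
    then show ?thesis using True by (simp add: psi_nonneg_def)
  next
    case False
    then show ?thesis by (simp add: psi_nonneg_def lower_quad_def ln_div)
  qed
  have "lower_quad 0 = 1" by (simp add: lower_quad_def)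
  then show ?thesis by (cases "t \<ge> 0") (auto simp: psi_def * min_def max_def)
qed

lemma lower_quad_pos: "lower_quad z > 0"
  using lower_quad_ge_half[of z] by linarith

text \<open>The representation \<open>psi_eq\<close> composes \<open>lower_quad\<close> with
  truncations at 0, which yields continuity, and likewise monotonicity, without inspecting the
  points where the pieces of \<open>psi\<close> are glued.\<close>

lemma continuous_on_psi: "continuous_on UNIV psi"
proof -
  have lower_quad: "continuous_on UNIV lower_quad" unfolding lower_quad_def[abs_def] by (intro continuous_intros) auto
  have *: "continuous_on UNIV (\<lambda>t. ln (lower_quad (f t)))" if "continuous_on UNIV f" for f :: "real \<Rightarrow> real"
    using lower_quad_pos that by (intro continuous_on_ln continuous_on_compose2[OF lower_quad]) (auto simp: less_imp_neq[symmetric])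
  show ?thesis unfolding psi_eq[abs_def] by (intro continuous_on_diff *) (intro continuous_intros)+
qed

lemma psi_mono: "s \<le> t \<Longrightarrow> psi s \<le> psi t"
  unfolding psi_eq by (intro diff_mono) (use lower_quad_pos in \<open>auto intro!: lower_quad_mono\<close>)

lemma psi_minus: "psi (- t) = - psi t"
  by (cases "t = 0") (auto simp: psi_def psi_nonneg_def)

lemma psi_neg: "t < 0 \<Longrightarrow> psi t < 0"
proof -
  assume "t < 0"
  then have "(max (1 + t) 0)\<^sup>2 < 1\<^sup>2" by (intro power_strict_mono) auto
  then have "lower_quad t < 1" by (simp add: lower_quad_def)
  then have "ln (lower_quad t) < 0" using lower_quad_pos by (intro ln_less_zero) auto
  then show "psi t < 0" using \<open>t < 0\<close> by (simp add: psi_eq lower_quad_def[of 0])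
qed

lemma r_emp_scale: "r_emp n x l (\<alpha> *\<^sub>R \<theta>) = (1 / real n) * (\<Sum>i = 1..n. psi (\<alpha>\<^sup>2 * (\<theta> \<bullet> x i)\<^sup>2 - l))"
  by (simp add: r_emp_def power_mult_distrib)

lemma r_emp_mono:
  assumes "0 \<le> \<alpha>" "\<alpha> \<le> \<beta>"
  shows "r_emp n x l (\<alpha> *\<^sub>R \<theta>) \<le> r_emp n x l (\<beta> *\<^sub>R \<theta>)"
  unfolding r_emp_scale using assms
  by (intro mult_left_mono sum_mono psi_mono diff_right_mono mult_right_mono power_mono) auto

lemma isCont_r_emp: "isCont (\<lambda>\<alpha>. r_emp n x l (\<alpha> *\<^sub>R \<theta>)) \<alpha>"
proof -
  have psi: "isCont psi y" for y using continuous_on_psi by (simp add: continuous_on_eq_continuous_at)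
  show ?thesis
    unfolding r_emp_scale
    by (intro continuous_intros isCont_o2[OF _ psi])
qed

text \<open>Where \<open>r_emp\<close> is negative it remains so slightly further out, by
  continuity. Hence the supremum is positive, because \<open>psi (- l) < 0\<close> rules the origin,
  and \<open>r_emp\<close> cannot be negative at a finite supremum.\<close>

lemma alpha_hat_cases:
  assumes n: "n \<ge> 1" and l: "l > 0"
  obtains "alpha_hat n x l \<theta> = \<infinity>" "\<And>\<alpha>. \<alpha> \<ge> 0 \<Longrightarrow> r_emp n x l (\<alpha> *\<^sub>R \<theta>) \<le> 0"
  | a where "alpha_hat n x l \<theta> = ereal a" "a > 0" "r_emp n x l (a *\<^sub>R \<theta>) \<ge> 0"
    "\<And>\<alpha>. \<alpha> \<ge> 0 \<Longrightarrow> r_emp n x l (\<alpha> *\<^sub>R \<theta>) > 0 \<Longrightarrow> a \<le> \<alpha>"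
proof -
  define A where "A = {\<alpha>. \<alpha> \<ge> 0 \<and> r_emp n x l (\<alpha> *\<^sub>R \<theta>) \<le> 0}"
  have hat: "alpha_hat n x l \<theta> = Sup (ereal ` A)" by (simp add: alpha_hat_def A_def)
  have bigger: "\<exists>\<beta>>\<alpha>. \<beta> \<in> A" if "\<alpha> \<ge> 0" "r_emp n x l (\<alpha> *\<^sub>R \<theta>) < 0" for \<alpha>
  proof -
    have "eventually (\<lambda>\<beta>. r_emp n x l (\<beta> *\<^sub>R \<theta>) < 0) (at \<alpha>)"
      using isCont_r_emp[of \<alpha> n x l \<theta>] that(2) unfolding isCont_def by (rule order_tendstoD)
    then obtain d where d: "d > 0" "\<And>\<beta>. \<beta> \<noteq> \<alpha> \<Longrightarrow> dist \<beta> \<alpha> < d \<Longrightarrow> r_emp n x l (\<beta> *\<^sub>R \<theta>) < 0"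
      by (auto simp: eventually_at)
    have "r_emp n x l ((\<alpha> + d / 2) *\<^sub>R \<theta>) < 0" using d(1) by (intro d(2)) (auto simp: dist_real_def)
    then show ?thesis using that(1) d(1) by (intro exI[of _ "\<alpha> + d / 2"]) (simp add: A_def)
  qed
  have "psi (- l) < 0" using l by (intro psi_neg) auto
  then have r0: "r_emp n x l (0 *\<^sub>R \<theta>) < 0"
    unfolding r_emp_scale using n by (simp add: field_simps mult_neg_pos)
  then obtain \<beta> where \<beta>: "\<beta> > 0" "\<beta> \<in> A" using bigger[of 0] by auto
  have upper: "ereal \<alpha> \<le> alpha_hat n x l \<theta>" if "\<alpha> \<in> A" for \<alpha>
    unfolding hat using that by (intro Sup_upper) auto
  have hat0: "0 < alpha_hat n x l \<theta>" using upper[OF \<beta>(2)] \<beta>(1) by (metis ereal_less(2) less_le_trans)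
  have bound: "alpha_hat n x l \<theta> \<le> ereal \<alpha>" if "\<alpha> \<ge> 0" "r_emp n x l (\<alpha> *\<^sub>R \<theta>) > 0" for \<alpha>
    unfolding hat
  proof (rule Sup_least)
    fix y assume "y \<in> ereal ` A"
    then obtain \<gamma> where \<gamma>: "y = ereal \<gamma>" "\<gamma> \<ge> 0" "r_emp n x l (\<gamma> *\<^sub>R \<theta>) \<le> 0" by (auto simp: A_def)
    then show "y \<le> ereal \<alpha>" using r_emp_mono[OF that(1), of \<gamma> n x l \<theta>] that(2) by force
  qed
  show ?thesis
  proof (cases "alpha_hat n x l \<theta>")
    case PInf
    have "r_emp n x l (\<alpha> *\<^sub>R \<theta>) \<le> 0" if "\<alpha> \<ge> 0" for \<alpha>
      using bound[OF that] PInf by force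
    then show ?thesis using that(1) PInf by blast
  next
    case MInf
    then show ?thesis using hat0 by simp
  next
    case (real a)
    have "a > 0" using hat0 real by simp
    moreover have "r_emp n x l (a *\<^sub>R \<theta>) \<ge> 0"
    proof (rule ccontr)
      assume "\<not> 0 \<le> r_emp n x l (a *\<^sub>R \<theta>)"
      then obtain \<gamma> where "\<gamma> > a" "\<gamma> \<in> A" using bigger[of a] \<open>a > 0\<close> by force
      then show False using upper[of \<gamma>] real by simp
    qed
    moreover have "a \<le> \<alpha>" if "\<alpha> \<ge> 0" "r_emp n x l (\<alpha> *\<^sub>R \<theta>) > 0" for \<alpha>
      using bound[OF that] real by simp
    ultimately show ?thesis using that(2) real by blast
  qed
qed

section \<open>Inversion of the quadratic bounds for \<open>r_emp\<close>\<close>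

lemma convex_quadratic_root:
  fixes \<xi> b c u v :: real
  assumes "0 \<le> \<xi>" "\<xi> * v\<^sup>2 + b * v + c \<le> 0" "\<xi> + b + c < 0" "u \<le> 1" "0 \<le> \<xi> * u\<^sup>2 + b * u + c" "v < 1"
  shows "u \<le> v"
proof (rule ccontr)
  assume "\<not> u \<le> v"
  \<comment> \<open>Convexity on the chord from \<open>v\<close> to 1: the quadratic is at most 0 at
    \<open>v\<close> and negative at 1, so it cannot be nonnegative at a point \<open>u\<close> of
    the half-open interval beyond \<open>v\<close>.\<close>
  have "(1 - v) * (\<xi> * u\<^sup>2 + b * u + c) = (1 - u) * (\<xi> * v\<^sup>2 + b * v + c) + (u - v) * (\<xi> + b + c)
      - \<xi> * ((u - v) * ((1 - u) * (1 - v)))"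
    by (simp add: power2_eq_square algebra_simps)
  moreover have "(1 - u) * (\<xi> * v\<^sup>2 + b * v + c) \<le> 0" using assms by (intro mult_nonneg_nonpos) auto
  moreover have "(u - v) * (\<xi> + b + c) < 0" using assms \<open>\<not> u \<le> v\<close> by (intro mult_pos_neg) auto
  moreover have "0 \<le> \<xi> * ((u - v) * ((1 - u) * (1 - v)))" using assms \<open>\<not> u \<le> v\<close> by simp
  moreover have "0 \<le> (1 - v) * (\<xi> * u\<^sup>2 + b * u + c)" using assms by simp
  ultimately show False by linarith
qed

text \<open>A condition on one sample, stated for vectors of all lengths because it is applied to
  multiples of unit vectors. The variable \<open>t\<close> is the relative distance of the moment
  from the level \<open>l\<close>.\<close>

definition emp_bounds ::
    "(real ^ 'd) measure \<Rightarrow> nat \<Rightarrow> real \<Rightarrow> (nat \<Rightarrow> real ^ 'd) \<Rightarrow> real \<Rightarrow> real \<Rightarrow> bool" where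
  "emp_bounds P n \<epsilon> x l b \<longleftrightarrow> (\<forall>\<theta>. let t = quad_moment P \<theta> / l - 1 in
     r_emp n x l \<theta> \<le> l * (xi_coef P l * t\<^sup>2 + (1 + mu_coef P l b) * t
       + gamma_coef P n \<epsilon> l b + delta_coef n l b * (norm \<theta>)\<^sup>2) \<and>
     l * (- xi_coef P l * t\<^sup>2 + (1 - mu_coef P l b) * t
       - gamma_coef P n \<epsilon> l b - delta_coef n l b * (norm \<theta>)\<^sup>2) \<le> r_emp n x l \<theta>)"

text \<open>At the multiple \<open>alpha_hat\<close> the empirical mean is nonnegative, hence so is
  its upper quadratic at \<open>t = N \<theta> / Nt - 1\<close>, where the norm term equals
  \<open>\<tau>\<close>. The candidate \<open>v = y / (1 + \<mu> - y)\<close> gives this quadratic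
  the value \<open>v * (\<xi> * v - y) \<le> 0\<close> and therefore bounds \<open>u = - t\<close>
  from above.\<close>

lemma Phi_minus_N_tilde_le:
  assumes n: "n \<ge> 1" and l: "l > 0" and eb: "emp_bounds P n \<epsilon> x l b"
    and \<theta>: "norm \<theta> = 1"
    and c: "0 < gamma_coef P n \<epsilon> l b" "0 \<le> xi_coef P l" "0 < delta_coef n l b"
  shows "Phi_minus P n \<epsilon> l b (N_tilde n x l \<theta>) \<le> quad_moment P \<theta>"
proof -
  define N where "N = quad_moment P"
  have N: "N \<theta> \<ge> 0" "\<And>a. N (a *\<^sub>R \<theta>) = a\<^sup>2 * N \<theta>" by (simp_all add: N_def quad_moment_nonneg quad_moment_scale)
  define \<xi> \<mu> \<gamma> d where "\<xi> = xi_coef P l" and "\<mu> = mu_coef P l b" and "\<gamma> = gamma_coef P n \<epsilon> l b" and "d = delta_coef n l b"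
  define Nt where "Nt = N_tilde n x l \<theta>"
  define \<tau> where "\<tau> = d * l / Nt"
  have Phi: "Phi_minus P n \<epsilon> l b Nt = (if Nt > 0 \<and> \<xi> - \<mu> + 2 * \<gamma> + 2 * \<tau> < 1 then Nt * (1 - (\<gamma> + \<tau>) / (1 + \<mu> - \<gamma> - \<tau>)) else 0)"
    by (simp add: Phi_minus_def Let_def \<xi>_def \<mu>_def \<gamma>_def \<tau>_def d_def)
  show ?thesis
  proof (cases "Nt > 0 \<and> \<xi> - \<mu> + 2 * \<gamma> + 2 * \<tau> < 1")
    case False
    then show ?thesis using N(1) Phi unfolding Nt_def[symmetric] N_def[symmetric] by (simp only: if_False)
  next
    case True
    obtain a where a: "alpha_hat n x l \<theta> = ereal a" "a > 0" "r_emp n x l (a *\<^sub>R \<theta>) \<ge> 0"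
      using True by (cases rule: alpha_hat_cases[OF n l, where x = x and \<theta> = \<theta>]) (auto simp: Nt_def N_tilde_def)
    have Nt: "Nt = l / a\<^sup>2" by (simp add: Nt_def N_tilde_def a)
    define u where "u = 1 - N \<theta> / Nt"
    have t: "N (a *\<^sub>R \<theta>) / l = N \<theta> / Nt" using a l by (simp add: N(2) Nt)
    have tau: "\<tau> = d * a\<^sup>2" using a l by (simp add: \<tau>_def Nt)
    have "0 \<le> l * (\<xi> * (N (a *\<^sub>R \<theta>) / l - 1)\<^sup>2 + (1 + \<mu>) * (N (a *\<^sub>R \<theta>) / l - 1) + \<gamma> + d * (norm (a *\<^sub>R \<theta>))\<^sup>2)"
      using eb a(3) unfolding emp_bounds_def Let_def \<xi>_def \<mu>_def \<gamma>_def d_def N_def by (meson order_trans)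
    then have q: "0 \<le> \<xi> * (N \<theta> / Nt - 1)\<^sup>2 + (1 + \<mu>) * (N \<theta> / Nt - 1) + \<gamma> + \<tau>"
      using l \<theta> by (simp add: zero_le_mult_iff t tau power_mult_distrib)
    define y where "y = \<gamma> + \<tau>"
    have y: "y > 0" using c True l by (simp add: y_def \<gamma>_def \<tau>_def d_def add_pos_nonneg)
    define v where "v = y / (1 + \<mu> - y)"
    have \<xi>: "\<xi> \<ge> 0" using c by (simp add: \<xi>_def)
    have D: "\<xi> + y < 1 + \<mu> - y" using True by (simp add: y_def)
    have "u \<le> v"
    proof (rule convex_quadratic_root[of \<xi> v "- (1 + \<mu>)" y])
      have vD: "v * (1 + \<mu> - y) = y" using D \<xi> y by (simp add: v_def)
      have v0: "0 \<le> v" using D \<xi> y by (simp add: v_def)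
      have "\<xi> * v \<le> y"
      proof -
        have "\<xi> * v \<le> (1 + \<mu> - y) * v" using D y v0 by (intro mult_right_mono) auto
        then show ?thesis using vD by (simp add: mult.commute)
      qed
      then have "v * (\<xi> * v - y) \<le> 0" using v0 by (intro mult_nonneg_nonpos) auto
      moreover have "\<xi> * v\<^sup>2 + - (1 + \<mu>) * v + y = v * (\<xi> * v - y)"
      proof -
        have "\<xi> * v\<^sup>2 + - (1 + \<mu>) * v + y = v * (\<xi> * v - y) - (v * (1 + \<mu> - y) - y)"
          by (simp add: power2_eq_square algebra_simps)
        then show ?thesis using vD by simp
      qed
      ultimately show "\<xi> * v\<^sup>2 + - (1 + \<mu>) * v + y \<le> 0" by simp
      show "v < 1" unfolding v_def using D \<xi> y by (simp add: divide_less_eq)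
      show "\<xi> + - (1 + \<mu>) + y < 0" using D y by linarith
      show "u \<le> 1" using N True by (simp add: u_def)
      have "N \<theta> / Nt - 1 = - u" by (simp add: u_def)
      then show "0 \<le> \<xi> * u\<^sup>2 + - (1 + \<mu>) * u + y" using q by (simp only: y_def power2_minus)
    qed (rule \<xi>)
    then have "Nt * (1 - v) \<le> Nt * (1 - u)" using True by (intro mult_left_mono) auto
    also have "\<dots> = N \<theta>" using True by (simp add: u_def)
    finally have "Nt * (1 - v) \<le> N \<theta>" .
    moreover have "Phi_minus P n \<epsilon> l b Nt = Nt * (1 - v)"
      unfolding Phi v_def y_def using True by (simp add: algebra_simps)
    ultimately show ?thesis by (simp add: Nt_def N_def)
  qed
qed

lemma N_tilde_nonneg: "l > 0 \<Longrightarrow> N_tilde n x l \<theta> \<ge> 0"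
  by (simp add: N_tilde_def)

text \<open>The multiple \<open>\<alpha>\<close> is chosen so that the moment of
  \<open>\<alpha> *\<^sub>R \<theta>\<close> is \<open>l * (1 + v)\<close>. The lower quadratic is
  positive there, which forces \<open>alpha_hat\<close> to be at most \<open>\<alpha>\<close>. The
  norm term is now \<open>\<tau> * (1 + v)\<close>; its part proportional to \<open>v\<close>
  explains the \<open>2 * \<tau>\<close> in the denominator.\<close>

lemma Phi_plus_le_N_tilde:
  assumes n: "n \<ge> 1" and l: "l > 0" and eb: "emp_bounds P n \<epsilon> x l b"
    and \<theta>: "norm \<theta> = 1"
    and c: "0 < gamma_coef P n \<epsilon> l b" "0 \<le> xi_coef P l" "0 < delta_coef n l b"
  shows "Phi_plus P n \<epsilon> l b (quad_moment P \<theta>) \<le> N_tilde n x l \<theta>"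
proof -
  define N where "N = quad_moment P"
  have N: "N \<theta> \<ge> 0" "\<And>a. N (a *\<^sub>R \<theta>) = a\<^sup>2 * N \<theta>" by (simp_all add: N_def quad_moment_nonneg quad_moment_scale)
  define \<xi> \<mu> \<gamma> d where "\<xi> = xi_coef P l" and "\<mu> = mu_coef P l b" and "\<gamma> = gamma_coef P n \<epsilon> l b" and "d = delta_coef n l b"
  define t where "t = N \<theta>"
  define \<tau> where "\<tau> = d * l / t"
  have Phi: "Phi_plus P n \<epsilon> l b t = (if t > 0 \<and> \<xi> + \<mu> + \<gamma> + 2 * \<tau> < 1 then t * inverse (1 + (\<gamma> + \<tau>) / (1 - \<mu> - \<gamma> - 2 * \<tau>)) else 0)"
    by (simp add: Phi_plus_def Let_def \<xi>_def \<mu>_def \<gamma>_def \<tau>_def d_def)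
  show ?thesis
  proof (cases "t > 0 \<and> \<xi> + \<mu> + \<gamma> + 2 * \<tau> < 1")
    case False
    then show ?thesis using N_tilde_nonneg[OF l] Phi unfolding t_def[symmetric] N_def[symmetric] by (simp only: if_False)
  next
    case True
    define y D where "y = \<gamma> + \<tau>" and "D = 1 - \<mu> - \<gamma> - 2 * \<tau>"
    have \<xi>: "\<xi> \<ge> 0" using c by (simp add: \<xi>_def)
    have y: "y > 0" using c True l by (simp add: y_def \<gamma>_def \<tau>_def d_def add_pos_nonneg)
    have D: "D > \<xi>" "D > 0" using True \<xi> by (auto simp: D_def)
    define v where "v = y / D"
    have v: "v > 0" "v * D = y" using y D by (auto simp: v_def)
    define \<alpha> where "\<alpha> = sqrt (l * (1 + v) / t)"
    have \<alpha>: "\<alpha> > 0" "\<alpha>\<^sup>2 = l * (1 + v) / t" using l v True by (auto simp: \<alpha>_def)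
    have "N (\<alpha> *\<^sub>R \<theta>) / l - 1 = v" using l True by (simp add: N(2) \<alpha>(2) t_def)
    moreover have "d * (norm (\<alpha> *\<^sub>R \<theta>))\<^sup>2 = \<tau> * (1 + v)"
      using \<theta> by (simp add: power_mult_distrib \<alpha>(2) \<tau>_def)
    ultimately have "l * (- \<xi> * v\<^sup>2 + (1 - \<mu>) * v - \<gamma> - \<tau> * (1 + v)) \<le> r_emp n x l (\<alpha> *\<^sub>R \<theta>)"
      using eb unfolding emp_bounds_def Let_def \<xi>_def \<mu>_def \<gamma>_def d_def N_def by metis
    moreover have "0 < l * (- \<xi> * v\<^sup>2 + (1 - \<mu>) * v - \<gamma> - \<tau> * (1 + v))"
    proof (rule mult_pos_pos[OF l])
      have "\<xi> * v < D * v" using D v by (intro mult_strict_right_mono) auto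
      then have "\<xi> * v < y" using v(2) by (simp only: mult.commute)
      then have "0 < v * (y - \<xi> * v)" using v(1) by simp
      moreover have "- \<xi> * v\<^sup>2 + (1 - \<mu>) * v - \<gamma> - \<tau> * (1 + v) = v * (y - \<xi> * v) + (v * D - y)"
        by (simp add: y_def D_def power2_eq_square algebra_simps)
      ultimately show "0 < - \<xi> * v\<^sup>2 + (1 - \<mu>) * v - \<gamma> - \<tau> * (1 + v)" using v by simp
    qed
    ultimately have r: "r_emp n x l (\<alpha> *\<^sub>R \<theta>) > 0" by linarith
    obtain a where a: "alpha_hat n x l \<theta> = ereal a" "a > 0" "a \<le> \<alpha>"
    proof (cases rule: alpha_hat_cases[OF n l, where x = x and \<theta> = \<theta>])
      case 1
      then show ?thesis using r \<alpha>(1) by (meson less_imp_le not_le)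
    next
      case (2 a)
      then show ?thesis using that r \<alpha>(1) by (meson less_imp_le)
    qed
    have "Phi_plus P n \<epsilon> l b t = t / (1 + v)" unfolding Phi using True by (simp add: v_def y_def D_def divide_inverse)
    also have "\<dots> = l / \<alpha>\<^sup>2" using l True v by (simp add: \<alpha>(2))
    also have "\<dots> \<le> l / a\<^sup>2" using l a by (intro divide_left_mono power_mono mult_pos_pos) auto
    also have "\<dots> = N_tilde n x l \<theta>" by (simp add: N_tilde_def a)
    finally show ?thesis by (simp add: t_def N_def)
  qed
qed

text \<open>This makes \<open>B_minus\<close> nonnegative, so an admissible matrix has a nonnegative
  quadratic form on the net and nearly so on the sphere.\<close>

lemma Phi_minus_nonneg:
  assumes "0 < gamma_coef P n \<epsilon> l b" "0 \<le> xi_coef P l" "0 < delta_coef n l b" "l > 0"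
  shows "0 \<le> Phi_minus P n \<epsilon> l b t"
proof (cases "t > 0 \<and> xi_coef P l - mu_coef P l b + 2 * gamma_coef P n \<epsilon> l b + 2 * (delta_coef n l b * l / t) < 1")
  case True
  define y where "y = gamma_coef P n \<epsilon> l b + delta_coef n l b * l / t"
  have "y > 0" using assms True by (simp add: y_def add_pos_nonneg)
  moreover have "y < 1 + mu_coef P l b - y" using assms True unfolding y_def by linarith
  ultimately have "y / (1 + mu_coef P l b - y) \<le> 1" by (simp add: divide_le_eq)
  then have "0 \<le> t * (1 - y / (1 + mu_coef P l b - y))" using True by simp
  then show ?thesis using True by (simp add: Phi_minus_def Let_def y_def algebra_simps)
next
  case False
  then show ?thesis by (auto simp: Phi_minus_def Let_def)
qed

text \<open>The width of the interval of all \<open>t\<close> compatible with one value of the preliminary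
  estimator. No monotonicity of \<^const>\<open>Phi_plus\<close> or \<^const>\<open>Phi_minus\<close> is involved: the
  correction \<open>\<tau>\<close> is only compared with its value at \<open>a\<close>.\<close>

lemma Phi_width:
  assumes coef: "0 < gamma_coef P n \<epsilon> l b" "gamma_coef P n \<epsilon> l b \<le> mu_coef P l b"
      "mu_coef P l b \<le> 2 * gamma_coef P n \<epsilon> l b" "0 \<le> xi_coef P l"
      "xi_coef P l \<le> (1 + k) * gamma_coef P n \<epsilon> l b" "0 < delta_coef n l b" "l > 0" "k \<ge> 0"
    and a: "a > 0" and x: "gamma_coef P n \<epsilon> l b + delta_coef n l b * l / a \<le> x" "(6 + k) * x \<le> 1"
    and t: "Phi_plus P n \<epsilon> l b t \<le> u" and u: "Phi_minus P n \<epsilon> l b u \<le> a"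
  shows "t \<le> a * (1 + 2 * (x / (1 - 4 * x)))"
proof (cases "t \<le> a")
  case True
  have "0 < delta_coef n l b * l / a" using coef a by simp
  then have "x > 0" using coef(1) x(1) by linarith
  moreover have "6 * x \<le> (6 + k) * x" using calculation coef by (intro mult_right_mono) auto
  ultimately have "0 \<le> x / (1 - 4 * x)" using x by (intro divide_nonneg_nonneg) linarith+
  then have "a * 1 \<le> a * (1 + 2 * (x / (1 - 4 * x)))" using a by (intro mult_left_mono) auto
  then show ?thesis using True by simp
next
  case False
  define \<xi> \<mu> \<gamma> d where "\<xi> = xi_coef P l" and "\<mu> = mu_coef P l b" and "\<gamma> = gamma_coef P n \<epsilon> l b" and "d = delta_coef n l b * l"
  have d: "d > 0" using coef by (simp add: d_def)
  define y where "y = \<gamma> + d / a"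
  have \<gamma>: "0 < \<gamma>" "\<gamma> \<le> \<mu>" "\<mu> \<le> 2 * \<gamma>" "0 \<le> \<xi>" "\<xi> \<le> (1 + k) * \<gamma>"
    using coef by (auto simp: \<xi>_def \<mu>_def \<gamma>_def)
  have y: "\<gamma> < y" "y \<le> x" "y > 0" using x d a \<gamma> by (auto simp: y_def \<gamma>_def d_def add_pos_pos)
  have x6: "6 * x \<le> 1" 
  proof -
    have "6 * x \<le> (6 + k) * x" using y coef(8) by (intro mult_right_mono) auto
    then show ?thesis using x by simp
  qed
  have \<xi>y: "\<xi> + 3 * y < 1"
  proof -
    have "(1 + k) * \<gamma> \<le> (1 + k) * y" using y coef(8) by (intro mult_left_mono) auto
    then have "\<xi> + 3 * y \<le> (4 + k) * y" using \<gamma> by (simp add: algebra_simps)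
    also have "\<dots> < (6 + k) * y" using y by simp
    also have "\<dots> \<le> (6 + k) * x" using y coef(8) by (intro mult_left_mono) auto
    finally show ?thesis using x by simp
  qed
  define e where "e = y / (1 - 3 * y)"
  have y3: "1 - 3 * y > 0" using y x6 by linarith
  have e0: "e > 0" using y y3 by (simp add: e_def)
  have t0: "t > a" using False by simp
  define \<tau> where "\<tau> = d / t"
  have \<tau>: "0 < \<tau>" "\<tau> \<le> d / a" using d t0 a by (auto simp: \<tau>_def intro!: divide_left_mono)
  \<comment> \<open>From \<open>\<mu> \<le> 2 * \<gamma>\<close> the subtracted terms are at most
    \<open>3 * \<gamma> + 2 * d / a\<close>, hence at most \<open>3 * y\<close>.\<close>
  have D1: "1 - 3 * y \<le> 1 - \<mu> - \<gamma> - 2 * \<tau>" using \<gamma> \<tau> unfolding y_def by argo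
  have frac: "(\<gamma> + \<tau>) / (1 - \<mu> - \<gamma> - 2 * \<tau>) \<le> e"
    unfolding e_def using D1 y3 \<tau> \<gamma> by (intro frac_le) (auto simp: y_def)
  have frac0: "0 \<le> (\<gamma> + \<tau>) / (1 - \<mu> - \<gamma> - 2 * \<tau>)" using D1 y3 \<tau> \<gamma> by simp
  have "\<xi> + \<mu> + \<gamma> + 2 * \<tau> < 1" using D1 \<xi>y by linarith
  then have Pp: "Phi_plus P n \<epsilon> l b t = t * inverse (1 + (\<gamma> + \<tau>) / (1 - \<mu> - \<gamma> - 2 * \<tau>))"
    using t0 a by (simp add: Phi_plus_def Let_def \<xi>_def \<mu>_def \<gamma>_def \<tau>_def d_def)
  have tu: "t \<le> u * (1 + e)"
  proof -
    have "t * inverse (1 + e) \<le> t * inverse (1 + (\<gamma> + \<tau>) / (1 - \<mu> - \<gamma> - 2 * \<tau>))"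
      using frac frac0 e0 t0 a by (intro mult_left_mono le_imp_inverse_le) auto
    then have "t * inverse (1 + e) \<le> u" using t Pp by simp
    then show ?thesis using e0 by (simp add: field_simps)
  qed
  have "0 < u * (1 + e)" using tu t0 a by linarith
  then have u0: "u > 0" using e0 by (simp add: zero_less_mult_iff)
  \<comment> \<open>The same factor \<open>1 + e\<close> is lost from \<open>u\<close> to
    \<open>a\<close> as from \<open>t\<close> to \<open>u\<close>; the product gives
    \<open>2 * e + e\<^sup>2\<close>.\<close>
  have ua: "u \<le> a * (1 + e)"
  proof (cases "u \<le> a")
    case True
    moreover have "a * 1 \<le> a * (1 + e)" using a e0 by (intro mult_left_mono) auto
    ultimately show ?thesis by simp
  next
    case ua: False
    define \<tau>' where "\<tau>' = d / u"
    have \<tau>': "0 < \<tau>'" "\<tau>' \<le> d / a" using d ua a by (auto simp: \<tau>'_def intro!: divide_left_mono)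
    define y' where "y' = \<gamma> + \<tau>'"
    have y': "0 < y'" "y' \<le> y" using \<gamma> \<tau>' by (auto simp: y'_def y_def)
    have D2: "1 - 3 * y \<le> 1 + \<mu> - 2 * y'" "1 - 3 * y \<le> 1 + \<mu> - y'" using \<gamma> \<tau>' unfolding y'_def y_def by argo+
    have "\<xi> - \<mu> + 2 * \<gamma> + 2 * \<tau>' < 1" using D2 \<xi>y unfolding y'_def by argo
    then have "Phi_minus P n \<epsilon> l b u = u * (1 - y' / (1 + \<mu> - y'))"
      using u0 by (simp add: Phi_minus_def Let_def \<xi>_def \<mu>_def \<gamma>_def \<tau>'_def d_def y'_def algebra_simps)
    then have "u * (1 - y' / (1 + \<mu> - y')) \<le> a" using u by simp
    also have "1 - y' / (1 + \<mu> - y') = (1 + \<mu> - 2 * y') / (1 + \<mu> - y')" using D2 y3 by (simp add: field_simps)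
    finally have "u * ((1 + \<mu> - 2 * y') / (1 + \<mu> - y')) \<le> a" .
    then have "u * (1 + \<mu> - 2 * y') \<le> a * (1 + \<mu> - y')" using D2 y3 by (simp add: field_simps)
    then have "u \<le> a * ((1 + \<mu> - y') / (1 + \<mu> - 2 * y'))" using D2 y3 by (simp add: field_simps)
    also have "(1 + \<mu> - y') / (1 + \<mu> - 2 * y') = 1 + y' / (1 + \<mu> - 2 * y')" using D2 y3 by (simp add: field_simps)
    also have "a * (1 + y' / (1 + \<mu> - 2 * y')) \<le> a * (1 + e)"
      unfolding e_def using D2 y3 y' a by (intro mult_left_mono add_left_mono frac_le) auto
    finally show ?thesis .
  qed
  have "u * (1 + e) \<le> (a * (1 + e)) * (1 + e)" using ua e0 by (intro mult_right_mono) auto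
  then have "t \<le> (a * (1 + e)) * (1 + e)" using tu by linarith
  also have "\<dots> = a * (1 + (2 * e + e\<^sup>2))" by (simp add: power2_eq_square algebra_simps)
  also have "\<dots> \<le> a * (1 + 2 * (x / (1 - 4 * x)))"
  proof (intro mult_left_mono add_left_mono)
    \<comment> \<open>The rate \<open>f = x / (1 - 4 * x)\<close> satisfies
      \<open>f = e' + e' * f\<close> with \<open>f \<ge> e'\<close>, so its surplus over
      \<open>e'\<close> pays for the quadratic term.\<close>
    define e' where "e' = x / (1 - 3 * x)"
    have x0: "x > 0" "1 - 4 * x > 0" "1 - 3 * x > 0" using y x6 by linarith+
    have "e \<le> e'" unfolding e_def e'_def using y x0 by (intro frac_le) auto
    then have "2 * e + e\<^sup>2 \<le> 2 * e' + e'\<^sup>2" using e0 by (intro add_mono power_mono) auto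
    also have "\<dots> \<le> 2 * (x / (1 - 4 * x))"
    proof -
      have e'0: "e' > 0" using x0 by (simp add: e'_def)
      have "1 + x / (1 - 4 * x) = (1 - 3 * x) / (1 - 4 * x)" using x0 by (simp add: field_simps)
      then have "e' * (1 + x / (1 - 4 * x)) = x / (1 - 4 * x)" using x0 by (simp add: e'_def)
      then have "x / (1 - 4 * x) = e' + e' * (x / (1 - 4 * x))" by (simp add: distrib_left)
      moreover have "e' \<le> x / (1 - 4 * x)" unfolding e'_def using x0 by (intro divide_left_mono) auto
      then have "e' * e' \<le> e' * (x / (1 - 4 * x))" using e'0 by (intro mult_left_mono) auto
      moreover have "0 \<le> e' * e'" using e'0 by simp
      ultimately show ?thesis unfolding power2_eq_square by linarith
    qed
    finally show "2 * e + e\<^sup>2 \<le> 2 * (x / (1 - 4 * x))" .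
  qed (use a in simp)
  finally show ?thesis .
qed

subsection \<open>From the net to the sphere\<close>

lemma (in prob_space) prob_INT_ge:
  assumes "finite I" "I \<noteq> {}" "\<And>i. i \<in> I \<Longrightarrow> E i \<in> events" "\<And>i. i \<in> I \<Longrightarrow> prob (E i) \<ge> 1 - \<delta>"
  shows "prob (\<Inter>i\<in>I. E i) \<ge> 1 - real (card I) * \<delta>"
proof -
  have "prob (space M - (\<Inter>i\<in>I. E i)) = prob (\<Union>i\<in>I. space M - E i)"
    by (rule arg_cong[where f = prob]) (use assms(2) in auto)
  also have "\<dots> \<le> (\<Sum>i\<in>I. prob (space M - E i))"
    using assms by (intro finite_measure_subadditive_finite) auto
  also have "\<dots> \<le> (\<Sum>i\<in>I. \<delta>)"
  proof (rule sum_mono)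
    fix i assume "i \<in> I"
    then show "prob (space M - E i) \<le> \<delta>" using assms(3,4)[of i] by (simp add: prob_compl)
  qed
  finally have "prob (space M - (\<Inter>i\<in>I. E i)) \<le> real (card I) * \<delta>" by simp
  moreover have "(\<Inter>i\<in>I. E i) \<in> events" using assms by (intro sets.finite_INT) auto
  ultimately show ?thesis by (simp add: prob_compl)
qed

context quartic_law
begin

lemma trace_nonneg: "0 \<le> trace (gram_matrix P)"
  by (simp add: trace_gram sum_nonneg quad_moment_nonneg)

lemma gram_symmetric: "transpose (gram_matrix P) = gram_matrix P"
  by (simp add: transpose_def gram_matrix_def vec_eq_iff mult.commute)

lemma gram_quadratic_form: "\<theta> \<bullet> (gram_matrix P *v \<theta>) = quad_moment P \<theta>"
proof -
  have prod_int: "integrable P (\<lambda>x. x $ i * x $ j)" for i j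
    using int_inner(1)[of "axis i 1"] int_inner(1)[of "axis j 1"]
    by (intro Cauchy_Schwarz_integral(1)) (auto simp: inner_axis')
  have "\<theta> \<bullet> (gram_matrix P *v \<theta>) = (\<Sum>i\<in>UNIV. \<Sum>j\<in>UNIV. \<theta> $ i * \<theta> $ j * (\<integral>x. x $ i * x $ j \<partial>P))"
    by (simp add: inner_vec_def matrix_vector_mult_def gram_matrix_def sum_distrib_left mult_ac)
  also have "\<dots> = (\<integral>x. (\<Sum>i\<in>UNIV. \<Sum>j\<in>UNIV. \<theta> $ i * \<theta> $ j * (x $ i * x $ j)) \<partial>P)"
    using prod_int by simp
  also have "\<dots> = quad_moment P \<theta>"
    unfolding quad_moment_def
    by (intro Bochner_Integration.integral_cong refl)
       (simp add: inner_vec_def power2_eq_square sum_product mult_ac)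
  finally show ?thesis .
qed

text \<open>The bound is divided by \<open>n\<close> and expanded around \<open>N = l\<close>: the
  quadratic term yields \<open>\<xi>\<close>, the linear one \<open>\<mu>\<close>, the constant one
  \<open>\<gamma>\<close>. Here the constants 34 and 65 are absorbed by those of the grid. The sign
  \<open>s = - 1\<close> gives the lower bound because \<open>psi\<close> is odd.\<close>

lemma emp_boundsI:
  assumes n: "n \<ge> 1" and l: "l > 0" and b: "b > 0"
    and dev: "\<And>\<theta> s. s = 1 \<or> s = - 1 \<Longrightarrow> (\<Sum>i = 1..n. psi (s * ((\<theta> \<bullet> x i)\<^sup>2 - l)))
        \<le> deviation_bound P n l b s \<theta> + ln (real (card (Lambda_grid P n \<epsilon>)) / \<epsilon>)"
  shows "emp_bounds P n \<epsilon> x l b"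
  unfolding emp_bounds_def Let_def
proof (rule allI)
  fix \<theta>
  define N where "N = quad_moment P \<theta>"
  have N: "N \<ge> 0" by (simp add: N_def quad_moment_nonneg)
  define \<kappa> S q where "\<kappa> = kappa P" and "S = (s4 P)\<^sup>2" and "q = (norm \<theta>)\<^sup>2"
  define Lc where "Lc = ln (real (card (Lambda_grid P n \<epsilon>)) / \<epsilon>)"
  define R where "R = (\<kappa> * N\<^sup>2 - 2 * l * N + l\<^sup>2) / 2 + 34 * sqrt \<kappa> * S * N / b + 65 * s4 P ^ 4 / b\<^sup>2 + (b * q / 2 + Lc) / real n"
  have n0: "real n > 0" using n by simp
  have c: "43 \<le> c_const" using c_const_bounds by simp
  have dev': "(\<Sum>i = 1..n. psi (s * ((\<theta> \<bullet> x i)\<^sup>2 - l))) / real n \<le> s * (N - l) + R" if "s = 1 \<or> s = - 1" for s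
  proof -
    have "(\<Sum>i = 1..n. psi (s * ((\<theta> \<bullet> x i)\<^sup>2 - l))) \<le> real n * (s * (N - l) + R)"
    proof -
      have "real n * (a + (r1 + r2 + r3 + (z1 + z2) / real n)) = real n * (a + r1 + r2 + r3) + z1 + z2"
        for a r1 r2 r3 z1 z2 :: real using n0 by (simp add: field_simps)
      then show ?thesis
        using dev[OF that, of \<theta>] unfolding deviation_bound_def R_def N_def \<kappa>_def S_def q_def Lc_def by (simp only:)
    qed
    then show ?thesis using n0 by (simp add: divide_le_eq mult.commute)
  qed
  define w where "w = (2 + c_const) * sqrt \<kappa> * S / b"
  define h where "h = (2 + 3 * c_const) * s4 P ^ 4 / (2 * b\<^sup>2)"
  have w: "34 * sqrt \<kappa> * S * N / b \<le> w * N"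
  proof -
    have "34 * (sqrt \<kappa> * S / b * N) \<le> (2 + c_const) * (sqrt \<kappa> * S / b * N)"
      using c N b kappa_pos by (intro mult_right_mono) (auto simp: \<kappa>_def S_def)
    then show ?thesis by (simp add: w_def mult_ac)
  qed
  have h: "65 * s4 P ^ 4 / b\<^sup>2 \<le> h"
  proof -
    have "65 * (s4 P ^ 4 / b\<^sup>2) \<le> (2 + 3 * c_const) / 2 * (s4 P ^ 4 / b\<^sup>2)"
      using c by (intro mult_right_mono) auto
    then show ?thesis by (simp add: h_def mult_ac)
  qed
  have R_le: "R \<le> l * (xi_coef P l * (N / l - 1)\<^sup>2 + mu_coef P l b * (N / l - 1) + gamma_coef P n \<epsilon> l b + delta_coef n l b * q)"
  proof -
    define r where "r = N / l - 1"
    have r: "l * r = N - l" using l by (simp add: r_def field_simps)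
    have "l * (xi_coef P l * r\<^sup>2) = \<kappa> * (N - l)\<^sup>2 / 2"
      unfolding r[symmetric] by (simp add: xi_coef_def \<kappa>_def power2_eq_square mult_ac)
    moreover have "l * (mu_coef P l b * r) = (l * (\<kappa> - 1) + w) * (N - l)"
      unfolding r[symmetric] by (simp add: mu_coef_def \<kappa>_def w_def S_def mult_ac)
    moreover have "l * gamma_coef P n \<epsilon> l b = l\<^sup>2 * (\<kappa> - 1) / 2 + l * w + h + Lc / real n"
    proof -
      have "l * gamma_coef P n \<epsilon> l b = l * (l / 2 * (\<kappa> - 1)) + l * w
          + l * ((2 + 3 * c_const) * s4 P ^ 4 / (2 * b\<^sup>2 * l)) + l * (Lc / (real n * l))"
        by (simp only: gamma_coef_def \<kappa>_def w_def S_def Lc_def distrib_left)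
      then show ?thesis using l by (simp add: h_def power2_eq_square)
    qed
    moreover have "l * (delta_coef n l b * q) = b * q / 2 / real n" using l by (simp add: delta_coef_def)
    moreover have "\<kappa> * (N - l)\<^sup>2 / 2 + (l * (\<kappa> - 1) + w) * (N - l) + (l\<^sup>2 * (\<kappa> - 1) / 2 + l * w)
        = (\<kappa> * N\<^sup>2 - 2 * l * N + l\<^sup>2) / 2 + w * N"
      by (simp add: power2_eq_square field_simps)
    ultimately have "l * (xi_coef P l * r\<^sup>2 + mu_coef P l b * r + gamma_coef P n \<epsilon> l b + delta_coef n l b * q)
        = (\<kappa> * N\<^sup>2 - 2 * l * N + l\<^sup>2) / 2 + w * N + h + (b * q / 2 + Lc) / real n"
      by (simp only: distrib_left add_divide_distrib)
    then show ?thesis using w h unfolding R_def r_def[symmetric] by linarith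
  qed
  have Nl: "l * (N / l - 1) = N - l" using l by (simp add: field_simps)
  have up: "r_emp n x l \<theta> \<le> (N - l) + R" using dev'[of 1] by (simp add: r_emp_def)
  have "(\<Sum>i = 1..n. psi (- 1 * ((\<theta> \<bullet> x i)\<^sup>2 - l))) = - (\<Sum>i = 1..n. psi ((\<theta> \<bullet> x i)\<^sup>2 - l))"
    unfolding sum_negf[symmetric] by (intro sum.cong refl) (simp only: mult_minus1 psi_minus)
  then have low: "(N - l) - R \<le> r_emp n x l \<theta>" using dev'[of "- 1"] by (simp add: r_emp_def)
  define A where "A = xi_coef P l * (N / l - 1)\<^sup>2 + mu_coef P l b * (N / l - 1) + gamma_coef P n \<epsilon> l b + delta_coef n l b * q"
  have "xi_coef P l * (N / l - 1)\<^sup>2 + (1 + mu_coef P l b) * (N / l - 1) + gamma_coef P n \<epsilon> l b + delta_coef n l b * q = A + (N / l - 1)"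
    "- xi_coef P l * (N / l - 1)\<^sup>2 + (1 - mu_coef P l b) * (N / l - 1) - gamma_coef P n \<epsilon> l b - delta_coef n l b * q = (N / l - 1) - A"
    by (simp_all add: A_def algebra_simps)
  then show "r_emp n x l \<theta> \<le> l * (xi_coef P l * (quad_moment P \<theta> / l - 1)\<^sup>2 + (1 + mu_coef P l b) * (quad_moment P \<theta> / l - 1) + gamma_coef P n \<epsilon> l b + delta_coef n l b * (norm \<theta>)\<^sup>2) \<and>
     l * (- xi_coef P l * (quad_moment P \<theta> / l - 1)\<^sup>2 + (1 - mu_coef P l b) * (quad_moment P \<theta> / l - 1) - gamma_coef P n \<epsilon> l b - delta_coef n l b * (norm \<theta>)\<^sup>2) \<le> r_emp n x l \<theta>"
    using up low R_le Nl unfolding N_def[symmetric] q_def[symmetric] A_def[symmetric]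
    by (simp only: distrib_left right_diff_distrib) linarith
qed

text \<open>A union bound over both signs and all grid pairs, each at level
  \<open>\<epsilon> / card \<Lambda>\<close>, produces the total \<open>2 * \<epsilon>\<close> and
  the logarithm in \<open>gamma_coef\<close>.\<close>

lemma emp_bounds_event:
  fixes M :: "'w measure" and X :: "nat \<Rightarrow> 'w \<Rightarrow> real ^ 'd"
  assumes M: "prob_space M" and indep: "prob_space.indep_vars M (\<lambda>_. borel) X {1..n}"
    and law: "\<And>i. i \<in> {1..n} \<Longrightarrow> distr M borel (X i) = P"
    and n: "n \<ge> 1" and K: "grid_size P n \<ge> 1" and \<epsilon>: "0 < \<epsilon>" "\<epsilon> < 1" and s4: "s4 P > 0"
  shows "\<exists>E \<in> sets M. measure M E \<ge> 1 - 2 * \<epsilon> \<and> (\<forall>\<omega>\<in>E. \<forall>(l, b)\<in>Lambda_grid P n \<epsilon>.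
      emp_bounds P n \<epsilon> (\<lambda>i\<in>{1..n}. X i \<omega>) l b)"
proof -
  interpret M: prob_space M by (rule M)
  define \<Lambda> where "\<Lambda> = Lambda_grid P n \<epsilon>"
  have fin: "finite \<Lambda>" and c1: "card \<Lambda> \<ge> 1"
    using finite_Lambda_grid card_Lambda_grid_pos[OF K] by (auto simp: \<Lambda>_def)
  define \<epsilon>' where "\<epsilon>' = \<epsilon> / real (card \<Lambda>)"
  have \<epsilon>': "\<epsilon>' > 0" "1 / \<epsilon>' = real (card \<Lambda>) / \<epsilon>" using \<epsilon> c1 by (auto simp: \<epsilon>'_def)
  define I where "I = \<Lambda> \<times> {1, - 1 :: real}"
  define good where "good E l b s \<longleftrightarrow> E \<in> sets M \<and> measure M E \<ge> 1 - \<epsilon>' \<and> (\<forall>\<omega>\<in>E. \<forall>\<theta>.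
      (\<Sum>i = 1..n. psi (s * ((\<theta> \<bullet> X i \<omega>)\<^sup>2 - l)))
        \<le> deviation_bound P n l b s \<theta> + ln (1 / \<epsilon>'))" for E l b s
  have "\<forall>p\<in>I. \<exists>E. good E (fst (fst p)) (snd (fst p)) (snd p)"
  proof
    fix p assume "p \<in> I"
    then have p: "(fst (fst p), snd (fst p)) \<in> Lambda_grid P n \<epsilon>" "(snd p)\<^sup>2 = 1" by (auto simp: I_def \<Lambda>_def)
    show "\<exists>E. good E (fst (fst p)) (snd (fst p)) (snd p)"
      using deviation[OF M indep law \<epsilon>'(1) grid_positive(2)[OF n K \<epsilon> s4 p(1)] p(2), of "fst (fst p)"]
      unfolding good_def by blast
  qed
  then obtain E where E: "\<And>p. p \<in> I \<Longrightarrow> good (E p) (fst (fst p)) (snd (fst p)) (snd p)" by metis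
  have I: "finite I" "I \<noteq> {}" "card I = 2 * card \<Lambda>"
    using fin c1 by (auto simp: I_def card_cartesian_product)
  show ?thesis
  proof (intro bexI[of _ "\<Inter>p\<in>I. E p"] conjI ballI)
    have "1 - real (card I) * \<epsilon>' \<le> measure M (\<Inter>p\<in>I. E p)"
      using I E unfolding good_def by (intro M.prob_INT_ge) auto
    moreover have "real (card I) * \<epsilon>' = 2 * \<epsilon>" using c1 by (simp add: I(3) \<epsilon>'_def)
    ultimately show "1 - 2 * \<epsilon> \<le> measure M (\<Inter>p\<in>I. E p)" by simp
    show "(\<Inter>p\<in>I. E p) \<in> sets M" using I E unfolding good_def by (intro sets.finite_INT) auto
    fix \<omega> lb assume \<omega>: "\<omega> \<in> (\<Inter>p\<in>I. E p)" and lb': "lb \<in> Lambda_grid P n \<epsilon>"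
    obtain l b where lb_eq: "lb = (l, b)" by (cases lb)
    then have lb: "(l, b) \<in> Lambda_grid P n \<epsilon>" using lb' by simp
    have "emp_bounds P n \<epsilon> (\<lambda>i\<in>{1..n}. X i \<omega>) l b"
    proof (rule emp_boundsI[OF n grid_positive[OF n K \<epsilon> s4 lb]])
      fix \<theta> and s :: real assume "s = 1 \<or> s = - 1"
      then have p: "((l, b), s) \<in> I" using lb by (auto simp: I_def \<Lambda>_def)
      have "(\<Sum>i = 1..n. psi (s * ((\<theta> \<bullet> (\<lambda>i\<in>{1..n}. X i \<omega>) i)\<^sup>2 - l))) = (\<Sum>i = 1..n. psi (s * ((\<theta> \<bullet> X i \<omega>)\<^sup>2 - l)))"
        by (intro sum.cong) auto
      then show "(\<Sum>i = 1..n. psi (s * ((\<theta> \<bullet> (\<lambda>i\<in>{1..n}. X i \<omega>) i)\<^sup>2 - l)))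
        \<le> deviation_bound P n l b s \<theta> + ln (real (card (Lambda_grid P n \<epsilon>)) / \<epsilon>)"
        using E[OF p] \<omega> p unfolding good_def \<epsilon>'(2) \<Lambda>_def by auto
    qed
    then show "case lb of (l, b) \<Rightarrow> emp_bounds P n \<epsilon> (\<lambda>i\<in>{1..n}. X i \<omega>) l b"
      by (simp add: lb_eq)
  qed
qed

end

section \<open>Monotonicity and slope of the error bound\<close>

lemma relative_error_mono:
  fixes s s' x x' :: real
  assumes s: "0 < s" "s \<le> s'" and x: "0 \<le> x'" "x' \<le> x" "x \<le> 1 / 8" and sx: "sqrt s * x \<le> sqrt s' * x'"
  shows "s * (x / (1 - 4 * x)) \<le> s' * (x' / (1 - 4 * x'))"
proof -
  \<comment> \<open>With this ratio the hypothesis reads \<open>y * x \<le> x'\<close>, and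
    \<open>s * x\<close> factors as \<open>(y * x) * (y * s')\<close>. The second factor is handled
    by \<open>4 * x * (1 + y) \<le> 1\<close>, which is where \<open>x \<le> 1 / 8\<close>
    enters.\<close>
  define y where "y = sqrt (s / s')"
  have y: "0 < y" "y \<le> 1" "s = y\<^sup>2 * s'" using s by (auto simp: y_def)
  have "y * x \<le> x'" using sx s by (simp add: y_def real_sqrt_divide field_simps)
  have "s * x = (y * x) * (y * s')" using y by (simp add: power2_eq_square)
  also have "\<dots> \<le> (y * x) * (s' * (1 - 4 * x) + 4 * s * x)"
  proof (rule mult_left_mono)
    have "0 \<le> (1 - y) * (1 - 4 * x * (1 + y))"
    proof (rule mult_nonneg_nonneg)
      have "x * (1 + y) \<le> 1 / 8 * 2" using x y by (intro mult_mono) auto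
      then show "0 \<le> 1 - 4 * x * (1 + y)" by simp
    qed (use y in simp)
    then have "0 \<le> s' * ((1 - y) * (1 - 4 * x * (1 + y)))" using s by simp
    also have "\<dots> = s' * (1 - 4 * x) + 4 * s * x - y * s'" unfolding y(3) by (simp add: power2_eq_square algebra_simps)
    finally show "y * s' \<le> s' * (1 - 4 * x) + 4 * s * x" by simp
  qed (use x y in simp)
  also have "\<dots> \<le> x' * (s' * (1 - 4 * x) + 4 * s * x)"
    using \<open>y * x \<le> x'\<close> s x by (intro mult_right_mono add_nonneg_nonneg mult_nonneg_nonneg) auto
  finally have "s * x * (1 - 4 * x') \<le> s' * x' * (1 - 4 * x)" by (simp add: algebra_simps)
  moreover have "0 < 1 - 4 * x" "0 < 1 - 4 * x'" using x by linarith+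
  ultimately show ?thesis by (simp add: field_simps)
qed

definition error_rate :: "(real ^ 'd) measure \<Rightarrow> nat \<Rightarrow> real \<Rightarrow> real \<Rightarrow> real" where
  "error_rate P n \<epsilon> s =
     (zeta_star P n \<epsilon> s / sqrt (real n)) / (1 - 4 * (zeta_star P n \<epsilon> s / sqrt (real n)))"

text \<open>The truncation at \<open>(s4 P)\<^sup>2\<close> serves both final inequalities: it is
  the one imposed on the estimator, and it leaves the moment of a unit vector unchanged.\<close>

definition error_bound :: "(real ^ 'd) measure \<Rightarrow> nat \<Rightarrow> real \<Rightarrow> real \<Rightarrow> real \<Rightarrow> real" where
  "error_bound P n \<epsilon> \<sigma> t = max t \<sigma> * error_rate P n \<epsilon> (max (min t ((s4 P)\<^sup>2)) \<sigma>)"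

locale grid_setup = quartic_law P for P :: "(real ^ 'd) measure" +
  fixes n :: nat and \<epsilon> \<sigma> :: real
  assumes n: "n \<ge> 1" and K: "grid_size P n \<ge> 1" and \<epsilon>: "0 < \<epsilon>" "\<epsilon> < 1"
    and \<sigma>: "0 < \<sigma>" "\<sigma> \<le> (s4 P)\<^sup>2" and zeta_small: "8 * zeta_star P n \<epsilon> \<sigma> \<le> sqrt (real n)"
begin

lemma n0: "sqrt (real n) > 0"
  using n by simp

lemma s4_pos: "s4 P > 0"
proof -
  have "s4 P \<noteq> 0" using \<sigma> by auto
  then show ?thesis using s4_nonneg by simp
qed

lemma log_nonneg: "0 \<le> ln (real_of_int (grid_size P n)) + ln (inverse \<epsilon>)"
proof -
  have "1 \<le> real_of_int (grid_size P n)" using K by simp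
  moreover have "1 \<le> inverse \<epsilon>" using \<epsilon> by (simp add: one_le_inverse)
  ultimately show ?thesis by (intro add_nonneg_nonneg) auto
qed

lemma zeta_nonneg: "0 < s \<Longrightarrow> 0 \<le> zeta_star P n \<epsilon> s"
  unfolding zeta_star_def add.assoc using kappa_pos trace_nonneg log_nonneg by simp

lemma zeta_antimono:
  assumes "0 < s" "s \<le> s'"
  shows "zeta_star P n \<epsilon> s' \<le> zeta_star P n \<epsilon> s"
proof -
  have "0.73 * trace (gram_matrix P) / s' \<le> 0.73 * trace (gram_matrix P) / s"
    "98.5 * kappa P * trace (gram_matrix P) / s' \<le> 98.5 * kappa P * trace (gram_matrix P) / s"
    using assms trace_nonneg kappa_pos by (intro divide_left_mono; simp)+
  then show ?thesis unfolding zeta_star_def using kappa_pos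
    by (intro add_mono real_sqrt_le_mono mult_left_mono) auto
qed

text \<open>Moved under the roots, the factor \<open>s\<close> cancels the denominators and
  multiplies the nonnegative logarithms. Thus the rate decreases with \<open>s\<close> while the
  absolute error increases.\<close>

lemma sqrt_zeta_mono:
  assumes "0 < s" "s \<le> s'"
  shows "sqrt s * zeta_star P n \<epsilon> s \<le> sqrt s' * zeta_star P n \<epsilon> s'"
proof -
  have eq: "sqrt s * zeta_star P n \<epsilon> s = sqrt (2.032 * (kappa P - 1) * (0.73 * trace (gram_matrix P)
      + s * (ln (real_of_int (grid_size P n)) + ln (inverse \<epsilon>)))) + sqrt (98.5 * kappa P * trace (gram_matrix P))" if "0 < s" for s
  proof -
    have "s * (2.032 * (kappa P - 1) * (0.73 * trace (gram_matrix P) / s + ln (real_of_int (grid_size P n)) + ln (inverse \<epsilon>)))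
        = 2.032 * (kappa P - 1) * (s * (0.73 * trace (gram_matrix P) / s) + s * (ln (real_of_int (grid_size P n)) + ln (inverse \<epsilon>)))"
    proof -
      have "s * (A * k * (T + L1 + L2)) = A * k * (s * T + s * (L1 + L2))" for A k T L1 L2 :: real
        by (simp add: algebra_simps)
      then show ?thesis .
    qed
    then show ?thesis unfolding zeta_star_def distrib_left real_sqrt_mult[symmetric] using that by simp
  qed
  have "s * (ln (real_of_int (grid_size P n)) + ln (inverse \<epsilon>)) \<le> s' * (ln (real_of_int (grid_size P n)) + ln (inverse \<epsilon>))"
    using assms log_nonneg by (intro mult_right_mono) auto
  then show ?thesis using assms kappa_pos unfolding eq[OF assms(1)] eq[OF less_le_trans[OF assms]]
    by (intro add_mono real_sqrt_le_mono mult_left_mono) auto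
qed

lemma zeta_le: "\<sigma> \<le> s \<Longrightarrow> zeta_star P n \<epsilon> s / sqrt (real n) \<le> 1 / 8"
  using zeta_antimono[of \<sigma> s] \<sigma> zeta_small n0 by (simp add: divide_le_eq)

lemma error_rate_bounds:
  assumes "\<sigma> \<le> s"
  shows "0 \<le> error_rate P n \<epsilon> s" "error_rate P n \<epsilon> s \<le> 1 / 4"
proof -
  define x where "x = zeta_star P n \<epsilon> s / sqrt (real n)"
  have x: "0 \<le> x" "x \<le> 1 / 8" using zeta_le[OF assms] zeta_nonneg[of s] n0 assms \<sigma> by (auto simp: x_def)
  show "0 \<le> error_rate P n \<epsilon> s" unfolding error_rate_def x_def[symmetric] using x by simp
  show "error_rate P n \<epsilon> s \<le> 1 / 4" unfolding error_rate_def x_def[symmetric] using x by (simp add: divide_le_eq)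
qed

lemma error_rate_antimono:
  assumes "\<sigma> \<le> s" "s \<le> s'"
  shows "error_rate P n \<epsilon> s' \<le> error_rate P n \<epsilon> s"
proof -
  define x x' where "x = zeta_star P n \<epsilon> s / sqrt (real n)" and "x' = zeta_star P n \<epsilon> s' / sqrt (real n)"
  have "0 \<le> x'" "x' \<le> x" "x \<le> 1 / 8"
    using zeta_le[OF assms(1)] zeta_nonneg[of s'] zeta_antimono[of s s'] n0 assms \<sigma>
    by (auto simp: x_def x'_def divide_right_mono)
  then show ?thesis unfolding error_rate_def x_def[symmetric] x'_def[symmetric] by (intro frac_le) auto
qed

lemma times_error_rate_mono:
  assumes "\<sigma> \<le> s" "s \<le> s'"
  shows "s * error_rate P n \<epsilon> s \<le> s' * error_rate P n \<epsilon> s'"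
  unfolding error_rate_def
proof (rule relative_error_mono)
  show "sqrt s * (zeta_star P n \<epsilon> s / sqrt (real n)) \<le> sqrt s' * (zeta_star P n \<epsilon> s' / sqrt (real n))"
    using sqrt_zeta_mono[of s s'] assms \<sigma> n0 by (simp add: divide_right_mono)
qed (use assms \<sigma> zeta_nonneg[of s'] zeta_antimono[of s s'] zeta_le[OF assms(1)] n0 in \<open>auto intro: divide_right_mono\<close>)

lemma error_bound_alt:
  "error_bound P n \<epsilon> \<sigma> t = max t \<sigma> * error_rate P n \<epsilon> (min (max t \<sigma>) ((s4 P)\<^sup>2))"
  unfolding error_bound_def using \<sigma> by (auto simp: min_def max_def)

lemma error_bound_mono:
  assumes "t \<le> t'"
  shows "error_bound P n \<epsilon> \<sigma> t \<le> error_bound P n \<epsilon> \<sigma> t'"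
proof -
  define m m' S where "m = max t \<sigma>" and "m' = max t' \<sigma>" and "S = (s4 P)\<^sup>2"
  have m: "\<sigma> \<le> m" "m \<le> m'" "\<sigma> \<le> S" using assms \<sigma> by (auto simp: m_def m'_def S_def)
  have "m * error_rate P n \<epsilon> (min m S) \<le> m' * error_rate P n \<epsilon> (min m' S)"
  proof -
    consider "m' \<le> S" | "m \<le> S" "S \<le> m'" | "S \<le> m" by linarith
    then show ?thesis
    proof cases
      case 1
      then show ?thesis using m times_error_rate_mono[of m m'] by simp
    next
      case 2
      have "m * error_rate P n \<epsilon> m \<le> S * error_rate P n \<epsilon> S" using 2 m by (intro times_error_rate_mono) auto
      also have "\<dots> \<le> m' * error_rate P n \<epsilon> S" using 2 m error_rate_bounds by (intro mult_right_mono) auto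
      finally show ?thesis using 2 by simp
    next
      case 3
      then show ?thesis using m error_rate_bounds[of S] by (simp add: mult_right_mono)
    qed
  qed
  then show ?thesis by (simp add: error_bound_alt m_def m'_def S_def)
qed

text \<open>The rate is antitone, so growth comes from the prefactor alone, with a rate at most
  \<open>(1 / 8) / (1 - 4 / 8) = 1 / 4\<close>.\<close>

lemma error_bound_lipschitz:
  assumes "t \<le> t'"
  shows "error_bound P n \<epsilon> \<sigma> t' \<le> error_bound P n \<epsilon> \<sigma> t + (t' - t) / 4"
proof -
  define m m' S where "m = max t \<sigma>" and "m' = max t' \<sigma>" and "S = (s4 P)\<^sup>2"
  have m: "\<sigma> \<le> m" "m \<le> m'" "\<sigma> \<le> S" "m' - m \<le> t' - t" using assms \<sigma> by (auto simp: m_def m'_def S_def)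
  have "m' * error_rate P n \<epsilon> (min m' S) \<le> m' * error_rate P n \<epsilon> (min m S)"
    using m \<sigma> by (intro mult_left_mono error_rate_antimono) auto
  also have "\<dots> = m * error_rate P n \<epsilon> (min m S) + (m' - m) * error_rate P n \<epsilon> (min m S)" by (simp add: algebra_simps)
  also have "(m' - m) * error_rate P n \<epsilon> (min m S) \<le> (t' - t) * (1 / 4)"
    using m error_rate_bounds[of "min m S"] by (intro mult_mono) auto
  finally show ?thesis by (simp add: error_bound_alt m_def m'_def S_def)
qed

text \<open>As \<open>kappa P - 1 \<ge> 1 / 2\<close>, the constant in front is at most
  \<open>6 + 2 = 8\<close>; hence the infinite branch of \<open>B_star\<close> never occurs
  here.\<close>

lemma zeta_condition:
  assumes "\<sigma> \<le> s"
  shows "(6 + inverse (kappa P - 1)) * zeta_star P n \<epsilon> s \<le> sqrt (real n)"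
proof -
  have "inverse (kappa P - 1) \<le> inverse (1 / 2)" using kappa_ge by (intro le_imp_inverse_le) auto
  then have "(6 + inverse (kappa P - 1)) * zeta_star P n \<epsilon> s \<le> 8 * zeta_star P n \<epsilon> s"
    using zeta_nonneg[of s] assms \<sigma> by (intro mult_right_mono) auto
  also have "\<dots> \<le> 8 * zeta_star P n \<epsilon> \<sigma>" using zeta_antimono[of \<sigma> s] assms \<sigma> by simp
  finally show ?thesis using zeta_small by simp
qed

lemma B_star_eq: "B_star P n \<epsilon> \<sigma> t = ereal (error_rate P n \<epsilon> (max t \<sigma>))"
  using zeta_condition[of "max t \<sigma>"] by (simp add: B_star_def error_rate_def Let_def)

section \<open>Confidence interval and error at one direction\<close>

lemma moment_in_bounds:
  assumes eb: "\<forall>(l, b)\<in>Lambda_grid P n \<epsilon>. emp_bounds P n \<epsilon> x l b"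
    and \<theta>: "norm \<theta> = 1"
  shows "B_minus P n \<epsilon> x \<theta> \<le> quad_moment P \<theta>" "ereal (quad_moment P \<theta>) \<le> B_plus P n \<epsilon> x \<theta>"
    "0 \<le> B_minus P n \<epsilon> x \<theta>"
proof -
  define N where "N = quad_moment P \<theta>"
  define \<Lambda> where "\<Lambda> = Lambda_grid P n \<epsilon>"
  have fin: "finite \<Lambda>" and ne: "\<Lambda> \<noteq> {}"
    using finite_Lambda_grid card_Lambda_grid_pos[OF K, of \<epsilon>] by (auto simp: \<Lambda>_def)
  define m p where "m = (\<lambda>(l, b). Phi_minus P n \<epsilon> l b (N_tilde n x l \<theta>))"
    and "p = (\<lambda>(l, b). Phi_plus_inv P n \<epsilon> l b (N_tilde n x l \<theta>))"
  have Bm: "B_minus P n \<epsilon> x \<theta> = Max (m ` \<Lambda>)" and Bp: "B_plus P n \<epsilon> x \<theta> = Min (p ` \<Lambda>)"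
    by (simp_all add: B_minus_def B_plus_def \<Lambda>_def m_def p_def)
  have minus: "m lb \<le> N" and plus: "ereal N \<le> p lb" and m0: "0 \<le> m lb" if "lb \<in> \<Lambda>" for lb
  proof -
    obtain l b where lb_eq: "lb = (l, b)" by (cases lb)
    then have lb: "(l, b) \<in> Lambda_grid P n \<epsilon>" using that by (simp add: \<Lambda>_def)
    have pos: "l > 0" using grid_positive[OF n K \<epsilon> s4_pos lb] by simp
    note c = coef_bounds[OF n K \<epsilon> s4_pos lb]
    have e: "emp_bounds P n \<epsilon> x l b"
      using eb lb by auto
    show "m lb \<le> N"
      using Phi_minus_N_tilde_le[OF n pos e \<theta> c(1) c(4) c(6)]
      by (simp add: m_def lb_eq N_def)
    have "Phi_plus P n \<epsilon> l b N \<le> N_tilde n x l \<theta>"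
      using Phi_plus_le_N_tilde[OF n pos e \<theta> c(1) c(4) c(6)] by (simp add: N_def)
    then show "ereal N \<le> p lb" unfolding p_def lb_eq Phi_plus_inv_def
      using quad_moment_nonneg by (auto intro!: Sup_upper simp: N_def)
    show "0 \<le> m lb" using Phi_minus_nonneg[OF c(1) c(4) c(6) pos] by (simp add: m_def lb_eq)
  qed
  have N1: "B_minus P n \<epsilon> x \<theta> \<le> N" unfolding Bm using fin ne minus by simp
  have N2: "ereal N \<le> B_plus P n \<epsilon> x \<theta>" unfolding Bp using fin ne plus by simp
  show "B_minus P n \<epsilon> x \<theta> \<le> quad_moment P \<theta>" "ereal (quad_moment P \<theta>) \<le> B_plus P n \<epsilon> x \<theta>"
    using N1 N2 by (simp_all add: N_def)
  obtain lb0 where "lb0 \<in> \<Lambda>" using ne by auto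
  then have "0 \<le> m lb0" "m lb0 \<le> B_minus P n \<epsilon> x \<theta>" unfolding Bm using m0 fin by auto
  then show "0 \<le> B_minus P n \<epsilon> x \<theta>" by simp
qed

lemma net_point_bound:
  assumes eb: "\<forall>(l, b)\<in>Lambda_grid P n \<epsilon>. emp_bounds P n \<epsilon> x l b"
    and \<theta>: "norm \<theta> = 1" and q: "B_minus P n \<epsilon> x \<theta> \<le> q" "ereal q \<le> B_plus P n \<epsilon> x \<theta>"
  shows "\<bar>max q \<sigma> - max (quad_moment P \<theta>) \<sigma>\<bar> \<le> 2 * error_bound P n \<epsilon> \<sigma> q"
    "\<bar>max q \<sigma> - max (quad_moment P \<theta>) \<sigma>\<bar> \<le> 2 * error_bound P n \<epsilon> \<sigma> (quad_moment P \<theta>)"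
proof -
  define N where "N = quad_moment P \<theta>"
  have NS: "N \<le> (s4 P)\<^sup>2" using quad_moment_le[OF \<theta>] by (simp add: N_def)
  note N1 = moment_in_bounds(1)[OF eb \<theta>, folded N_def] and N2 = moment_in_bounds(2)[OF eb \<theta>, folded N_def]
  define p where "p = (\<lambda>(l, b). Phi_plus_inv P n \<epsilon> l b (N_tilde n x l \<theta>))"
  \<comment> \<open>Applied with \<open>a\<close> the smaller of \<open>q\<close> and the true
    moment. That minimum is at most \<open>(s4 P)\<^sup>2\<close>, as the choice of a grid point
    requires, while the larger value may exceed it. Truncating at \<open>\<sigma>\<close> keeps the
    scale in the range where \<open>zeta_star\<close> is small.\<close>
  have width: "max t \<sigma> - max a \<sigma> \<le> 2 * error_bound P n \<epsilon> \<sigma> a"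
    if a: "B_minus P n \<epsilon> x \<theta> \<le> a" "a \<le> (s4 P)\<^sup>2" and t: "ereal t \<le> B_plus P n \<epsilon> x \<theta>" for a t
  proof -
    define a' where "a' = max a \<sigma>"
    have a': "0 < a'" "\<sigma> \<le> a'" "a' \<le> (s4 P)\<^sup>2" using a \<sigma> by (auto simp: a'_def)
    define z where "z = zeta_star P n \<epsilon> a' / sqrt (real n)"
    have "8 * zeta_star P n \<epsilon> a' \<le> sqrt (real n)" using zeta_antimono[of \<sigma> a'] \<sigma> a' zeta_small by linarith
    from exists_grid_point[OF n K \<epsilon> a'(1,3) this] obtain l b where lb: "(l, b) \<in> Lambda_grid P n \<epsilon>"
      and g: "gamma_coef P n \<epsilon> l b + b / (2 * real n * a') \<le> z" by (auto simp: z_def)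
    have pos: "l > 0" using grid_positive[OF n K \<epsilon> s4_pos lb] by simp
    have dl: "delta_coef n l b * l / a' = b / (2 * real n * a')" using pos by (simp add: delta_coef_def)
    have z6: "(6 + inverse (kappa P - 1)) * z \<le> 1"
      using zeta_condition[OF a'(2)] n0 by (simp add: z_def divide_le_eq)
    have "(\<lambda>(l, b). Phi_minus P n \<epsilon> l b (N_tilde n x l \<theta>)) (l, b) \<le> B_minus P n \<epsilon> x \<theta>"
      unfolding B_minus_def using finite_Lambda_grid lb by (intro Max_ge finite_imageI imageI)
    then have u: "Phi_minus P n \<epsilon> l b (N_tilde n x l \<theta>) \<le> a'" using a(1) by (simp add: a'_def)
    define U where "U = a' * (1 + 2 * (z / (1 - 4 * z)))"
    have "p (l, b) \<le> ereal U"
      unfolding p_def Phi_plus_inv_def prod.case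
    proof (rule Sup_least)
      fix y assume "y \<in> ereal ` {t. 0 \<le> t \<and> Phi_plus P n \<epsilon> l b t \<le> N_tilde n x l \<theta>}"
      then obtain t' where t': "y = ereal t'" "Phi_plus P n \<epsilon> l b t' \<le> N_tilde n x l \<theta>" by auto
      have "t' \<le> U" unfolding U_def
        using coef_bounds[OF n K \<epsilon> s4_pos lb] pos kappa_pos a' g z6 t'(2) u
        by (intro Phi_width[where k = "inverse (kappa P - 1)" and u = "N_tilde n x l \<theta>" and P = P and n = n and l = l and b = b and \<epsilon> = \<epsilon>])
           (auto simp: dl)
      then show "y \<le> ereal U" by (simp add: t')
    qed
    moreover have "B_plus P n \<epsilon> x \<theta> \<le> p (l, b)" 
      unfolding B_plus_def p_def using finite_Lambda_grid lb by (intro Min_le finite_imageI imageI)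
    ultimately have "ereal t \<le> ereal U" using t by (meson order_trans)
    then have tU: "t \<le> U" by simp
    have rate: "z / (1 - 4 * z) = error_rate P n \<epsilon> a'" by (simp add: z_def error_rate_def)
    have "0 \<le> a' * error_rate P n \<epsilon> a'" using error_rate_bounds[OF a'(2)] a' by simp
    moreover have "error_bound P n \<epsilon> \<sigma> a = a' * error_rate P n \<epsilon> a'"
      using a(2) by (simp add: error_bound_def a'_def min_def)
    moreover have "U = a' + 2 * (a' * error_rate P n \<epsilon> a')" unfolding U_def rate by (simp add: algebra_simps)
    ultimately show ?thesis using tU a' unfolding a'_def[symmetric] by linarith
  qed
  have "\<bar>max q \<sigma> - max N \<sigma>\<bar> \<le> 2 * error_bound P n \<epsilon> \<sigma> (min q N)"
  proof (cases "q \<le> N")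
    case True
    then have "max q \<sigma> \<le> max N \<sigma>" by auto
    then show ?thesis using width[OF q(1) _ N2] NS True by (simp add: min_absorb1)
  next
    case False
    then have "max N \<sigma> \<le> max q \<sigma>" by auto
    then show ?thesis using width[OF N1 NS q(2)] False by (simp add: min_absorb2)
  qed
  moreover have "error_bound P n \<epsilon> \<sigma> (min q N) \<le> error_bound P n \<epsilon> \<sigma> q"
    "error_bound P n \<epsilon> \<sigma> (min q N) \<le> error_bound P n \<epsilon> \<sigma> N" by (intro error_bound_mono; simp)+
  ultimately show "\<bar>max q \<sigma> - max (quad_moment P \<theta>) \<sigma>\<bar> \<le> 2 * error_bound P n \<epsilon> \<sigma> q"
    "\<bar>max q \<sigma> - max (quad_moment P \<theta>) \<sigma>\<bar> \<le> 2 * error_bound P n \<epsilon> \<sigma> (quad_moment P \<theta>)"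
    unfolding N_def[symmetric] by linarith+
qed

end

section \<open>Passage from the net to the whole sphere\<close>

lemma finite_net_nearest:
  assumes "finite_net \<delta> (\<Theta> :: (real ^ 'd) set)" "norm \<theta> = 1"
  obtains \<zeta> where "\<zeta> \<in> \<Theta>" "norm \<zeta> = 1" "norm (\<theta> - \<zeta>) \<le> \<delta>"
proof -
  have \<Theta>: "finite \<Theta>" "\<Theta> \<noteq> {}" "\<Theta> \<subseteq> sphere 0 1"
    and sup: "(SUP \<theta>\<in>sphere 0 1. MIN \<xi>\<in>\<Theta>. norm (\<theta> - \<xi>)) \<le> \<delta>"
    using assms(1) by (auto simp: finite_net_def)
  obtain \<xi>0 where \<xi>0: "\<xi>0 \<in> \<Theta>" using \<Theta> by auto
  \<comment> \<open>The real supremum is informative once the set is known to be bounded; two points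
    of the sphere are at distance at most 2.\<close>
  have bdd: "bdd_above ((\<lambda>\<theta>. MIN \<xi>\<in>\<Theta>. norm (\<theta> - \<xi>)) ` sphere 0 1)"
  proof (rule bdd_aboveI2)
    fix y :: "real ^ 'd" assume "y \<in> sphere 0 1"
    then have "norm (y - \<xi>0) \<le> 2" using norm_triangle_ineq4[of y \<xi>0] \<Theta>(3) \<xi>0 by auto
    moreover have "(MIN \<xi>\<in>\<Theta>. norm (y - \<xi>)) \<le> norm (y - \<xi>0)" using \<Theta>(1) \<xi>0 by simp
    ultimately show "(MIN \<xi>\<in>\<Theta>. norm (y - \<xi>)) \<le> 2" by linarith
  qed
  have "(MIN \<xi>\<in>\<Theta>. norm (\<theta> - \<xi>)) \<le> \<delta>"
    using cSUP_upper[OF _ bdd, of \<theta>] assms(2) sup by simp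
  moreover have "(MIN \<xi>\<in>\<Theta>. norm (\<theta> - \<xi>)) \<in> (\<lambda>\<xi>. norm (\<theta> - \<xi>)) ` \<Theta>" using \<Theta> by (intro Min_in) auto
  ultimately obtain \<zeta> where "\<zeta> \<in> \<Theta>" "norm (\<theta> - \<zeta>) \<le> \<delta>" by auto
  then show ?thesis using that \<Theta>(3) by auto
qed

context grid_setup
begin

lemma sphere_bounds:
  fixes Q :: "real ^ 'd ^ 'd"
  assumes eb: "\<forall>(l, b)\<in>Lambda_grid P n \<epsilon>. emp_bounds P n \<epsilon> x l b"
    and \<delta>: "\<delta> > 0" and net: "finite_net \<delta> \<Theta>" and adm: "admissible P n \<epsilon> \<Theta> x Q" and \<theta>: "norm \<theta> = 1"
  defines "q \<equiv> \<theta> \<bullet> (positive_part Q *v \<theta>)"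
    and "N \<equiv> quad_moment P \<theta>" and "F \<equiv> sqrt (trace (gram_matrix P ** gram_matrix P))"
  shows "\<bar>max q \<sigma> - max N \<sigma>\<bar> \<le> 2 * error_bound P n \<epsilon> \<sigma> N + 7 * \<delta> * F"
    "\<bar>max q \<sigma> - max N \<sigma>\<bar> \<le> 2 * error_bound P n \<epsilon> \<sigma> q + 7 * \<delta> * F"
proof -
  have sym: "transpose Q = Q" and tr: "trace (Q ** Q) \<le> trace (gram_matrix P ** gram_matrix P)"
    and B: "\<And>\<zeta>. \<zeta> \<in> \<Theta> \<Longrightarrow> B_minus P n \<epsilon> x \<zeta> \<le> \<zeta> \<bullet> (Q *v \<zeta>)"
      "\<And>\<zeta>. \<zeta> \<in> \<Theta> \<Longrightarrow> ereal (\<zeta> \<bullet> (Q *v \<zeta>)) \<le> B_plus P n \<epsilon> x \<zeta>"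
    using adm by (auto simp: admissible_def)
  have F0: "0 \<le> F" unfolding F_def using trace_square[OF gram_symmetric] by (simp add: sum_nonneg)
  define D where "D = 2 * \<delta> * F"
  have D0: "0 \<le> D" using \<delta> F0 by (simp add: D_def)
  have lipQ: "\<bar>y \<bullet> (Q *v y) - \<zeta> \<bullet> (Q *v \<zeta>)\<bar> \<le> D"
    and lipG: "\<bar>quad_moment P y - quad_moment P \<zeta>\<bar> \<le> D"
    if "norm y = 1" "norm \<zeta> = 1" "norm (y - \<zeta>) \<le> \<delta>" for y \<zeta>
  proof -
    have "\<bar>y \<bullet> (Q *v y) - \<zeta> \<bullet> (Q *v \<zeta>)\<bar> \<le> 2 * norm (y - \<zeta>) * sqrt (trace (Q ** Q))"
      by (rule quadratic_form_lipschitz[OF sym that(1,2)])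
    also have "\<dots> \<le> D" unfolding D_def F_def using that(3) tr \<delta>
      trace_square[OF sym] by (intro mult_mono real_sqrt_le_mono) (auto simp: sum_nonneg)
    finally show "\<bar>y \<bullet> (Q *v y) - \<zeta> \<bullet> (Q *v \<zeta>)\<bar> \<le> D" .
    have "\<bar>quad_moment P y - quad_moment P \<zeta>\<bar> \<le> 2 * norm (y - \<zeta>) * F"
      using quadratic_form_lipschitz[OF gram_symmetric that(1,2)] by (simp add: gram_quadratic_form F_def)
    also have "\<dots> \<le> D" unfolding D_def using that(3) \<delta> F0 by (intro mult_mono) auto
    finally show "\<bar>quad_moment P y - quad_moment P \<zeta>\<bar> \<le> D" .
  qed
  have low: "- D \<le> y \<bullet> (Q *v y)" if y: "norm y = 1" for y
  proof -
    obtain \<zeta> where \<zeta>: "\<zeta> \<in> \<Theta>" "norm \<zeta> = 1" "norm (y - \<zeta>) \<le> \<delta>" using finite_net_nearest[OF net y] by metis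
    have "0 \<le> \<zeta> \<bullet> (Q *v \<zeta>)" using moment_in_bounds(3)[OF eb \<zeta>(2)] B(1)[OF \<zeta>(1)] by linarith
    then show ?thesis using lipQ[OF y \<zeta>(2,3)] by linarith
  qed
  obtain \<zeta> where \<zeta>: "\<zeta> \<in> \<Theta>" "norm \<zeta> = 1" "norm (\<theta> - \<zeta>) \<le> \<delta>" using finite_net_nearest[OF net \<theta>] by metis
  define q0 N0 where "q0 = \<zeta> \<bullet> (Q *v \<zeta>)" and "N0 = quad_moment P \<zeta>"
  note nb = net_point_bound(1,2)[OF eb \<zeta>(2) B[OF \<zeta>(1)], folded q0_def N0_def]
  \<comment> \<open>Moving from \<open>\<zeta>\<close> to \<open>\<theta>\<close> costs
    \<open>D\<close> either way; taking the positive part can add another \<open>D\<close>,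
    upwards.\<close>
  have dq: "q0 - D \<le> q" "q \<le> q0 + 2 * D"
    using lipQ[OF \<theta> \<zeta>(2,3)] positive_part_bounds[OF sym D0 low \<theta>] unfolding q_def q0_def by linarith+
  have dN: "\<bar>N - N0\<bar> \<le> D" using lipG[OF \<theta> \<zeta>(2,3)] by (simp add: N_def N0_def)
  define G where "G = error_bound P n \<epsilon> \<sigma>"
  have G_le: "G t \<le> G t' + max 0 (t - t') / 4" for t t'
    using error_bound_mono[of t t'] error_bound_lipschitz[of t' t] unfolding G_def by (cases "t \<le> t'") auto
  have diff: "\<bar>max q \<sigma> - max N \<sigma>\<bar> \<le> \<bar>max q0 \<sigma> - max N0 \<sigma>\<bar> + \<bar>q - q0\<bar> + \<bar>N - N0\<bar>"
    by (auto simp: max_def abs_if)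
  have "\<bar>max q \<sigma> - max N \<sigma>\<bar> \<le> 2 * G N0 + \<bar>q - q0\<bar> + \<bar>N - N0\<bar>" using diff nb(2) unfolding G_def by linarith
  \<comment> \<open>The total is \<open>D / 2 + 2 * D + D = 7 / 2 * D\<close>, that is
    \<open>7 * \<delta> * F\<close>.\<close>
  also have "\<dots> \<le> 2 * (G N + D / 4) + 2 * D + D"
  proof -
    have "max 0 (N0 - N) \<le> D" using dN D0 by simp
    then have "max 0 (N0 - N) / 4 \<le> D / 4" by simp
    then have "G N0 \<le> G N + D / 4" using G_le[of N0 N] by (rule order_trans[OF _ add_left_mono, rotated])
    moreover have "\<bar>q - q0\<bar> \<le> 2 * D" using dq D0 by auto
    ultimately show ?thesis using dN by argo
  qed
  finally show "\<bar>max q \<sigma> - max N \<sigma>\<bar> \<le> 2 * error_bound P n \<epsilon> \<sigma> N + 7 * \<delta> * F"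
    by (simp add: G_def D_def mult_ac)
  have "\<bar>max q \<sigma> - max N \<sigma>\<bar> \<le> 2 * G q0 + \<bar>q - q0\<bar> + \<bar>N - N0\<bar>" using diff nb(1) unfolding G_def by linarith
  \<comment> \<open>If \<open>q0 \<le> q\<close> monotonicity makes the change of \<open>G\<close>
    free. Otherwise \<open>q0 - q \<le> D\<close>, and the slope 1/4 costs \<open>D / 2\<close> in
    addition to \<open>2 * D\<close>.\<close>
  also have "\<dots> \<le> 2 * G q + 3 * D"
  proof (cases "q0 \<le> q")
    case True
    then show ?thesis using G_le[of q0 q] dq dN by simp
  next
    case False
    then have "G q0 \<le> G q + (q0 - q) / 4" "\<bar>q - q0\<bar> = q0 - q" using G_le[of q0 q] by simp_all
    then show ?thesis using dq dN D0 by argo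
  qed
  also have "\<dots> \<le> 2 * G q + 7 * (\<delta> * F)" 
  proof -
    have "0 \<le> \<delta> * F" using \<delta> F0 by (intro mult_nonneg_nonneg) auto
    moreover have "3 * D = 6 * (\<delta> * F)" by (simp only: D_def mult.assoc)
    ultimately show ?thesis by argo
  qed
  finally show "\<bar>max q \<sigma> - max N \<sigma>\<bar> \<le> 2 * error_bound P n \<epsilon> \<sigma> q + 7 * \<delta> * F"
    by (simp add: G_def mult.assoc)
qed

end

theorem proposition2p5:
  fixes M :: "'w measure" and P :: "(real ^ 'd) measure"
    and X :: "nat \<Rightarrow> 'w \<Rightarrow> real ^ 'd" and n :: nat
    and \<epsilon> \<delta> \<sigma> :: real and \<Theta> :: "(real ^ 'd) set"
    and Q :: "(nat \<Rightarrow> real ^ 'd) \<Rightarrow> real ^ 'd ^ 'd"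
  assumes "prob_space P" and "sets P = sets borel"
    and "prob_space M" and "n \<ge> 1"
    and "prob_space.indep_vars M (\<lambda>_. borel) X {1..n}"
    and "\<And>i. i \<in> {1..n} \<Longrightarrow> distr M borel (X i) = P"
    and "integrable P (\<lambda>x. norm x ^ 4)"
    and "bdd_above (kurtosis_ratios P)"
    and "kappa P \<ge> 3 / 2"
    and "grid_size P n \<ge> 1"
    and "0 < \<epsilon>" and "\<epsilon> < 1" and "\<delta> > 0"
    and "0 < \<sigma>" and "\<sigma> \<le> (s4 P)\<^sup>2"
    and "8 * zeta_star P n \<epsilon> \<sigma> \<le> sqrt (real n)"
    and "finite_net \<delta> \<Theta>"
    and "\<And>\<omega>. \<omega> \<in> space M \<Longrightarrow>
           transpose (Q (\<lambda>i\<in>{1..n}. X i \<omega>)) = Q (\<lambda>i\<in>{1..n}. X i \<omega>)"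
    and "\<And>\<omega>. \<omega> \<in> space M \<Longrightarrow> \<exists>S. admissible P n \<epsilon> \<Theta> (\<lambda>i\<in>{1..n}. X i \<omega>) S \<Longrightarrow>
           admissible P n \<epsilon> \<Theta> (\<lambda>i\<in>{1..n}. X i \<omega>) (Q (\<lambda>i\<in>{1..n}. X i \<omega>))"
  shows "\<exists>E \<in> sets M. measure M E \<ge> 1 - 2 * \<epsilon> \<and>
    (\<forall>\<omega>\<in>E. \<forall>\<theta>\<in>sphere 0 1.
      (let q = \<theta> \<bullet> (positive_part (Q (\<lambda>i\<in>{1..n}. X i \<omega>)) *v \<theta>);
           N = quad_moment P \<theta>;
           err = 7 * \<delta> * sqrt (trace (gram_matrix P ** gram_matrix P))
       in ereal \<bar>max q \<sigma> - max N \<sigma>\<bar>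
            \<le> ereal (2 * max N \<sigma>) * B_star P n \<epsilon> \<sigma> N + ereal err
        \<and> ereal \<bar>max q \<sigma> - max N \<sigma>\<bar>
            \<le> ereal (2 * max q \<sigma>) * B_star P n \<epsilon> \<sigma> (min q ((s4 P)\<^sup>2)) + ereal err))"
proof -
  interpret quartic_law P using assms(1,2,7,8,9) by (rule quartic_law.intro)
  interpret grid_setup P n \<epsilon> \<sigma>
    using assms(4,10,11,12,14,15,16) by (intro grid_setup.intro quartic_law_axioms grid_setup_axioms.intro)
  define x where "x \<omega> = (\<lambda>i\<in>{1..n}. X i \<omega>)" for \<omega>
  obtain E where E: "E \<in> sets M" "measure M E \<ge> 1 - 2 * \<epsilon>"
    and eb: "\<And>\<omega>. \<omega> \<in> E \<Longrightarrow> \<forall>(l, b)\<in>Lambda_grid P n \<epsilon>. emp_bounds P n \<epsilon> (x \<omega>) l b"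
    using emp_bounds_event[OF assms(3,5,6) assms(4,10,11,12) s4_pos] unfolding x_def by blast
  show ?thesis
    unfolding Let_def
  proof (intro bexI[of _ E] conjI ballI)
    show "1 - 2 * \<epsilon> \<le> measure M E" by (rule E(2))
    fix \<omega> and \<theta> :: "real ^ 'd" assume \<omega>: "\<omega> \<in> E" and \<theta>: "\<theta> \<in> sphere 0 1"
    have \<omega>M: "\<omega> \<in> space M" using \<omega> E(1) sets.sets_into_space by blast
    have "admissible P n \<epsilon> \<Theta> (x \<omega>) (gram_matrix P)"
      unfolding admissible_def
    proof (intro conjI ballI)
      fix \<zeta> assume "\<zeta> \<in> \<Theta>"
      then have \<zeta>: "norm \<zeta> = 1" using assms(17) by (auto simp: finite_net_def)
      show "B_minus P n \<epsilon> (x \<omega>) \<zeta> \<le> \<zeta> \<bullet> (gram_matrix P *v \<zeta>)"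
        "ereal (\<zeta> \<bullet> (gram_matrix P *v \<zeta>)) \<le> B_plus P n \<epsilon> (x \<omega>) \<zeta>"
        using moment_in_bounds[OF eb[OF \<omega>] \<zeta>] by (simp_all add: gram_quadratic_form)
    qed (simp_all add: gram_symmetric)
    then have adm: "admissible P n \<epsilon> \<Theta> (x \<omega>) (Q (x \<omega>))"
      using assms(19)[OF \<omega>M] unfolding x_def by blast
    have \<theta>1: "norm \<theta> = 1" using \<theta> by simp
    define q where "q = \<theta> \<bullet> (positive_part (Q (x \<omega>)) *v \<theta>)"
    note sb = sphere_bounds[OF eb[OF \<omega>] assms(13,17) adm \<theta>1, folded q_def]
    \<comment> \<open>The truncation inside \<open>error_bound\<close> is thereby removed for the
      true moment, as the first inequality has none.\<close>
    have NS: "min (quad_moment P \<theta>) ((s4 P)\<^sup>2) = quad_moment P \<theta>" using quad_moment_le[OF \<theta>1] by simp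
    show "ereal \<bar>max (\<theta> \<bullet> (positive_part (Q (\<lambda>i\<in>{1..n}. X i \<omega>)) *v \<theta>)) \<sigma> - max (quad_moment P \<theta>) \<sigma>\<bar>
          \<le> ereal (2 * max (quad_moment P \<theta>) \<sigma>) * B_star P n \<epsilon> \<sigma> (quad_moment P \<theta>)
            + ereal (7 * \<delta> * sqrt (trace (gram_matrix P ** gram_matrix P)))"
      using sb(1) unfolding x_def[symmetric] q_def[symmetric] B_star_eq error_bound_def NS
      by (simp add: mult.assoc)
    show "ereal \<bar>max (\<theta> \<bullet> (positive_part (Q (\<lambda>i\<in>{1..n}. X i \<omega>)) *v \<theta>)) \<sigma> - max (quad_moment P \<theta>) \<sigma>\<bar>
          \<le> ereal (2 * max (\<theta> \<bullet> (positive_part (Q (\<lambda>i\<in>{1..n}. X i \<omega>)) *v \<theta>)) \<sigma>)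
              * B_star P n \<epsilon> \<sigma> (min (\<theta> \<bullet> (positive_part (Q (\<lambda>i\<in>{1..n}. X i \<omega>)) *v \<theta>)) ((s4 P)\<^sup>2))
            + ereal (7 * \<delta> * sqrt (trace (gram_matrix P ** gram_matrix P)))"
      using sb(2) unfolding x_def[symmetric] q_def[symmetric] B_star_eq error_bound_def
      by (simp add: mult.assoc)
  qed (rule E(1))
qed

end
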